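(* Let $k>n\ge0$ be integers, and use the $\mathrm{SL}(\mathbb V)$-equivariant isomorphisms described in the context. If $k-1>n\geq0$, then the natural projection $J^k(L^n)\to J^{k-1}(L^n)$ is the homomorphism $$\mathbb V_n\oplus(L^{-(k+1)}\otimes\mathbb V_{k-n-1})\longrightarrow\mathbb V_n\oplus(L^{-k}\otimes\mathbb V_{k-n-2})$$ which is the direct sum of the identity map of $\mathbb V_n$ and the natural contraction map $L^{-(k+1)}\otimes\mathbb V_{k-n-1}\to L^{-k}\otimes\mathbb V_{k-n-2}$. If $k-1=n\geq0$, then the natural projection $J^k(L^n)\to J^{k-1}(L^n)$ is the homomorphism $$\mathbb V_n\oplus(L^{-(k+1)}\otimes\mathbb V_{k-n-1})\longrightarrow\mathbb V_n$$ which is the direct sum of the identity map of $\mathbb V_n$ and the zero homomorphism of $L^{-(k+1)}\otimes\mathbb V_{k-n-1}=L^{-(k+1)}$.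
   Context: $\mathbb V$ is a two-dimensional complex vector space with a fixed $0\ne\omega\in\bigwedge^2\mathbb V$, $X=\mathbb P(\mathbb V)$ is the space of lines $\xi\subset\mathbb V$. $\mathbb L\subset X\times\mathbb V$ is the tautological subbundle (fiber $\xi$ over $\xi$), $L=(X\times\mathbb V)/\mathbb L$; negative powers of a line bundle are powers of its dual. $\omega$ gives $\mathbb V^*\cong\mathbb V$ and $L^{-1}\cong\mathbb L$ (via $\mathbb L\otimes L=X\times\bigwedge^2\mathbb V$). $\mathbb V_j=X\times\mathrm{Sym}^j(\mathbb V)$, $\mathbb V_0=\mathcal O_X$. $\mathrm{SL}(\mathbb V)$ acts naturally on all these bundles. $J^k(W)=p_{1*}\bigl(p_2^*W/(p_2^*W\otimes\mathcal O_{X\times X}(-(k+1)\Delta))\bigr)$, with $p_1,p_2:X\times X\to X$ the projections and $\Delta$ the diagonal; the natural projection $J^k(W)\to J^{k-1}(W)$ is induced by $\mathcal O(-(k+1)\Delta)\subset\mathcal O(-k\Delta)$. Isomorphisms. For $k=n$: $J^n(L^n)=\mathbb V_n$ by the map $\mathbb V_n=X\times H^0(X,L^n)\to J^n(L^n)$ taking a global section to its $n$-jet. For $k>n\ge0$: let $\gamma_3:\mathbb V_n=X\times H^0(X,L^n)\to J^k(L^n)$ take a global section to its $k$-jet, and let $\beta:J^k(L^n)\to J^n(L^n)=\mathbb V_n$ be the natural projection; then $\beta\circ\gamma_3=\mathrm{Id}$, so $J^k(L^n)=\mathrm{image}(\gamma_3)\oplus\mathrm{kernel}(\beta)$. The connecting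 homomorphism $J^k(L^n)\to R^1p_{1*}(p_2^*L^n\otimes\mathcal O(-(k+1)\Delta))$ restricts to an isomorphism on $\mathrm{kernel}(\beta)$, and its target is identified with $\mathbb L^{k+1}\otimes\mathbb V^*_{k-n-1}=L^{-(k+1)}\otimes\mathbb V_{k-n-1}$ using $\mathcal O_{X\times X}(\Delta)\cong p_1^*L\otimes p_2^*L$ (given by the section of $p_1^*L\otimes p_2^*L$ defined by $\omega\in\mathbb V\otimes\mathbb V$), its restriction $L^2\cong TX$ to the diagonal, the projection formula, Serre duality ($H^1(X,L^{-m-2})=\mathrm{Sym}^m(\mathbb V)^*$), $\mathbb V^*\cong\mathbb V$ and $\mathbb L\cong L^{-1}$. Thus $J^k(L^n)=\mathbb V_n\oplus(L^{-(k+1)}\otimes\mathbb V_{k-n-1})$. The natural contraction map $L^{-(k+1)}\otimes\mathbb V_{k-n-1}\to L^{-k}\otimes\mathbb V_{k-n-2}$ is the contraction $\mathbb L\otimes\mathbb V_j^*\to\mathbb V_{j-1}^*$ (with $\mathbb L\subset X\times\mathbb V$, $j=k-n-1$) induced by $\mathbb V\otimes(\mathbb V^* )^{\otimes j}\to(\mathbb V^* )^{\otimes(j-1)}$, tensored with $\mathbb L^{k}$, under the identifications $\mathbb L\cong L^{-1}$ and $\mathbb V_i^*\cong\mathbb V_i$ given by $\omega$. *)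

theory Defs
  imports "HOL-Complex_Analysis.Complex_Analysis"
begin

section \<open>Sheaves of functions, quotient sheaves and Cech cohomology\<close>

text \<open>
  Every sheaf below is a sheaf on a space \<open>T\<close> with points of type \<open>'m\<close> whose sections are
  complex functions on a bundle \<open>C\<close> of fibres \<open>C p\<close> over the points \<open>p\<close>.  It is given by a
  function \<open>F\<close> such that \<open>F N\<close> consists of the total functions that are sections over the open
  set \<open>N\<close>; their values outside the fibres over \<open>N\<close> are irrelevant.
\<close>

definition agree_on :: "('m \<Rightarrow> 'y set) \<Rightarrow> 'm set \<Rightarrow> ('y \<Rightarrow> complex) \<Rightarrow> ('y \<Rightarrow> complex) \<Rightarrow> bool" where
  "agree_on C N f g \<longleftrightarrow> (\<forall>p\<in>N. \<forall>y\<in>C p. f y = g y)"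

text \<open>The element \<open>f + G_p\<close> of the stalk \<open>F_p / G_p\<close>, as the set of all its representatives.\<close>

definition stalk_class ::
  "'m topology \<Rightarrow> ('m set \<Rightarrow> ('y \<Rightarrow> complex) set) \<Rightarrow> ('m set \<Rightarrow> ('y \<Rightarrow> complex) set) \<Rightarrow>
   'm \<Rightarrow> ('y \<Rightarrow> complex) \<Rightarrow> ('y \<Rightarrow> complex) set" where
  "stalk_class T F G p f =
     {f'. \<exists>N. openin T N \<and> p \<in> N \<and> f \<in> F N \<and> f' \<in> F N \<and> (\<lambda>y. f y - f' y) \<in> G N}"

text \<open>
  Sections over \<open>N\<close> of the quotient sheaf \<open>F/G\<close> (the sheafification of \<open>N \<mapsto> F N / G N\<close>):
  functions into the stalks which are locally induced by sections of \<open>F\<close>.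
\<close>

definition quotient_sections ::
  "'m topology \<Rightarrow> ('m set \<Rightarrow> ('y \<Rightarrow> complex) set) \<Rightarrow> ('m set \<Rightarrow> ('y \<Rightarrow> complex) set) \<Rightarrow>
   'm set \<Rightarrow> ('m \<Rightarrow> ('y \<Rightarrow> complex) set) set" where
  "quotient_sections T F G N =
     {q. (\<forall>p\<in>N. \<exists>N'. openin T N' \<and> p \<in> N' \<and> N' \<subseteq> N \<and>
              (\<exists>f\<in>F N'. \<forall>p'\<in>N'. q p' = stalk_class T F G p' f)) \<and>
         (\<forall>p. p \<notin> N \<longrightarrow> q p = {})}"

text \<open>The map \<open>F/G \<rightarrow> F/G'\<close> induced by an inclusion \<open>G \<subseteq> G'\<close> of subsheaves of \<open>F\<close>.\<close>

definition quotient_map_to ::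
  "'m topology \<Rightarrow> ('m set \<Rightarrow> ('y \<Rightarrow> complex) set) \<Rightarrow> ('m set \<Rightarrow> ('y \<Rightarrow> complex) set) \<Rightarrow>
   ('m \<Rightarrow> ('y \<Rightarrow> complex) set) \<Rightarrow> ('m \<Rightarrow> ('y \<Rightarrow> complex) set)" where
  "quotient_map_to T F G' q = (\<lambda>p. {f'. \<exists>f\<in>q p. f' \<in> stalk_class T F G' p f})"

definition quotient_diff ::
  "'m topology \<Rightarrow> ('m set \<Rightarrow> ('y \<Rightarrow> complex) set) \<Rightarrow> ('m set \<Rightarrow> ('y \<Rightarrow> complex) set) \<Rightarrow>
   ('m \<Rightarrow> ('y \<Rightarrow> complex) set) \<Rightarrow> ('m \<Rightarrow> ('y \<Rightarrow> complex) set) \<Rightarrow> ('m \<Rightarrow> ('y \<Rightarrow> complex) set)" where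
  "quotient_diff T F G q1 q2 =
     (\<lambda>p. {f. \<exists>f1\<in>q1 p. \<exists>f2\<in>q2 p. f \<in> stalk_class T F G p (\<lambda>y. f1 y - f2 y)})"

text \<open>
  Cech 1-cocycles of \<open>G\<close> over \<open>N\<close>, for open covers \<open>W\<close> of \<open>N\<close> indexed by the points of \<open>N\<close>
  with \<open>p \<in> W p\<close>.  Such covers are cofinal among all open covers, and two cocycles have the same
  class in the direct limit \<open>H\<^sup>1(N, G)\<close> iff they become cohomologous after shrinking both covers
  pointwise.
\<close>

type_synonym ('m, 'y) cochain = "('m \<Rightarrow> 'm set) \<times> ('m \<Rightarrow> 'm \<Rightarrow> 'y \<Rightarrow> complex)"

definition cocycles ::
  "'m topology \<Rightarrow> ('m \<Rightarrow> 'y set) \<Rightarrow> ('m set \<Rightarrow> ('y \<Rightarrow> complex) set) \<Rightarrow> 'm set \<Rightarrow>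
   ('m, 'y) cochain set" where
  "cocycles T C G N =
     {(W, g).
        (\<forall>p\<in>N. openin T (W p) \<and> p \<in> W p \<and> W p \<subseteq> N) \<and>
        (\<forall>p\<in>N. \<forall>p'\<in>N. g p p' \<in> G (W p \<inter> W p')) \<and>
        (\<forall>p\<in>N. \<forall>p'\<in>N. \<forall>p''\<in>N. agree_on C (W p \<inter> W p' \<inter> W p'')
           (\<lambda>y. g p p' y + g p' p'' y) (g p p''))}"

fun cohomologous ::
  "'m topology \<Rightarrow> ('m \<Rightarrow> 'y set) \<Rightarrow> ('m set \<Rightarrow> ('y \<Rightarrow> complex) set) \<Rightarrow> 'm set \<Rightarrow>
   ('m, 'y) cochain \<Rightarrow> ('m, 'y) cochain \<Rightarrow> bool" where
  "cohomologous T C G N (W, g) (W', g') \<longleftrightarrow>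
     (\<exists>V h. (\<forall>p\<in>N. openin T (V p) \<and> p \<in> V p \<and> V p \<subseteq> W p \<inter> W' p \<and> h p \<in> G (V p)) \<and>
            (\<forall>p\<in>N. \<forall>p'\<in>N. agree_on C (V p \<inter> V p')
               (\<lambda>y. g' p p' y - g p p' y) (\<lambda>y. h p' y - h p y)))"

fun restrict_cochain :: "'m set \<Rightarrow> ('m, 'y) cochain \<Rightarrow> ('m, 'y) cochain" where
  "restrict_cochain N (W, g) = ((\<lambda>p. W p \<inter> N), g)"

text \<open>
  The connecting homomorphism \<open>H\<^sup>0(N, F/G) \<rightarrow> H\<^sup>1(N, G)\<close>; its values are cohomology classes, i.e.
  sets of cohomologous cocycles.
\<close>

definition connecting_hom ::
  "'m topology \<Rightarrow> ('m \<Rightarrow> 'y set) \<Rightarrow> ('m set \<Rightarrow> ('y \<Rightarrow> complex) set) \<Rightarrow>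
   ('m set \<Rightarrow> ('y \<Rightarrow> complex) set) \<Rightarrow> 'm set \<Rightarrow>
   ('m \<Rightarrow> ('y \<Rightarrow> complex) set) \<Rightarrow> ('m, 'y) cochain set" where
  "connecting_hom T C F G N q =
     {c \<in> cocycles T C G N.
        \<exists>W f. (\<forall>p\<in>N. openin T (W p) \<and> p \<in> W p \<and> W p \<subseteq> N \<and> f p \<in> F (W p) \<and>
                 (\<forall>p'\<in>W p. q p' = stalk_class T F G p' (f p))) \<and>
              cohomologous T C G N (W, \<lambda>p p' y. f p' y - f p y) c}"

text \<open>
  Holomorphic functions of two variables on an open set: complex differentiable at every point.
\<close>

definition holomorphic2_on :: "(complex \<times> complex \<Rightarrow> complex) \<Rightarrow> (complex \<times> complex) set \<Rightarrow> bool" where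
  "holomorphic2_on f S \<longleftrightarrow>
     (\<forall>p\<in>S. \<exists>a b. (f has_derivative (\<lambda>(s, t). a * s + b * t)) (at p))"


section \<open>The projective line\<close>

type_synonym 'v covector = "'v \<Rightarrow> complex"

locale complex_plane = vector_space scale
  for scale :: "complex \<Rightarrow> 'v::ab_group_add \<Rightarrow> 'v" +
  assumes dim_plane: "dim (UNIV :: 'v set) = 2"
begin

definition dual :: "'v covector set" where
  "dual = {l. Vector_Spaces.linear scale (*) l}"

definition X :: "'v set set" where
  "X = {\<xi>. subspace \<xi> \<and> dim \<xi> = 1}"

definition line :: "'v covector \<Rightarrow> 'v set" where
  "line l = {v. l v = 0}"

text \<open>
  A basis \<open>(l, m)\<close> of the dual plane gives the affine chart \<open>z \<mapsto> line (pencil l m z)\<close> of \<open>X\<close>.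
\<close>

definition frame :: "'v covector \<Rightarrow> 'v covector \<Rightarrow> bool" where
  "frame l m \<longleftrightarrow> l \<in> dual \<and> m \<in> dual \<and> (\<forall>v. l v = 0 \<longrightarrow> m v = 0 \<longrightarrow> v = 0)"

definition pencil :: "'v covector \<Rightarrow> 'v covector \<Rightarrow> complex \<Rightarrow> 'v covector" where
  "pencil l m z = (\<lambda>v. l v + z * m v)"

definition X_top :: "'v set topology" where
  "X_top = topology (\<lambda>U. U \<subseteq> X \<and> (\<forall>l m. frame l m \<longrightarrow> open {z. line (pencil l m z) \<in> U}))"

lemma openin_X_top:
  "openin X_top U \<longleftrightarrow> U \<subseteq> X \<and> (\<forall>l m. frame l m \<longrightarrow> open {z. line (pencil l m z) \<in> U})"
proof -
  let ?P = "\<lambda>U. U \<subseteq> X \<and> (\<forall>l m. frame l m \<longrightarrow> open {z. line (pencil l m z) \<in> U})"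
  have "istopology ?P"
    unfolding istopology_def
  proof (intro conjI allI impI)
    fix S R assume S: "?P S" and R: "?P R"
    show "S \<inter> R \<subseteq> X" using S by blast
    fix l m assume "frame l m"
    moreover have "{z. line (pencil l m z) \<in> S \<inter> R} =
        {z. line (pencil l m z) \<in> S} \<inter> {z. line (pencil l m z) \<in> R}" by blast
    ultimately show "open {z. line (pencil l m z) \<in> S \<inter> R}" using S R by (metis open_Int)
  next
    fix \<K> assume K: "\<forall>K\<in>\<K>. ?P K"
    show "\<Union>\<K> \<subseteq> X" using K by blast
    fix l m assume "frame l m"
    moreover have "{z. line (pencil l m z) \<in> \<Union>\<K>} = (\<Union>K\<in>\<K>. {z. line (pencil l m z) \<in> K})"
      by blast
    ultimately show "open {z. line (pencil l m z) \<in> \<Union>\<K>}" using K by (metis (no_types) open_UN)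
  qed
  then show ?thesis by (simp add: X_top_def)
qed

definition XX_top :: "('v set \<times> 'v set) topology" where
  "XX_top = prod_topology X_top X_top"

text \<open>
  For \<open>\<xi> \<in> X\<close>, the set \<open>cone \<xi>\<close> is the set of nonzero vectors of the line \<open>(V/\<xi>)\<^sup>*\<close>, which is the
  fibre of \<open>L\<^sup>-\<^sup>1\<close> at \<open>\<xi>\<close>.  For a vector space \<open>W\<close> and any integer \<open>d\<close>, we represent the
  fibre of \<open>L\<^sup>d \<otimes> W\<close> at \<open>\<xi>\<close> by the functions \<open>f : cone \<xi> \<rightarrow> W\<close> that are homogeneous of degree \<open>d\<close>;
  for \<open>d = -e\<close> with \<open>e \<ge> 0\<close> the function \<open>f\<close> represents the element \<open>l \<otimes> \<dots> \<otimes> l \<otimes> f(l)\<close> (with \<open>e\<close>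
  factors \<open>l\<close>, independent of \<open>l\<close>), and for \<open>d = 1\<close> the class of \<open>v\<close> in \<open>V/\<xi>\<close> is \<open>l \<mapsto> l(v)\<close>.
  Tensor products of powers of \<open>L\<close> become products of functions.
\<close>

definition cone :: "'v set \<Rightarrow> 'v covector set" where
  "cone \<xi> = {l \<in> dual. line l = \<xi>}"

definition L_sections :: "int \<Rightarrow> 'v set set \<Rightarrow> ('v covector \<Rightarrow> complex) set" where
  "L_sections d U =
     {f. (\<forall>\<xi>\<in>U. \<forall>l\<in>cone \<xi>. \<forall>c. c \<noteq> 0 \<longrightarrow> f (\<lambda>v. c * l v) = c powi d * f l) \<and>
         (\<forall>l m. frame l m \<longrightarrow> (\<lambda>z. f (pencil l m z)) holomorphic_on {z. line (pencil l m z) \<in> U})}"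

definition cone2 :: "'v set \<times> 'v set \<Rightarrow> ('v covector \<times> 'v covector) set" where
  "cone2 = (\<lambda>(\<xi>, \<eta>). cone \<xi> \<times> cone \<eta>)"

text \<open>The sheaf \<open>p\<^sub>1\<^sup>* L\<^sup>a \<otimes> p\<^sub>2\<^sup>* L\<^sup>b\<close> on \<open>X \<times> X\<close>; in particular \<open>p\<^sub>2\<^sup>* L\<^sup>b\<close> for \<open>a = 0\<close>.\<close>

definition LL_sections ::
  "int \<Rightarrow> int \<Rightarrow> ('v set \<times> 'v set) set \<Rightarrow> ('v covector \<times> 'v covector \<Rightarrow> complex) set" where
  "LL_sections a b N =
     {f. (\<forall>p\<in>N. \<forall>(l, m)\<in>cone2 p. \<forall>c. c \<noteq> 0 \<longrightarrow>
            f (\<lambda>v. c * l v, m) = c powi a * f (l, m) \<and>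
            f (l, \<lambda>v. c * m v) = c powi b * f (l, m)) \<and>
         (\<forall>l m l' m'. frame l m \<longrightarrow> frame l' m' \<longrightarrow>
            holomorphic2_on (\<lambda>(z, w). f (pencil l m z, pencil l' m' w))
              {(z, w). (line (pencil l m z), line (pencil l' m' w)) \<in> N})}"

text \<open>
  The subsheaf \<open>p\<^sub>2\<^sup>* L\<^sup>b \<otimes> \<O>(-k\<Delta>)\<close> of \<open>p\<^sub>2\<^sup>* L\<^sup>b\<close>: in an affine chart (used on both
  factors), \<open>z - w\<close> is a local equation of the diagonal.
\<close>

definition vanishing_sections ::
  "nat \<Rightarrow> int \<Rightarrow> ('v set \<times> 'v set) set \<Rightarrow> ('v covector \<times> 'v covector \<Rightarrow> complex) set" where
  "vanishing_sections k b N =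
     {f \<in> LL_sections 0 b N.
        \<forall>l m z\<^sub>0. frame l m \<longrightarrow> (line (pencil l m z\<^sub>0), line (pencil l m z\<^sub>0)) \<in> N \<longrightarrow>
          (\<exists>S h. open S \<and> (z\<^sub>0, z\<^sub>0) \<in> S \<and> holomorphic2_on h S \<and>
             (\<forall>(z, w)\<in>S. f (pencil l m z, pencil l m w) = (z - w) ^ k * h (z, w)))}"


section \<open>Jet bundles\<close>

text \<open>
  \<open>Jet k n U\<close> is the space of sections of \<open>J\<^sup>k(L\<^sup>n)\<close> over the open set \<open>U\<close>, that is, of
  \<open>p\<^sub>2\<^sup>* L\<^sup>n / (p\<^sub>2\<^sup>* L\<^sup>n \<otimes> \<O>(-(k+1)\<Delta>))\<close> over \<open>U \<times> X\<close>.
\<close>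

type_synonym 'w jet_section =
  "'w set \<times> 'w set \<Rightarrow> ('w covector \<times> 'w covector \<Rightarrow> complex) set"

definition Jet :: "nat \<Rightarrow> nat \<Rightarrow> 'v set set \<Rightarrow> 'v jet_section set" where
  "Jet k n U =
     quotient_sections XX_top (LL_sections 0 (int n)) (vanishing_sections (k + 1) (int n)) (U \<times> X)"

text \<open>The natural projection from \<open>J\<^sup>k(L\<^sup>n)\<close>, for any \<open>k \<ge> j\<close>, to \<open>J\<^sup>j(L\<^sup>n)\<close>.\<close>

definition jet_proj :: "nat \<Rightarrow> nat \<Rightarrow> 'v jet_section \<Rightarrow> 'v jet_section" where
  "jet_proj j n = quotient_map_to XX_top (LL_sections 0 (int n)) (vanishing_sections (j + 1) (int n))"

text \<open>
  \<open>Sym\<^sup>j(V)\<close>, as the space of polynomial functions on the dual plane that are homogeneous of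
  degree \<open>j\<close>: the product \<open>v\<^sub>1 \<cdots> v\<^sub>j\<close> is the function \<open>y \<mapsto> y(v\<^sub>1) \<cdots> y(v\<^sub>j)\<close>.  The restriction of
  such a function to the cones is the corresponding global section of \<open>L\<^sup>j\<close>.
\<close>

definition Sym :: "nat \<Rightarrow> ('v covector \<Rightarrow> complex) set" where
  "Sym j = {P. \<exists>(N::nat) c v. P = (\<lambda>y. if y \<in> dual then \<Sum>i<N. c i * (\<Prod>r<j. y (v i r)) else 0)}"

text \<open>Sections over \<open>U\<close> of the trivial bundle \<open>V\<^sub>n\<close> with fibre \<open>Sym\<^sup>n(V)\<close>, extended by zero.\<close>

definition V_sections :: "nat \<Rightarrow> 'v set set \<Rightarrow> ('v set \<Rightarrow> 'v covector \<Rightarrow> complex) set" where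
  "V_sections n U =
     {\<sigma>. (\<forall>\<xi>\<in>U. \<sigma> \<xi> \<in> Sym n) \<and> (\<forall>\<xi>. \<xi> \<notin> U \<longrightarrow> \<sigma> \<xi> = (\<lambda>y. 0)) \<and>
         (\<forall>l m y. frame l m \<longrightarrow> y \<in> dual \<longrightarrow>
            (\<lambda>z. \<sigma> (line (pencil l m z)) y) holomorphic_on {z. line (pencil l m z) \<in> U})}"

text \<open>The homomorphism \<open>V\<^sub>n \<rightarrow> J\<^sup>k(L\<^sup>n)\<close> taking a global section of \<open>L\<^sup>n\<close> to its \<open>k\<close>-jet.\<close>

definition jet_of ::
  "nat \<Rightarrow> nat \<Rightarrow> 'v set set \<Rightarrow> ('v set \<Rightarrow> 'v covector \<Rightarrow> complex) \<Rightarrow> 'v jet_section" where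
  "jet_of k n U \<sigma> = (\<lambda>p. if p \<in> U \<times> X
     then stalk_class XX_top (LL_sections 0 (int n)) (vanishing_sections (k + 1) (int n)) p
            (\<lambda>(l, y). \<sigma> (line l) y)
     else {})"

text \<open>The isomorphism \<open>J\<^sup>n(L\<^sup>n) = V\<^sub>n\<close>, and the homomorphism \<open>J\<^sup>k(L\<^sup>n) \<rightarrow> J\<^sup>n(L\<^sup>n) = V\<^sub>n\<close>.\<close>

definition jet_iso_n ::
  "nat \<Rightarrow> 'v set set \<Rightarrow> 'v jet_section \<Rightarrow> ('v set \<Rightarrow> 'v covector \<Rightarrow> complex)" where
  "jet_iso_n n U = the_inv_into (V_sections n U) (jet_of n n U)"

definition \<beta> ::
  "nat \<Rightarrow> 'v set set \<Rightarrow> 'v jet_section \<Rightarrow> ('v set \<Rightarrow> 'v covector \<Rightarrow> complex)" where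
  "\<beta> n U q = jet_iso_n n U (jet_proj n n q)"

text \<open>
  A section \<open>r\<close> of a first direct image \<open>R\<^sup>1p\<^sub>1\<^sub>* G\<close> (the sheafification of \<open>U \<mapsto> H\<^sup>1(U \<times> X, G)\<close>) is
  given by its germs: \<open>r \<xi>\<close> is the set of all pairs \<open>(U', c)\<close> where \<open>U'\<close> is an open neighbourhood
  of \<open>\<xi>\<close> and \<open>c\<close> a cocycle over \<open>U' \<times> X\<close> representing the germ.
\<close>

type_synonym 'w direct_image_section =
  "'w set \<Rightarrow> ('w set set \<times> ('w set \<times> 'w set, 'w covector \<times> 'w covector) cochain) set"

definition direct_image_germ ::
  "(('v set \<times> 'v set) set \<Rightarrow> ('v covector \<times> 'v covector \<Rightarrow> complex) set) \<Rightarrow>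
   'v set set \<Rightarrow> ('v set \<times> 'v set, 'v covector \<times> 'v covector) cochain \<Rightarrow>
   'v direct_image_section" where
  "direct_image_germ G U c \<xi> =
     {(U', c'). openin X_top U' \<and> \<xi> \<in> U' \<and> c' \<in> cocycles XX_top cone2 G (U' \<times> X) \<and>
        (\<exists>U''. openin X_top U'' \<and> \<xi> \<in> U'' \<and> U'' \<subseteq> U \<inter> U' \<and>
           cohomologous XX_top cone2 G (U'' \<times> X)
             (restrict_cochain (U'' \<times> X) c) (restrict_cochain (U'' \<times> X) c'))}"

text \<open>The connecting homomorphism from \<open>J\<^sup>k(L\<^sup>n)\<close> to \<open>R\<^sup>1p\<^sub>1\<^sub>*(p\<^sub>2\<^sup>* L\<^sup>n \<otimes> \<O>(-(k+1)\<Delta>))\<close>.\<close>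

definition jet_connecting ::
  "nat \<Rightarrow> nat \<Rightarrow> 'v set set \<Rightarrow> 'v jet_section \<Rightarrow> 'v direct_image_section" where
  "jet_connecting k n U q =
     (\<lambda>\<xi>. if \<xi> \<in> U then
        (\<Union>c \<in> connecting_hom XX_top cone2 (LL_sections 0 (int n))
                (vanishing_sections (k + 1) (int n)) (U \<times> X) q.
           direct_image_germ (vanishing_sections (k + 1) (int n)) U c \<xi>)
        else {})"

text \<open>
  The projection formula \<open>R\<^sup>1p\<^sub>1\<^sub>*(p\<^sub>1\<^sup>* L\<^sup>a \<otimes> p\<^sub>2\<^sup>* L\<^sup>b) = L\<^sup>a \<otimes> H\<^sup>1(X, L\<^sup>b)\<close>.  In accordance with the
  representation of \<open>L\<^sup>a \<otimes> W\<close> above, a section of the right hand side is a function from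
  covectors to cohomology classes.  The class at \<open>l \<in> cone \<xi>\<close> is obtained by restricting to
  \<open>{\<xi>} \<times> X\<close> and evaluating in \<open>l\<close>.
\<close>

fun fibre_cochain ::
  "'v covector \<Rightarrow> ('v set \<times> 'v set, 'v covector \<times> 'v covector) cochain \<Rightarrow>
   ('v set, 'v covector) cochain" where
  "fibre_cochain l (W, g) =
     ((\<lambda>\<eta>. {\<eta>'. (line l, \<eta>') \<in> W (line l, \<eta>)}), (\<lambda>\<eta> \<eta>' y. g (line l, \<eta>) (line l, \<eta>') (l, y)))"

definition fibre_class ::
  "int \<Rightarrow> 'v direct_image_section \<Rightarrow> 'v covector \<Rightarrow> ('v set, 'v covector) cochain set" where
  "fibre_class b r l =
     {c \<in> cocycles X_top cone (L_sections b) X.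
        \<exists>(U', c')\<in>r (line l). cohomologous X_top cone (L_sections b) X (fibre_cochain l c') c}"

text \<open>
  The dual \<open>V\<^sub>j\<^sup>*\<close> of \<open>Sym\<^sup>j(V)\<close>, extended by zero, and the contraction \<open>V \<otimes> V\<^sub>j\<^sup>* \<rightarrow> V\<^sub>j\<^sub>-\<^sub>1\<^sup>*\<close>.  A
  functional \<open>\<phi>\<close> on \<open>Sym\<^sup>j(V)\<close> is the symmetric tensor \<open>(v\<^sub>1, \<dots>, v\<^sub>j) \<mapsto> \<phi>(v\<^sub>1 \<cdots> v\<^sub>j)\<close>
  in the \<open>j\<close>-th tensor power of \<open>V\<^sup>*\<close>; contraction with \<open>u\<close> is the insertion of \<open>u\<close> into it.
\<close>

definition Sym_dual :: "nat \<Rightarrow> (('v covector \<Rightarrow> complex) \<Rightarrow> complex) set" where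
  "Sym_dual j =
     {\<phi>. (\<forall>P\<in>Sym j. \<forall>Q\<in>Sym j. \<forall>a b. \<phi> (\<lambda>y. a * P y + b * Q y) = a * \<phi> P + b * \<phi> Q) \<and>
         (\<forall>P. P \<notin> Sym j \<longrightarrow> \<phi> P = 0)}"

definition contract ::
  "nat \<Rightarrow> 'v \<Rightarrow> (('v covector \<Rightarrow> complex) \<Rightarrow> complex) \<Rightarrow> (('v covector \<Rightarrow> complex) \<Rightarrow> complex)" where
  "contract j u \<phi> = (\<lambda>Q. if Q \<in> Sym (j - 1) then \<phi> (\<lambda>y. y u * Q y) else 0)"

end


section \<open>The identifications given by a bivector\<close>

text \<open>
  An element of \<open>\<Lambda>\<^sup>2V \<subset> V \<otimes> V\<close> is an alternating bilinear form \<open>\<omega>\<close> on \<open>V\<^sup>*\<close>; only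
  the values of \<open>\<omega>\<close> on covectors that lie in \<open>dual\<close> are relevant.
\<close>

locale oriented_plane = complex_plane scale
  for scale :: "complex \<Rightarrow> 'v::ab_group_add \<Rightarrow> 'v" +
  fixes \<omega> :: "'v covector \<Rightarrow> 'v covector \<Rightarrow> complex"
  assumes omega_linear:
      "\<lbrakk>l \<in> dual; l' \<in> dual; m \<in> dual\<rbrakk> \<Longrightarrow> \<omega> (\<lambda>v. a * l v + b * l' v) m = a * \<omega> l m + b * \<omega> l' m"
    and omega_alternating: "\<lbrakk>l \<in> dual; m \<in> dual\<rbrakk> \<Longrightarrow> \<omega> m l = - \<omega> l m"
    and omega_nonzero: "\<exists>l\<in>dual. \<exists>m\<in>dual. \<omega> l m \<noteq> 0"
begin

text \<open>
  The isomorphism \<open>V\<^sup>* \<rightarrow> V\<close>, \<open>l \<mapsto> \<omega>(l, \<cdot>)\<close>.  Since \<open>l\<close> vanishes on \<open>sharp l\<close>, it maps the fibre of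
  \<open>L\<^sup>-\<^sup>1\<close> at \<open>\<xi>\<close> (the covectors vanishing on \<open>\<xi>\<close>) onto \<open>\<xi>\<close>; this is the isomorphism of \<open>L\<^sup>-\<^sup>1\<close> with
  the tautological bundle.
\<close>

definition sharp :: "'v covector \<Rightarrow> 'v" where
  "sharp l = (THE v. \<forall>m\<in>dual. m v = \<omega> l m)"

text \<open>
  The isomorphism \<open>V\<^sub>j\<^sup>* \<rightarrow> V\<^sub>j\<close> induced by \<open>sharp\<close>.  It takes the \<open>j\<close>-th power of a covector \<open>a\<close>
  to the \<open>j\<close>-th power of \<open>sharp a\<close>, i.e. to the function \<open>y \<mapsto> \<omega>(a, y)\<^sup>j\<close>, which is
  \<open>y \<mapsto> a(- sharp y)\<^sup>j\<close>.  So it takes a functional \<open>\<phi>\<close> to \<open>y \<mapsto> \<phi>((- sharp y)\<^sup>j)\<close>.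
\<close>

definition Sym_iso :: "nat \<Rightarrow> (('v covector \<Rightarrow> complex) \<Rightarrow> complex) \<Rightarrow> ('v covector \<Rightarrow> complex)" where
  "Sym_iso j \<phi> =
     (\<lambda>y. if y \<in> dual then \<phi> (\<lambda>x. if x \<in> dual then (x (- sharp y)) ^ j else 0) else 0)"

text \<open>
  The isomorphism of \<open>R\<^sup>1p\<^sub>1\<^sub>*(p\<^sub>2\<^sup>* L\<^sup>b \<otimes> \<O>(-k\<Delta>))\<close> with \<open>R\<^sup>1p\<^sub>1\<^sub>*(p\<^sub>1\<^sup>* L\<^sup>-\<^sup>k \<otimes> p\<^sub>2\<^sup>* L\<^sup>b\<^sup>-\<^sup>k)\<close> given by
  \<open>\<O>(\<Delta>) = p\<^sub>1\<^sup>* L \<otimes> p\<^sub>2\<^sup>* L\<close>, under which the section \<open>1\<close> of \<open>\<O>(\<Delta>)\<close> corresponds to the section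
  \<open>(l, y) \<mapsto> \<omega>(l, y)\<close>.  On the level of sheaves its inverse is multiplication by \<open>\<omega>\<^sup>k\<close>.
\<close>

definition untwist :: "nat \<Rightarrow> int \<Rightarrow> 'v direct_image_section \<Rightarrow> 'v direct_image_section" where
  "untwist k b r \<xi> =
     {(U', (W, g)). openin X_top U' \<and> \<xi> \<in> U' \<and>
        (W, g) \<in> cocycles XX_top cone2 (LL_sections (- int k) (b - int k)) (U' \<times> X) \<and>
        (U', (W, \<lambda>p p' (l, y). \<omega> l y ^ k * g p p' (l, y))) \<in> r \<xi>}"

text \<open>
  Under \<open>L\<^sup>2 = TX\<close>, the tangent vector \<open>d/dw\<close> at \<open>line (pencil l m w)\<close> is the element of
  \<open>L\<^sup>2\<close> with value \<open>\<omega> l m\<close> at \<open>pencil l m w\<close>: this is the derivative with respect to \<open>w\<close>, at \<open>w = z\<close>,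
  of the section \<open>\<omega> (pencil l m z) (pencil l m w)\<close> that defines the diagonal.  Hence a section \<open>f\<close>
  of \<open>L\<^sup>-\<^sup>2\<close> is the form \<open>f (pencil l m w) * \<omega> l m dw\<close>.  Its residue at \<open>\<xi>\<close> does not
  depend on the frame with \<open>l \<in> cone \<xi>\<close>.
\<close>

definition residue_at :: "'v set \<Rightarrow> ('v covector \<Rightarrow> complex) \<Rightarrow> complex" where
  "residue_at \<xi> f =
     (let (l, m) = (SOME (l, m). l \<in> cone \<xi> \<and> frame l m)
      in residue (\<lambda>w. f (pencil l m w) * \<omega> l m) 0)"

text \<open>
  The trace \<open>H\<^sup>1(X, K) = H\<^sup>1(X, L\<^sup>-\<^sup>2) \<rightarrow> \<complex>\<close>: a class is the coboundary of a Mittag-Leffler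
  distribution \<open>\<mu>\<close> of meromorphic forms, with poles in a finite set \<open>D\<close>, and is mapped to
  the sum of the residues of \<open>\<mu>\<close>.
\<close>

definition H1_trace :: "('v set, 'v covector) cochain set \<Rightarrow> complex" where
  "H1_trace \<kappa> =
     (THE t. \<exists>(W, g)\<in>\<kappa>. \<exists>D \<mu>. finite D \<and> D \<subseteq> X \<and>
        (\<forall>\<xi>\<in>X. \<mu> \<xi> \<in> L_sections (-2) (W \<xi> - D)) \<and>
        (\<forall>\<xi>\<in>X. \<forall>\<eta>\<in>W \<xi> \<inter> D. \<forall>l m. l \<in> cone \<eta> \<longrightarrow> frame l m \<longrightarrow>
           not_essential (\<lambda>w. \<mu> \<xi> (pencil l m w)) 0) \<and>
        (\<forall>\<xi>\<in>X. \<forall>\<eta>\<in>X. agree_on cone (W \<xi> \<inter> W \<eta> - D) (g \<xi> \<eta>) (\<lambda>y. \<mu> \<eta> y - \<mu> \<xi> y)) \<and>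
        t = (\<Sum>\<xi>\<in>D. residue_at \<xi> (\<mu> \<xi>)))"

text \<open>
  The product \<open>H\<^sup>1(X, L\<^sup>-\<^sup>m\<^sup>-\<^sup>2) \<times> H\<^sup>0(X, L\<^sup>m) \<rightarrow> H\<^sup>1(X, L\<^sup>-\<^sup>2)\<close> and the Serre duality
  map \<open>H\<^sup>1(X, L\<^sup>-\<^sup>m\<^sup>-\<^sup>2) \<rightarrow> Sym\<^sup>m(V)\<^sup>*\<close>.
\<close>

definition H1_product ::
  "('v set, 'v covector) cochain set \<Rightarrow> ('v covector \<Rightarrow> complex) \<Rightarrow> ('v set, 'v covector) cochain set" where
  "H1_product \<kappa> P =
     {c \<in> cocycles X_top cone (L_sections (-2)) X.
        \<exists>(W, g)\<in>\<kappa>. cohomologous X_top cone (L_sections (-2)) X (W, \<lambda>\<xi> \<eta> y. g \<xi> \<eta> y * P y) c}"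

definition Serre_dual ::
  "nat \<Rightarrow> ('v set, 'v covector) cochain set \<Rightarrow> (('v covector \<Rightarrow> complex) \<Rightarrow> complex)" where
  "Serre_dual m \<kappa> = (\<lambda>P. if P \<in> Sym m then H1_trace (H1_product \<kappa> P) else 0)"

text \<open>
  For \<open>k > n\<close>, the isomorphism from \<open>R\<^sup>1p\<^sub>1\<^sub>*(p\<^sub>2\<^sup>* L\<^sup>n \<otimes> \<O>(-(k+1)\<Delta>))\<close> over \<open>U\<close> to
  \<open>L\<^sup>-\<^sup>(\<^sup>k\<^sup>+\<^sup>1\<^sup>) \<otimes> V\<^sub>k\<^sub>-\<^sub>n\<^sub>-\<^sub>1\<close>, and the resulting isomorphism from \<open>J\<^sup>k(L\<^sup>n)\<close> to
  \<open>V\<^sub>n \<oplus> (L\<^sup>-\<^sup>(\<^sup>k\<^sup>+\<^sup>1\<^sup>) \<otimes> V\<^sub>k\<^sub>-\<^sub>n\<^sub>-\<^sub>1)\<close>.  Sections of the second summand are functions of a covector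
  \<open>l\<close> with values in \<open>Sym\<^sup>k\<^sup>-\<^sup>n\<^sup>-\<^sup>1(V)\<close>, extended by zero.
\<close>

definition direct_image_iso ::
  "nat \<Rightarrow> nat \<Rightarrow> 'v set set \<Rightarrow> 'v direct_image_section \<Rightarrow> ('v covector \<Rightarrow> 'v covector \<Rightarrow> complex)" where
  "direct_image_iso k n U r =
     (\<lambda>l. if l \<in> dual \<and> line l \<in> U
          then Sym_iso (k - n - 1) (Serre_dual (k - n - 1)
                 (fibre_class (int n - int (k + 1)) (untwist (k + 1) (int n) r) l))
          else (\<lambda>y. 0))"

definition jet_iso ::
  "nat \<Rightarrow> nat \<Rightarrow> 'v set set \<Rightarrow> 'v jet_section \<Rightarrow>
   ('v set \<Rightarrow> 'v covector \<Rightarrow> complex) \<times> ('v covector \<Rightarrow> 'v covector \<Rightarrow> complex)" where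
  "jet_iso k n U q =
     (let \<sigma> = \<beta> n U q;
          q' = quotient_diff XX_top (LL_sections 0 (int n)) (vanishing_sections (k + 1) (int n))
                 q (jet_of k n U \<sigma>)
      in (\<sigma>, direct_image_iso k n U (jet_connecting k n U q')))"

text \<open>
  The contraction \<open>L\<^sup>-\<^sup>d \<otimes> V\<^sub>j \<rightarrow> L\<^sup>-\<^sup>d\<^sup>+\<^sup>1 \<otimes> V\<^sub>j\<^sub>-\<^sub>1\<close> over \<open>U\<close>, for \<open>d > 0\<close>.  A section \<open>t\<close> of the source
  stands for \<open>l \<otimes> \<dots> \<otimes> l \<otimes> t(l)\<close>; one of the factors \<open>l\<close>, read as the element \<open>sharp l\<close>
  of the tautological bundle, is contracted with \<open>t(l)\<close>, read as an element of \<open>V\<^sub>j\<^sup>*\<close>.  The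
  formula does not involve \<open>d\<close>.
\<close>

definition contraction ::
  "nat \<Rightarrow> 'v set set \<Rightarrow> ('v covector \<Rightarrow> 'v covector \<Rightarrow> complex) \<Rightarrow>
   ('v covector \<Rightarrow> 'v covector \<Rightarrow> complex)" where
  "contraction j U t =
     (\<lambda>l. if l \<in> dual \<and> line l \<in> U
          then Sym_iso (j - 1) (contract j (sharp l) (the_inv_into (Sym_dual j) (Sym_iso j) (t l)))
          else (\<lambda>y. 0))"

end

end

theory Submission
  imports Defs
begin

text \<open>
  Let \<open>f\<close> be a local representative, at the point \<open>(\<xi>, \<xi>)\<close> of the diagonal, of the component of a
  \<open>k\<close>-jet in the kernel of \<open>\<beta>\<close>.  For \<open>l\<close> in the cone of \<open>\<xi>\<close>, the cocycle that the connecting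
  homomorphism and the isomorphism \<open>\<O>(\<Delta>) = p\<^sub>1\<^sup>* L \<otimes> p\<^sub>2\<^sup>* L\<close> attach to it is on \<open>{\<xi>} \<times> X\<close> the coboundary
  of a Mittag-Leffler distribution whose only pole is at \<open>\<xi>\<close>, with principal part
  \<open>f(l, y) / \<omega>(l, y)\<^sup>k\<^sup>+\<^sup>1\<close>.  Hence its Serre dual is the functional that sends \<open>P\<close> to the residue at \<open>\<xi>\<close>
  of \<open>P(y) f(l, y) / \<omega>(l, y)\<^sup>k\<^sup>+\<^sup>1\<close>; it is well defined because the residues of a meromorphic form on \<open>X\<close>
  add up to zero.  The projected jet has the same representative \<open>f\<close>, and
  \<open>Q f / \<omega>(l, \<cdot>)\<^sup>k = (\<omega>(l, \<cdot>) Q) f / \<omega>(l, \<cdot>)\<^sup>k\<^sup>+\<^sup>1\<close> where \<open>\<omega>(l, y) = y(sharp l)\<close>: this is the contraction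
  with \<open>sharp l\<close>.
\<close>

section \<open>Holomorphic functions of two variables\<close>

text \<open>Two obstacles shape the proof. \<open>H1_trace\<close> is a definite description over
  all cocycles of a class and all Mittag-Leffler distributions for them, and the class is reached
  through four successive cohomologies. So the residue formula needs an explicit cocycle and also a
  comparison with an arbitrary one, in which each correcting cochain either vanishes to order
  \<open>k + 1\<close> on the diagonal or is regular on the fibre, and hence leaves the residue
  alone. Moreover \<open>contraction\<close> inverts \<open>Sym_iso\<close>, which requires that
  functionals on forms be determined by their values on powers of vectors. The splitting is handled
  by subtracting the jet of one and the same section \<open>\<sigma>\<close> of V_n from a jet and
  from its projection. That \<open>\<sigma>\<close> exists is the isomorphism J^n(L^n) = V_n: at
  each point it is the unique form of degree \<open>n\<close> osculating the jet. Its holomorphic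
  variation, and the divisibility of the remainder by a power of \<open>z - w\<close> in two
  variables, rest on a Taylor expansion along the diagonal, obtained from mere complex
  differentiability.\<close>

lemma holomorphic2_on_subset: "holomorphic2_on f S \<Longrightarrow> T \<subseteq> S \<Longrightarrow> holomorphic2_on f T"
  unfolding holomorphic2_on_def by blast

lemma bounded_linear_pair: "bounded_linear (\<lambda>(s::complex, t::complex). a * s + b * t)"
  unfolding case_prod_beta'
  by (intro bounded_linear_intros)

lemma holomorphic2_on_transform:
  assumes "holomorphic2_on f S" "open S" "\<And>p. p \<in> S \<Longrightarrow> f p = g p"
  shows "holomorphic2_on g S"
  unfolding holomorphic2_on_def
proof
  fix p assume p: "p \<in> S"
  then obtain a b where "(f has_derivative (\<lambda>(s, t). a * s + b * t)) (at p)"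
    using assms(1) unfolding holomorphic2_on_def by blast
  then have "(g has_derivative (\<lambda>(s, t). a * s + b * t)) (at p)"
    by (rule has_derivative_transform_within_open[OF _ assms(2) p]) (use assms(3) in simp)
  then show "\<exists>a b. (g has_derivative (\<lambda>(s, t). a * s + b * t)) (at p)" by blast
qed

lemma holomorphic2_on_const: "holomorphic2_on (\<lambda>p. c) S"
  unfolding holomorphic2_on_def
proof
  fix p assume "p \<in> S"
  have "((\<lambda>p::complex\<times>complex. c) has_derivative (\<lambda>(s, t). 0 * s + 0 * t)) (at p)"
    by (auto simp: case_prod_beta')
  then show "\<exists>a b. ((\<lambda>p. c) has_derivative (\<lambda>(s, t). a * s + b * t)) (at p)" by blast
qed

lemma holomorphic2_on_fst: "holomorphic2_on fst S"
  unfolding holomorphic2_on_def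
proof
  fix p assume "p \<in> S"
  have "(fst has_derivative (\<lambda>(s::complex, t::complex). 1 * s + 0 * t)) (at p)"
    by (auto simp: case_prod_beta' intro!: derivative_eq_intros)
  then show "\<exists>a b. (fst has_derivative (\<lambda>(s, t). a * s + b * t)) (at p)" by blast
qed

lemma holomorphic2_on_snd: "holomorphic2_on snd S"
  unfolding holomorphic2_on_def
proof
  fix p assume "p \<in> S"
  have "(snd has_derivative (\<lambda>(s::complex, t::complex). 0 * s + 1 * t)) (at p)"
    by (auto simp: case_prod_beta' intro!: derivative_eq_intros)
  then show "\<exists>a b. (snd has_derivative (\<lambda>(s, t). a * s + b * t)) (at p)" by blast
qed

lemma holomorphic2_on_compose:
  assumes f: "holomorphic2_on f T" and a: "holomorphic2_on a S" and b: "holomorphic2_on b S"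
    and sub: "\<And>p. p \<in> S \<Longrightarrow> (a p, b p) \<in> T"
  shows "holomorphic2_on (\<lambda>p. f (a p, b p)) S"
  unfolding holomorphic2_on_def
proof
  fix p assume p: "p \<in> S"
  obtain a1 a2 where da: "(a has_derivative (\<lambda>(s, t). a1 * s + a2 * t)) (at p)"
    using a p unfolding holomorphic2_on_def by blast
  obtain b1 b2 where db: "(b has_derivative (\<lambda>(s, t). b1 * s + b2 * t)) (at p)"
    using b p unfolding holomorphic2_on_def by blast
  obtain c1 c2 where df: "(f has_derivative (\<lambda>(s, t). c1 * s + c2 * t)) (at (a p, b p))"
    using f sub[OF p] unfolding holomorphic2_on_def by blast
  have "((\<lambda>p. (a p, b p)) has_derivative
      (\<lambda>h. ((\<lambda>(s, t). a1 * s + a2 * t) h, (\<lambda>(s, t). b1 * s + b2 * t) h))) (at p)"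
    by (rule has_derivative_Pair[OF da db])
  from has_derivative_compose[OF this df]
  have "((\<lambda>p. f (a p, b p)) has_derivative
      (\<lambda>(s, t). (c1 * a1 + c2 * b1) * s + (c1 * a2 + c2 * b2) * t)) (at p)"
    by (simp add: case_prod_beta' algebra_simps)
  then show "\<exists>u v. ((\<lambda>p. f (a p, b p)) has_derivative (\<lambda>(s, t). u * s + v * t)) (at p)" by blast
qed

lemma holomorphic2_on_outer:
  assumes g: "g holomorphic_on T" "open T" and f: "holomorphic2_on f S"
    and sub: "\<And>p. p \<in> S \<Longrightarrow> f p \<in> T"
  shows "holomorphic2_on (\<lambda>p. g (f p)) S"
  unfolding holomorphic2_on_def
proof
  fix p assume p: "p \<in> S"
  obtain a b where df: "(f has_derivative (\<lambda>(s, t). a * s + b * t)) (at p)"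
    using f p unfolding holomorphic2_on_def by blast
  obtain d where "(g has_field_derivative d) (at (f p))"
    using g sub[OF p] by (metis holomorphic_derivI)
  then have "(g has_derivative (*) d) (at (f p))" by (simp add: has_field_derivative_def)
  from has_derivative_compose[OF df this]
  have "((\<lambda>p. g (f p)) has_derivative (\<lambda>(s, t). (d * a) * s + (d * b) * t)) (at p)"
    by (simp add: case_prod_beta' algebra_simps)
  then show "\<exists>u v. ((\<lambda>p. g (f p)) has_derivative (\<lambda>(s, t). u * s + v * t)) (at p)" by blast
qed

lemma holomorphic2_on_add:
  assumes "holomorphic2_on f S" "holomorphic2_on g S"
  shows "holomorphic2_on (\<lambda>p. f p + g p) S"
proof -
  have "holomorphic2_on (\<lambda>q. fst q + snd q) UNIV"
    unfolding holomorphic2_on_def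
  proof
    fix p :: "complex \<times> complex"
    have "((\<lambda>q. fst q + snd q) has_derivative (\<lambda>(s::complex, t). 1 * s + 1 * t)) (at p)"
      by (auto simp: case_prod_beta' intro!: derivative_eq_intros)
    then show "\<exists>a b. ((\<lambda>q. fst q + snd q) has_derivative (\<lambda>(s, t). a * s + b * t)) (at p)"
      by blast
  qed
  from holomorphic2_on_compose[OF this assms] show ?thesis by simp
qed

lemma holomorphic2_on_mult:
  assumes "holomorphic2_on f S" "holomorphic2_on g S"
  shows "holomorphic2_on (\<lambda>p. f p * g p) S"
proof -
  have "holomorphic2_on (\<lambda>q. fst q * snd q) UNIV"
    unfolding holomorphic2_on_def
  proof
    fix p :: "complex \<times> complex"
    have "((\<lambda>q. fst q * snd q) has_derivative (\<lambda>(s::complex, t). snd p * s + fst p * t)) (at p)"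
      by (auto simp: case_prod_beta' intro!: derivative_eq_intros)
    then show "\<exists>a b. ((\<lambda>q. fst q * snd q) has_derivative (\<lambda>(s, t). a * s + b * t)) (at p)"
      by blast
  qed
  from holomorphic2_on_compose[OF this assms] show ?thesis by simp
qed

lemma holomorphic2_on_diff:
  assumes "holomorphic2_on f S" "holomorphic2_on g S"
  shows "holomorphic2_on (\<lambda>p. f p - g p) S"
  using holomorphic2_on_add[OF assms(1) holomorphic2_on_mult[OF holomorphic2_on_const[of "-1"] assms(2)]]
  by simp

lemma holomorphic2_on_power:
  "holomorphic2_on f S \<Longrightarrow> holomorphic2_on (\<lambda>p. f p ^ n) S"
  by (induction n) (simp_all add: holomorphic2_on_const holomorphic2_on_mult)

lemma holomorphic2_on_sum:
  "(\<And>i. i \<in> I \<Longrightarrow> holomorphic2_on (f i) S) \<Longrightarrow> holomorphic2_on (\<lambda>p. \<Sum>i\<in>I. f i p) S"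
  by (induction I rule: infinite_finite_induct) (simp_all add: holomorphic2_on_const holomorphic2_on_add)

lemma holomorphic2_on_divide:
  assumes "holomorphic2_on f S" "holomorphic2_on g S" "\<And>p. p \<in> S \<Longrightarrow> g p \<noteq> 0"
  shows "holomorphic2_on (\<lambda>p. f p / g p) S"
proof -
  have "holomorphic2_on (\<lambda>p. inverse (g p)) S"
    by (rule holomorphic2_on_outer[of inverse "- {0}"]) (use assms in \<open>auto intro!: holomorphic_intros\<close>)
  from holomorphic2_on_mult[OF assms(1) this] show ?thesis by (simp add: divide_inverse)
qed

lemmas holomorphic2_intros = holomorphic2_on_const holomorphic2_on_fst holomorphic2_on_snd
  holomorphic2_on_add holomorphic2_on_diff holomorphic2_on_mult holomorphic2_on_power
  holomorphic2_on_sum holomorphic2_on_divide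

text \<open>The chain rule along a holomorphic curve; it is applied with one coordinate fixed, and
  to the diagonal.\<close>

lemma holomorphic2_on_slice:
  assumes f: "holomorphic2_on f S" and a: "a holomorphic_on A" and b: "b holomorphic_on A"
    and A: "open A" and sub: "\<And>z. z \<in> A \<Longrightarrow> (a z, b z) \<in> S"
  shows "(\<lambda>z. f (a z, b z)) holomorphic_on A"
proof -
  have "\<exists>d. ((\<lambda>z. f (a z, b z)) has_field_derivative d) (at z)" if z: "z \<in> A" for z
  proof -
    obtain a' where da: "(a has_field_derivative a') (at z)" using a A z by (metis holomorphic_derivI)
    obtain b' where db: "(b has_field_derivative b') (at z)" using b A z by (metis holomorphic_derivI)
    obtain c1 c2 where df: "(f has_derivative (\<lambda>(s, t). c1 * s + c2 * t)) (at (a z, b z))"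
      using f sub[OF z] unfolding holomorphic2_on_def by blast
    have "((\<lambda>z. (a z, b z)) has_derivative (\<lambda>h. (a' * h, b' * h))) (at z)"
      using has_derivative_Pair da db unfolding has_field_derivative_def by blast
    from has_derivative_compose[OF this df]
    have "((\<lambda>z. f (a z, b z)) has_derivative (\<lambda>h. c1 * (a' * h) + c2 * (b' * h))) (at z)"
      by simp
    also have "(\<lambda>h. c1 * (a' * h) + c2 * (b' * h)) = (*) (c1 * a' + c2 * b')"
      by (auto simp: algebra_simps)
    finally have "((\<lambda>z. f (a z, b z)) has_field_derivative (c1 * a' + c2 * b')) (at z)"
      by (simp add: has_field_derivative_def)
    then show ?thesis by blast
  qed
  then show ?thesis
    unfolding holomorphic_on_def
    by (auto simp: field_differentiable_def intro: has_field_derivative_at_within)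
qed

lemma holomorphic2_on_imp_continuous_on:
  "holomorphic2_on f S \<Longrightarrow> continuous_on S f"
  unfolding holomorphic2_on_def by (blast intro: continuous_at_imp_continuous_on has_derivative_continuous)

text \<open>The quotient has a removable singularity at \<open>a\<close>. The maximum principle
  moves the estimate to the circle of radius \<open>r/2\<close>, where the numerator is at most
  \<open>2 * M\<close> and the denominator has norm \<open>r/2\<close>.\<close>

lemma difference_quotient_bound:
  fixes g :: "complex \<Rightarrow> complex"
  assumes g: "g holomorphic_on ball a r" and r: "0 < r" and M: "\<And>z. z \<in> ball a r \<Longrightarrow> norm (g z) \<le> M"
  shows "\<exists>q. q holomorphic_on ball a r \<and> q a = deriv g a \<and>
    (\<forall>z\<in>ball a r. g z - g a = (z - a) * q z) \<and> (\<forall>z\<in>ball a (r/2). norm (q z) \<le> 4 * M / r)"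
proof -
  define q where "q = (\<lambda>z. if z = a then deriv g a else (g z - g a) / (z - a))"
  have gd: "g field_differentiable at a"
    using g r by (meson centre_in_ball holomorphic_on_imp_differentiable_at open_ball)
  have da: "deriv (\<lambda>z. g z - g a) a = deriv g a"
    using gd by (simp add: deriv_diff field_differentiable_const)
  have qh: "q holomorphic_on ball a r"
  proof (rule pole_theorem_open_0[where g = "\<lambda>z. g z - g a" and a = a])
    show "(\<lambda>z. g z - g a) holomorphic_on ball a r" using g by (intro holomorphic_intros)
  qed (auto simp: q_def da)
  have qe: "g z - g a = (z - a) * q z" for z by (auto simp: q_def)
  have bd: "norm (q z) \<le> 4 * M / r" if z: "z \<in> ball a (r/2)" for z
  proof (rule maximum_modulus_frontier[where S = "ball a (r/2)" and f = q])
    show "q holomorphic_on interior (ball a (r/2))"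
      using qh by (rule holomorphic_on_subset) (use r in auto)
    show "continuous_on (closure (ball a (r/2))) q"
      using r holomorphic_on_imp_continuous_on[OF qh]
      by (auto elim!: continuous_on_subset)
    show "norm (q w) \<le> 4 * M / r" if "w \<in> frontier (ball a (r/2))" for w
    proof -
      have w: "dist a w = r/2" using that r by (simp add: frontier_ball)
      then have ne: "w \<noteq> a" using r by auto
      have wb: "w \<in> ball a r" using w r by auto
      have "norm (g w - g a) \<le> M + M"
        using M[OF wb] M[of a] r by (meson centre_in_ball add_mono norm_triangle_ineq4 order_trans)
      moreover have "norm (w - a) = r/2" using w by (simp add: dist_norm norm_minus_commute)
      then have "norm (q w) = norm (g w - g a) / (r/2)"
        using ne by (simp add: q_def norm_divide del: divide_divide_eq_right)
      ultimately show ?thesis using r by (simp add: field_simps)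
    qed
  qed (use z in auto)
  have "q a = deriv g a" by (simp add: q_def)
  with qh qe bd show ?thesis by blast
qed

text \<open>The quotient lemma is used twice: for \<open>g\<close>, and then for its quotient
  \<open>q\<close> on the disc of radius \<open>r/2\<close> with the bound \<open>4 * M / r\<close>.
  This gives \<open>4 * (4 * M / r) / (r/2) = 32 * M / r^2\<close> and costs another halving of the
  disc.\<close>

lemma first_order_bound:
  fixes g :: "complex \<Rightarrow> complex"
  assumes g: "g holomorphic_on ball a r" and r: "0 < r" and M: "\<And>z. z \<in> ball a r \<Longrightarrow> norm (g z) \<le> M"
    and z: "z \<in> ball a (r/4)"
  shows "norm (g z - g a) \<le> 4 * M / r * norm (z - a)"
    and "norm (g z - g a - deriv g a * (z - a)) \<le> 32 * M / r^2 * norm (z - a) ^ 2"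
proof -
  obtain q where q: "q holomorphic_on ball a r" "q a = deriv g a"
    "\<And>z. z \<in> ball a r \<Longrightarrow> g z - g a = (z - a) * q z"
    "\<And>z. z \<in> ball a (r/2) \<Longrightarrow> norm (q z) \<le> 4 * M / r"
    using difference_quotient_bound[OF g r M] by blast
  have "q holomorphic_on ball a (r/2)" using q(1) by (rule holomorphic_on_subset) (use r in auto)
  from difference_quotient_bound[OF this half_gt_zero[OF r] q(4)]
  obtain p where p: "\<forall>z\<in>ball a (r/2). q z - q a = (z - a) * p z"
    "\<forall>z\<in>ball a (r/2/2). norm (p z) \<le> 4 * (4 * M / r) / (r/2)"
    by blast
  have z1: "z \<in> ball a r" "z \<in> ball a (r/2)" "z \<in> ball a (r/2/2)" using z r by auto
  show "norm (g z - g a) \<le> 4 * M / r * norm (z - a)"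
    using mult_right_mono[OF q(4)[OF z1(2)] norm_ge_zero[of "z - a"]] q(3)[OF z1(1)]
    by (simp add: norm_mult mult.commute)
  have "g z - g a - deriv g a * (z - a) = (z - a) * (q z - q a)"
    using q(2,3) z1 by (simp add: algebra_simps)
  also have "\<dots> = (z - a) ^ 2 * p z" using bspec[OF p(1) z1(2)] by (simp add: power2_eq_square)
  finally have "norm (g z - g a - deriv g a * (z - a)) = norm (z - a) ^ 2 * norm (p z)"
    by (simp add: norm_mult norm_power)
  also have "\<dots> \<le> norm (z - a) ^ 2 * (4 * (4 * M / r) / (r/2))"
    using bspec[OF p(2) z1(3)] by (intro mult_left_mono) auto
  also have "\<dots> = 32 * M / r^2 * norm (z - a) ^ 2" by (simp add: power2_eq_square)
  finally show "norm (g z - g a - deriv g a * (z - a)) \<le> 32 * M / r^2 * norm (z - a) ^ 2" .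
qed

text \<open>
  Osgood's lemma, for locally bounded functions: the Cauchy estimates make the first order
  expansions in one variable uniform in the other one.
\<close>

lemma separately_holomorphic_imp_holomorphic2:
  fixes f :: "complex \<times> complex \<Rightarrow> complex"
  assumes r: "0 < r"
    and M: "\<And>z w. z \<in> ball z0 r \<Longrightarrow> w \<in> ball w0 r \<Longrightarrow> norm (f (z, w)) \<le> M"
    and h1: "\<And>w. w \<in> ball w0 r \<Longrightarrow> (\<lambda>z. f (z, w)) holomorphic_on ball z0 r"
    and h2: "\<And>z. z \<in> ball z0 r \<Longrightarrow> (\<lambda>w. f (z, w)) holomorphic_on ball w0 r"
  shows "\<exists>a b. (f has_derivative (\<lambda>(s, t). a * s + b * t)) (at (z0, w0))"
proof -
  define a where "a = deriv (\<lambda>z. f (z, w0)) z0"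
  define b where "b = (\<lambda>z. deriv (\<lambda>w. f (z, w)) w0)"
  have M0: "0 \<le> M" using M[of z0 w0] r norm_ge_zero order_trans by (metis centre_in_ball)
  have b_bound: "norm (b z - b z0) \<le> 32 * M / r^2 * norm (z - z0)" if z: "z \<in> ball z0 (r/4)" for z
  proof -
    have zr: "z \<in> ball z0 r" "z0 \<in> ball z0 r" using z r by auto
    \<comment> \<open>The Cauchy estimate is applied to a difference of two slices, which is itself
      of size \<open>norm (z - z0)\<close>; this bounds the variation of the partial derivative in
      \<open>w\<close>.\<close>
    have "norm ((deriv ^^ 1) (\<lambda>w. f (z, w) - f (z0, w)) w0)
        \<le> fact 1 * (4 * M / r * norm (z - z0)) / (r/2) ^ 1"
    proof (rule Cauchy_inequality)
      have "(\<lambda>w. f (z, w) - f (z0, w)) holomorphic_on ball w0 r"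
        using h2[OF zr(1)] h2[OF zr(2)] by (intro holomorphic_intros)
      then show "(\<lambda>w. f (z, w) - f (z0, w)) holomorphic_on ball w0 (r/2)"
        and "continuous_on (cball w0 (r/2)) (\<lambda>w. f (z, w) - f (z0, w))"
        using r by (auto intro: holomorphic_on_subset holomorphic_on_imp_continuous_on
            elim!: holomorphic_on_subset intro!: holomorphic_on_imp_continuous_on)
      show "norm (f (z, w) - f (z0, w)) \<le> 4 * M / r * norm (z - z0)"
        if "norm (w0 - w) = r / 2" for w
      proof -
        have w: "w \<in> ball w0 r" using that r by (simp add: dist_norm)
        show ?thesis using first_order_bound(1)[OF h1[OF w] r _ z] M w by blast
      qed
    qed (use r in auto)
    moreover have "deriv (\<lambda>w. f (z, w) - f (z0, w)) w0 = b z - b z0"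
      unfolding b_def
      by (rule deriv_diff)
        (use h2[OF zr(1)] h2[OF zr(2)] r in \<open>auto intro: holomorphic_on_imp_differentiable_at\<close>)
    ultimately have "norm (b z - b z0) \<le> 8 * M / r^2 * norm (z - z0)"
      by (simp add: power2_eq_square)
    \<comment> \<open>The constant 8 is weakened to 32 so that the three error terms below share the
      bound \<open>C\<close>.\<close>
    also have "\<dots> \<le> 32 * M / r^2 * norm (z - z0)"
      using M0 by (intro mult_right_mono divide_right_mono) auto
    finally show ?thesis .
  qed
  \<comment> \<open>\<open>96 = 3 * 32\<close>: the error is split into the three terms of
    \<open>e1\<close>, \<open>e2\<close> and \<open>e3\<close>, each at most \<open>C * N^2\<close>
    with \<open>C = 32 * M / r^2\<close>.\<close>
  define K where "K = 96 * M / r^2"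
  have "(f has_derivative (\<lambda>(s, t). a * s + b z0 * t)) (at (z0, w0))"
  proof (rule has_derivativeI_sandwich[where e = "r/4" and H = "\<lambda>p. K * norm (p - (z0, w0))"])
    show "0 < r/4" using r by simp
    show "bounded_linear (\<lambda>(s, t). a * s + b z0 * t)" by (rule bounded_linear_pair)
    show "norm (f p - f (z0, w0) - (case p - (z0, w0) of (s, t) \<Rightarrow> a * s + b z0 * t))
        / norm (p - (z0, w0)) \<le> K * norm (p - (z0, w0))"
      if ne: "p \<noteq> (z0, w0)" and d: "dist p (z0, w0) < r/4" for p
    proof -
      obtain z w where p: "p = (z, w)" by fastforce
      define N where "N = norm (p - (z0, w0))"
      have nz: "norm (z - z0) \<le> N" and nw: "norm (w - w0) \<le> N"
        using norm_fst_le[of "z - z0" "w - w0"] norm_snd_le[of "w - w0" "z - z0"]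
        by (auto simp: N_def p)
      have z: "z \<in> ball z0 (r/4)" and w: "w \<in> ball w0 (r/4)"
        using nz nw d by (auto simp: N_def dist_norm norm_minus_commute)
      have zr: "z \<in> ball z0 r" and wr: "w0 \<in> ball w0 r" using z r by auto
      define C where "C = 32 * M / r^2"
      have C0: "0 \<le> C" using M0 by (simp add: C_def)
      have N0: "0 \<le> N" by (simp add: N_def)
      have e1: "norm (f (z, w) - f (z, w0) - b z * (w - w0)) \<le> C * N^2"
      proof -
        have "norm (f (z, w) - f (z, w0) - b z * (w - w0)) \<le> C * norm (w - w0)^2"
          unfolding b_def C_def using first_order_bound(2)[OF h2[OF zr] r _ w] M zr by blast
        also have "\<dots> \<le> C * N^2" using C0 nw by (intro mult_left_mono power_mono) auto
        finally show ?thesis .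
      qed
      have e2: "norm (f (z, w0) - f (z0, w0) - a * (z - z0)) \<le> C * N^2"
      proof -
        have "norm (f (z, w0) - f (z0, w0) - a * (z - z0)) \<le> C * norm (z - z0)^2"
          unfolding a_def C_def using first_order_bound(2)[OF h1[OF wr] r _ z] M wr by blast
        also have "\<dots> \<le> C * N^2" using C0 nz by (intro mult_left_mono power_mono) auto
        finally show ?thesis .
      qed
      have e3: "norm ((b z - b z0) * (w - w0)) \<le> C * N^2"
      proof -
        have "norm (b z - b z0) \<le> C * N"
          using b_bound[OF z] nz C0 unfolding C_def[symmetric]
          by (meson mult_left_mono order_trans)
        then have "norm ((b z - b z0) * (w - w0)) \<le> C * N * N"
          unfolding norm_mult using nw C0 N0 by (intro mult_mono) auto
        then show ?thesis by (simp add: power2_eq_square mult.assoc)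
      qed
      have "f p - f (z0, w0) - (case p - (z0, w0) of (s, t) \<Rightarrow> a * s + b z0 * t)
          = (f (z, w) - f (z, w0) - b z * (w - w0)) + (f (z, w0) - f (z0, w0) - a * (z - z0))
            + (b z - b z0) * (w - w0)"
        by (simp add: p algebra_simps)
      then have "norm (f p - f (z0, w0) - (case p - (z0, w0) of (s, t) \<Rightarrow> a * s + b z0 * t))
          \<le> C * N^2 + C * N^2 + C * N^2"
        using e1 e2 e3 by (metis (no_types, lifting) norm_triangle_mono)
      also have "\<dots> = K * N * N" by (simp add: K_def C_def power2_eq_square)
      finally show ?thesis
        using ne unfolding N_def[symmetric] by (simp add: N_def divide_le_eq)
    qed
    have "((\<lambda>p. K * norm (p - (z0, w0))) \<longlongrightarrow> K * norm ((z0, w0) - (z0, w0))) (at (z0, w0))"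
      by (intro tendsto_intros)
    then show "((\<lambda>p. K * norm (p - (z0, w0))) \<longlongrightarrow> 0) (at (z0, w0))" by simp
  qed
  then show ?thesis by blast
qed

text \<open>The quotient \<open>F / (w - z)\<close>, completed by a derivative on the diagonal, has
  removable singularities in each variable separately, and the maximum principle in \<open>w\<close>
  bounds it. Osgood's lemma then gives differentiability in both variables together.\<close>

lemma diagonal_division:
  assumes F: "holomorphic2_on F (ball z0 r \<times> ball z0 r)" and r: "0 < r"
    and diag: "\<And>z. z \<in> ball z0 r \<Longrightarrow> F (z, z) = 0"
  obtains h where "holomorphic2_on h (ball z0 (r/2) \<times> ball z0 (r/2))"
    "\<And>z w. z \<in> ball z0 (r/2) \<Longrightarrow> w \<in> ball z0 (r/2) \<Longrightarrow> F (z, w) = (w - z) * h (z, w)"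
proof -
  let ?B = "ball z0 r"
  define h where "h = (\<lambda>(z, w). if w = z then deriv (\<lambda>w. F (z, w)) z else F (z, w) / (w - z))"
  have F2: "(\<lambda>w. F (z, w)) holomorphic_on ?B" if "z \<in> ?B" for z
    by (rule holomorphic2_on_slice[OF F]) (use that in \<open>auto intro!: holomorphic_intros\<close>)
  have F1: "(\<lambda>z. F (z, w)) holomorphic_on ?B" if "w \<in> ?B" for w
    by (rule holomorphic2_on_slice[OF F]) (use that in \<open>auto intro!: holomorphic_intros\<close>)
  have hF: "F (z, w) = (w - z) * h (z, w)" if "z \<in> ?B" for z w
    using diag that by (auto simp: h_def)
  have h2: "(\<lambda>w. h (z, w)) holomorphic_on ?B" if z: "z \<in> ?B" for z
    by (rule pole_theorem_open_0[OF F2[OF z], where a = z]) (use diag z in \<open>auto simp: h_def\<close>)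
  \<comment> \<open>The derivative of \<open>F\<close> along the diagonal is zero, so its two
    partial derivatives are opposite there. Hence the value of \<open>h\<close> on the diagonal,
    chosen for the variable \<open>w\<close>, also removes the singularity in
    \<open>z\<close>.\<close>
  have anti: "deriv (\<lambda>w. F (z, w)) z = - deriv (\<lambda>w. F (w, z)) z" if z: "z \<in> ?B" for z
  proof -
    obtain a b where ab: "(F has_derivative (\<lambda>(s, t). a * s + b * t)) (at (z, z))"
      using F z unfolding holomorphic2_on_def by blast
    have *: "((\<lambda>x. F (u x, v x)) has_field_derivative (a * u' + b * v')) (at z)"
      if "(u has_field_derivative u') (at z)" "(v has_field_derivative v') (at z)" "u z = z" "v z = z"
      for u v u' v'
    proof -
      have "((\<lambda>x. (u x, v x)) has_derivative (\<lambda>h. (u' * h, v' * h))) (at z)"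
        using has_derivative_Pair that unfolding has_field_derivative_def by blast
      from has_derivative_compose[OF this, of F] ab that(3,4)
      have "((\<lambda>x. F (u x, v x)) has_derivative (\<lambda>h. a * (u' * h) + b * (v' * h))) (at z)"
        by fastforce
      also have "(\<lambda>h. a * (u' * h) + b * (v' * h)) = (*) (a * u' + b * v')"
        by (auto simp: algebra_simps)
      finally show ?thesis by (simp add: has_field_derivative_def)
    qed
    have "((\<lambda>x. F (x, x)) has_field_derivative (a * 1 + b * 1)) (at z)"
      by (rule *) (auto intro!: derivative_eq_intros)
    moreover have "((\<lambda>x. F (x, x)) has_field_derivative 0) (at z)"
      by (rule has_field_derivative_transform_within_open[of "\<lambda>_. 0" _ _ ?B]) (use z diag in auto)
    ultimately have "a + b = 0" using DERIV_unique by fastforce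
    moreover have "((\<lambda>x. F (z, x)) has_field_derivative (a * 0 + b * 1)) (at z)"
      by (rule *) (auto intro!: derivative_eq_intros)
    moreover have "((\<lambda>x. F (x, z)) has_field_derivative (a * 1 + b * 0)) (at z)"
      by (rule *) (auto intro!: derivative_eq_intros)
    ultimately show ?thesis
      by (metis DERIV_imp_deriv add.inverse_unique add.right_neutral add_0 mult.right_neutral
          mult_zero_right neg_eq_iff_add_eq_0)
  qed
  have h1: "(\<lambda>z. h (z, w)) holomorphic_on ?B" if w: "w \<in> ?B" for w
  proof -
    have "(\<lambda>z. - h (z, w)) holomorphic_on ?B"
    proof (rule pole_theorem_open_0[OF F1[OF w], where a = w])
      show "F (z, w) = (z - w) * - h (z, w)" if "z \<in> ?B - {w}" for z
        using hF[of z w] that by (auto simp: algebra_simps)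
      show "- h (w, w) = deriv (\<lambda>z. F (z, w)) w" using anti[OF w] by (simp add: h_def)
    qed (use diag w in auto)
    then have "(\<lambda>z. - (- h (z, w))) holomorphic_on ?B" by (rule holomorphic_on_minus)
    then show ?thesis by simp
  qed
  \<comment> \<open>The radius lies strictly between \<open>r/2\<close> and \<open>r\<close>: the
    closed disc is compact inside the domain of \<open>F\<close>, and its boundary keeps distance at
    least \<open>r/4\<close> from every \<open>z\<close> in the disc of radius
    \<open>r/2\<close>.\<close>
  let ?C = "cball z0 (3*r/4)"
  have sub: "?C \<subseteq> ?B" using r by auto
  have "continuous_on (?C \<times> ?C) F"
    using holomorphic2_on_imp_continuous_on[OF F] sub by (meson Sigma_mono continuous_on_subset)
  then have "compact (F ` (?C \<times> ?C))" by (intro compact_continuous_image compact_Times compact_cball)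
  then obtain M where M: "\<And>p. p \<in> ?C \<times> ?C \<Longrightarrow> norm (F p) \<le> M"
    using compact_imp_bounded bounded_iff by (metis imageI)
  have bd: "norm (h (z, w)) \<le> 4 * M / r" if z: "z \<in> ball z0 (r/2)" and w: "w \<in> ball z0 (3*r/4)" for z w
  proof (rule maximum_modulus_frontier[where S = "ball z0 (3*r/4)" and f = "\<lambda>w. h (z, w)"])
    have zB: "z \<in> ?B" using z r by auto
    show "(\<lambda>w. h (z, w)) holomorphic_on interior (ball z0 (3*r/4))"
      using h2[OF zB] by (rule holomorphic_on_subset) (use r in auto)
    show "continuous_on (closure (ball z0 (3*r/4))) (\<lambda>w. h (z, w))"
      using r sub holomorphic_on_imp_continuous_on[OF h2[OF zB]] by (auto elim!: continuous_on_subset)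
    show "norm (h (z, v)) \<le> 4 * M / r" if "v \<in> frontier (ball z0 (3*r/4))" for v
    proof -
      have v: "dist z0 v = 3*r/4" using that r by (simp add: frontier_ball)
      have "norm (F (z, v)) \<le> M" using v z r by (intro M) auto
      moreover have "r/4 \<le> norm (v - z)"
      proof -
        have "dist z0 v \<le> dist z0 z + dist z v" by (rule dist_triangle)
        then show ?thesis using v z by (simp add: dist_norm norm_minus_commute)
      qed
      moreover have "norm (F (z, v)) = norm (v - z) * norm (h (z, v))"
        using hF[OF zB, of v] by (simp add: norm_mult)
      ultimately have "r/4 * norm (h (z, v)) \<le> M"
        by (metis mult_right_mono norm_ge_zero order_trans)
      then show ?thesis using r by (simp add: field_simps)
    qed
  qed (use w in auto)
  have "holomorphic2_on h (ball z0 (r/2) \<times> ball z0 (r/2))"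
    unfolding holomorphic2_on_def
  proof clarify
    fix z w assume z: "z \<in> ball z0 (r/2)" and w: "w \<in> ball z0 (r/2)"
    define e where "e = r/2 - max (dist z0 z) (dist z0 w)"
    have e: "0 < e" using z w by (auto simp: e_def)
    have bz: "ball z e \<subseteq> ball z0 (r/2)" and bw: "ball w e \<subseteq> ball z0 (r/2)"
      by (auto simp: e_def intro!: subset_ball simp: ball_subset_ball_iff dist_commute)
    have half: "ball z0 (r/2) \<subseteq> ?B" using r by auto
    show "\<exists>a b. (h has_derivative (\<lambda>(s, t). a * s + b * t)) (at (z, w))"
    proof (rule separately_holomorphic_imp_holomorphic2[OF e, of _ _ _ "4 * M / r"])
      show "norm (h (x, y)) \<le> 4 * M / r" if "x \<in> ball z e" "y \<in> ball w e" for x y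
        by (rule bd) (use that bz bw r in auto)
      show "(\<lambda>x. h (x, y)) holomorphic_on ball z e" if "y \<in> ball w e" for y
      proof -
        have "y \<in> ball z0 (r/2)" using that bw by blast
        then have "y \<in> ?B" using r by auto
        moreover have "ball z e \<subseteq> ?B" using bz half by blast
        ultimately show ?thesis using h1 holomorphic_on_subset by blast
      qed
      show "(\<lambda>y. h (x, y)) holomorphic_on ball w e" if "x \<in> ball z e" for x
      proof -
        have "x \<in> ball z0 (r/2)" using that bz by blast
        then have "x \<in> ?B" using r by auto
        moreover have "ball w e \<subseteq> ?B" using bw half by blast
        ultimately show ?thesis using h2 holomorphic_on_subset by blast
      qed
    qed
  qed
  moreover have "F (z, w) = (w - z) * h (z, w)" if "z \<in> ball z0 (r/2)" for z w
    using hF[of z w] that r by auto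
  ultimately show ?thesis using that by blast
qed

text \<open>Taylor expansion in \<open>w\<close> around \<open>w = z\<close>, with coefficients
  holomorphic in the parameter \<open>z\<close>. The next coefficient is the restriction
  \<open>h (z, z)\<close> of the remainder to the diagonal; what is left is zero there, hence
  divisible by \<open>w - z\<close>. Each step halves the radius.\<close>

lemma diagonal_expansion:
  assumes F: "holomorphic2_on F S" and S: "open S" "(z0, z0) \<in> S"
  shows "\<exists>r a h. 0 < r \<and> ball z0 r \<times> ball z0 r \<subseteq> S \<and> (\<forall>i<k. a i holomorphic_on ball z0 r) \<and>
     holomorphic2_on h (ball z0 r \<times> ball z0 r) \<and>
     (\<forall>z\<in>ball z0 r. \<forall>w\<in>ball z0 r. F (z, w) = (\<Sum>i<k. a i z * (w - z)^i) + (w - z)^k * h (z, w))"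
proof (induction k)
  case 0
  obtain A B where AB: "open A" "open B" "z0 \<in> A" "z0 \<in> B" "A \<times> B \<subseteq> S"
    using open_prod_elim[OF S] by (metis mem_Sigma_iff)
  then obtain r where "0 < r" "ball z0 r \<subseteq> A \<inter> B" by (meson IntI open_Int openE)
  then have "0 < r" "ball z0 r \<times> ball z0 r \<subseteq> S" using AB by auto
  moreover have "holomorphic2_on F (ball z0 r \<times> ball z0 r)"
    using F calculation(2) by (rule holomorphic2_on_subset)
  ultimately show ?case by (intro exI[of _ r] exI[of _ "\<lambda>_ _. 0"] exI[of _ F]) auto
next
  case (Suc k)
  then obtain r a h where r: "0 < r" "ball z0 r \<times> ball z0 r \<subseteq> S"
    and a: "\<And>i. i < k \<Longrightarrow> a i holomorphic_on ball z0 r"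
    and h: "holomorphic2_on h (ball z0 r \<times> ball z0 r)"
    and eq: "\<And>z w. z \<in> ball z0 r \<Longrightarrow> w \<in> ball z0 r \<Longrightarrow>
        F (z, w) = (\<Sum>i<k. a i z * (w - z)^i) + (w - z)^k * h (z, w)"
    by blast
  have hd: "(\<lambda>z. h (z, z)) holomorphic_on ball z0 r"
    by (rule holomorphic2_on_slice[OF h]) (auto intro!: holomorphic_intros)
  have "holomorphic2_on (\<lambda>p. h p - h (fst p, fst p)) (ball z0 r \<times> ball z0 r)"
  proof (intro holomorphic2_on_diff h)
    show "holomorphic2_on (\<lambda>p. h (fst p, fst p)) (ball z0 r \<times> ball z0 r)"
      by (rule holomorphic2_on_outer[OF hd]) (auto intro: holomorphic2_intros)
  qed
  then obtain g where g: "holomorphic2_on g (ball z0 (r/2) \<times> ball z0 (r/2))"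
    "\<And>z w. z \<in> ball z0 (r/2) \<Longrightarrow> w \<in> ball z0 (r/2) \<Longrightarrow> h (z, w) - h (z, z) = (w - z) * g (z, w)"
    using diagonal_division[of "\<lambda>p. h p - h (fst p, fst p)" z0 r] r(1) by auto
  have sub: "ball z0 (r/2) \<subseteq> ball z0 r" using r by auto
  define a' where "a' = a(k := (\<lambda>z. h (z, z)))"
  have "\<forall>i<Suc k. a' i holomorphic_on ball z0 (r/2)"
    using holomorphic_on_subset[OF a sub] holomorphic_on_subset[OF hd sub]
    by (auto simp: a'_def less_Suc_eq)
  moreover have "F (z, w) = (\<Sum>i<Suc k. a' i z * (w - z)^i) + (w - z)^Suc k * g (z, w)"
    if z: "z \<in> ball z0 (r/2)" and w: "w \<in> ball z0 (r/2)" for z w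
  proof -
    have "h (z, w) = h (z, z) + (w - z) * g (z, w)" using g(2)[OF z w] by (simp add: algebra_simps)
    moreover have "F (z, w) = (\<Sum>i<k. a i z * (w - z)^i) + (w - z)^k * h (z, w)"
      using eq z w sub by blast
    moreover have "(\<Sum>i<k. a' i z * (w - z)^i) = (\<Sum>i<k. a i z * (w - z)^i)"
      by (intro sum.cong) (auto simp: a'_def)
    moreover have "a' k z = h (z, z)" by (simp add: a'_def)
    ultimately show ?thesis by (simp add: distrib_left mult_ac)
  qed
  ultimately show ?case
    using r g(1) sub by (intro exI[of _ "r/2"] exI[of _ a'] exI[of _ g]) auto
qed

text \<open>Letting \<open>w\<close> tend to 0 shows that the constant term is zero; then a factor
  \<open>w\<close> is cancelled. The equation is asked on the punctured disc, where this
  cancellation preserves it.\<close>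

lemma polynomial_vanishing_order:
  fixes c :: "nat \<Rightarrow> complex"
  assumes "0 < r" and "continuous_on (ball 0 r) H"
    and "\<And>w. w \<in> ball 0 r - {0} \<Longrightarrow> (\<Sum>i<k. c i * w^i) = w^k * H w"
  shows "\<forall>i<k. c i = 0"
  using assms(3)
proof (induction k arbitrary: c)
  case 0 then show ?case by simp
next
  case (Suc k)
  have split: "(\<Sum>i<Suc k. c i * w^i) = c 0 + w * (\<Sum>i<k. c (Suc i) * w^i)" for w
    by (simp add: sum.lessThan_Suc_shift sum_distrib_left mult_ac del: sum.lessThan_Suc)
  have "((\<lambda>w. c 0 + w * (\<Sum>i<k. c (Suc i) * w^i)) \<longlongrightarrow> c 0 + 0 * (\<Sum>i<k. c (Suc i) * 0^i)) (at 0)"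
    by (intro tendsto_intros)
  then have lim1: "((\<lambda>w. \<Sum>i<Suc k. c i * w^i) \<longlongrightarrow> c 0) (at 0)"
    unfolding split mult_zero_left add_0_right .
  have lim2: "((\<lambda>w. w^Suc k * H w) \<longlongrightarrow> 0^Suc k * H 0) (at 0)"
  proof (intro tendsto_intros)
    show "(H \<longlongrightarrow> H 0) (at 0)"
      using assms(1,2) by (metis centre_in_ball continuous_on_eq_continuous_at isCont_def open_ball)
  qed
  have "eventually (\<lambda>w. (\<Sum>i<Suc k. c i * w^i) = w^Suc k * H w) (at 0)"
  proof (rule eventually_mono)
    show "eventually (\<lambda>w. w \<in> ball 0 r - {0}) (at (0::complex))"
      using assms(1) by (intro eventually_at_in_open) auto
  qed (rule Suc.prems)
  from tendsto_unique[OF trivial_limit_at iffD1[OF tendsto_cong[OF this] lim1] lim2]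
  have "c 0 = 0^Suc k * H 0" .
  then have c0: "c 0 = 0" by simp
  have "(\<Sum>i<k. c (Suc i) * w^i) = w^k * H w" if w: "w \<in> ball 0 r - {0}" for w
  proof -
    have "w \<noteq> 0" using w by simp
    moreover have "w * (\<Sum>i<k. c (Suc i) * w^i) = w * (w^k * H w)"
      using trans[OF split[symmetric] Suc.prems[OF w]] unfolding c0 power_Suc add_0 mult.assoc .
    ultimately show ?thesis by (rule iffD1[OF mult_left_cancel])
  qed
  from Suc.IH[of "\<lambda>i. c (Suc i)", OF this] have "\<forall>i<k. c (Suc i) = 0" by blast
  then show ?case using c0 by (metis less_Suc_eq_0_disj)
qed

text \<open>Serves to prove joint holomorphy: a polynomial in \<open>w\<close> is recovered from its
  values at \<open>0, ..., n\<close> by fixed functions \<open>b j\<close>, so a family of such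
  polynomials becomes a finite sum of products of a function of the parameter and a function of
  \<open>w\<close>.\<close>

lemma lagrange_interpolation:
  obtains b :: "nat \<Rightarrow> complex \<Rightarrow> complex"
  where "\<And>j. b j holomorphic_on UNIV"
    and "\<And>c w. (\<Sum>i\<le>n. c i * w^i) = (\<Sum>j\<le>n. (\<Sum>i\<le>n. c i * of_nat j^i) * b j w)"
proof -
  define L where "L = (\<lambda>j k. smult (1 / (of_nat j - of_nat k)) [:- of_nat k, 1 :: complex:])"
  define q where "q = (\<lambda>j. \<Prod>k\<in>{..n}-{j}. L j k)"
  have deg: "degree (q j) \<le> n" if "j \<le> n" for j
  proof -
    have "degree (q j) \<le> sum (degree \<circ> L j) ({..n}-{j})"
      unfolding q_def by (rule degree_prod_sum_le) simp
    also have "\<dots> \<le> sum (\<lambda>k. 1) ({..n}-{j})" by (intro sum_mono) (auto simp: L_def)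
    also have "\<dots> = n" using that by simp
    finally show ?thesis .
  qed
  have ev: "poly (q j) (of_nat k) = (if k = j then 1 else 0)" if "k \<le> n" for j k
  proof (cases "k = j")
    case True then show ?thesis
      by (auto simp: q_def L_def poly_prod divide_simps intro!: prod.neutral)
  next
    case False
    then have "k \<in> {..n} - {j}" using that by auto
    then have "(\<Prod>x\<in>{..n}-{j}. poly (L j x) (of_nat k)) = 0"
      by (intro prod_zero) (auto simp: L_def intro!: bexI[of _ k])
    then show ?thesis using False by (simp add: q_def poly_prod)
  qed
  have "(\<Sum>i\<le>n. c i * w^i) = (\<Sum>j\<le>n. (\<Sum>i\<le>n. c i * of_nat j^i) * poly (q j) w)" for c :: "nat \<Rightarrow> complex" and w
  proof -
    define P where "P = (\<Sum>i\<le>n. monom (c i) i)"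
    define Q where "Q = (\<Sum>j\<le>n. smult (poly P (of_nat j)) (q j))"
    have P: "poly P x = (\<Sum>i\<le>n. c i * x^i)" for x by (simp add: P_def poly_sum poly_monom)
    have "degree P \<le> n" unfolding P_def
      by (rule degree_sum_le) (auto intro: order_trans[OF degree_monom_le])
    moreover have "degree Q \<le> n" unfolding Q_def
      by (rule degree_sum_le) (auto intro: order_trans[OF degree_smult_le] deg)
    ultimately have d: "degree (P - Q) \<le> n" by (rule degree_diff_le)
    have "poly (P - Q) (of_nat k) = 0" if "k \<le> n" for k
    proof -
      have "poly Q (of_nat k) = (\<Sum>j\<le>n. if k = j then poly P (of_nat j) else 0)"
        unfolding Q_def poly_sum using ev[OF that] by (intro sum.cong) auto
      also have "\<dots> = poly P (of_nat k)" using that by (simp add: sum.delta)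
      finally show ?thesis by simp
    qed
    then have sub: "of_nat ` {..n} \<subseteq> {x. poly (P - Q) x = (0::complex)}" by auto
    have "P - Q = 0"
    proof (rule ccontr)
      assume ne: "P - Q \<noteq> 0"
      have "card (of_nat ` {..n} :: complex set) = n + 1" by (subst card_image) (auto simp: inj_on_def)
      moreover have "card (of_nat ` {..n} :: complex set) \<le> card {x. poly (P - Q) x = 0}"
        using sub poly_roots_finite[OF ne] by (rule card_mono[rotated])
      ultimately show False using card_poly_roots_bound[OF ne] d by simp
    qed
    then have "poly P w = poly Q w" by simp
    then show ?thesis by (simp add: Q_def poly_sum P)
  qed
  moreover have "poly (q j) holomorphic_on UNIV" for j by (intro holomorphic_intros)
  ultimately show ?thesis using that[of "\<lambda>j. poly (q j)"] by blast
qed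

section \<open>Linear algebra of the plane and its symmetric powers\<close>

context complex_plane begin

lemma dual_iff:
  "l \<in> dual \<longleftrightarrow> (\<forall>u v. l (u + v) = l u + l v) \<and> (\<forall>c v. l (scale c v) = c * l v)"
  unfolding dual_def mem_Collect_eq Vector_Spaces.linear_def module_hom_def module_hom_axioms_def
  using vector_space_axioms module_axioms
  by (auto simp: vector_space_def module_def algebra_simps)

lemma
  assumes "m \<in> dual"
  shows dual_scaleV: "m (scale c v) = c * m v"
    and dual_addV: "m (u + v) = m u + m v"
    and dual_zeroV: "m 0 = 0"
    and dual_minusV: "m (- v) = - m v"
proof -
  show s: "m (scale c v) = c * m v" for c v using assms unfolding dual_iff by blast
  show "m (u + v) = m u + m v" using assms unfolding dual_iff by blast
  show "m 0 = 0" using s[of 0 0] by simp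
  show "m (- v) = - m v" using s[of "-1" v] by simp
qed

lemma dual_combination: "l \<in> dual \<Longrightarrow> m \<in> dual \<Longrightarrow> (\<lambda>v. a * l v + b * m v) \<in> dual"
  unfolding dual_iff by (simp add: algebra_simps)

lemma dual_scale: "l \<in> dual \<Longrightarrow> (\<lambda>v. c * l v) \<in> dual"
  unfolding dual_iff by (simp add: algebra_simps)

lemma dual_pencil: "l \<in> dual \<Longrightarrow> m \<in> dual \<Longrightarrow> pencil l m z \<in> dual"
  using dual_combination[of l m 1 z] by (simp add: pencil_def)

lemma coordinates:
  "\<exists>x0 x1 e0 e1. x0 \<in> dual \<and> x1 \<in> dual \<and> x0 e0 = 1 \<and> x0 e1 = 0 \<and> x1 e0 = 0 \<and> x1 e1 = 1 \<and>
    (\<forall>v. v = scale (x0 v) e0 + scale (x1 v) e1)"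
proof -
  obtain B where B: "independent B" "UNIV \<subseteq> span B" "card B = 2"
    using basis_exists[of UNIV] dim_plane by metis
  obtain e0 e1 where e: "B = {e0, e1}" "e0 \<noteq> e1" using B(3) by (auto simp: card_2_iff)
  interpret vp: vector_space_pair scale "(*) :: complex \<Rightarrow> complex \<Rightarrow> complex"
    by unfold_locales (auto simp: algebra_simps)
  have ex: "\<exists>x\<in>dual. \<forall>b\<in>B. x b = f b" for f
    using vp.linear_independent_extend[OF B(1), of f] by (auto simp: dual_def)
  obtain x0 where x0: "x0 \<in> dual" "x0 e0 = 1" "x0 e1 = 0"
    using ex[of "\<lambda>b. if b = e0 then 1 else 0"] e by auto
  obtain x1 where x1: "x1 \<in> dual" "x1 e0 = 0" "x1 e1 = 1"
    using ex[of "\<lambda>b. if b = e1 then 1 else 0"] e by auto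
  have "v = scale (x0 v) e0 + scale (x1 v) e1" for v
  proof -
    have "v \<in> span (insert e0 {e1})" using B(2) e by auto
    then obtain a b where "v - scale a e0 = scale b e1"
      unfolding span_insert by (auto simp: span_singleton)
    then have v: "v = scale a e0 + scale b e1" by (simp add: algebra_simps)
    have "x0 v = a" using x0 unfolding v by (simp add: dual_iff)
    moreover have "x1 v = b" using x1 unfolding v by (simp add: dual_iff)
    ultimately show ?thesis using v by simp
  qed
  with x0 x1 show ?thesis by blast
qed

lemma dual_separates:
  assumes "\<And>m. m \<in> dual \<Longrightarrow> m u = m v"
  shows "u = v"
proof -
  obtain x0 x1 e0 e1 where x: "x0 \<in> dual" "x1 \<in> dual" "x0 e0 = 1" "x0 e1 = 0" "x1 e0 = 0" "x1 e1 = 1"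
    and cs: "\<forall>v. v = scale (x0 v) e0 + scale (x1 v) e1"
    using coordinates by blast
  note c = cs[rule_format]
  have "x0 u = x0 v" "x1 u = x1 v" using assms x by auto
  then show ?thesis using c[of u] c[of v] by simp
qed

section \<open>Symmetric powers of the plane and their duals\<close>

lemma Sym_product: "(\<lambda>y. if y \<in> dual then c * (\<Prod>r<j. y (v r)) else 0) \<in> Sym j"
  unfolding Sym_def mem_Collect_eq
  by (intro exI[of _ "1::nat"] exI[of _ "\<lambda>_. c"] exI[of _ "\<lambda>_. v"]) auto

lemma Sym_add:
  assumes "P \<in> Sym j" "Q \<in> Sym j"
  shows "(\<lambda>y. P y + Q y) \<in> Sym j"
proof -
  obtain N c v where P: "P = (\<lambda>y. if y \<in> dual then \<Sum>i<(N::nat). c i * (\<Prod>r<j. y (v i r)) else 0)"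
    using assms(1) by (auto simp: Sym_def)
  obtain N' c' v' where Q: "Q = (\<lambda>y. if y \<in> dual then \<Sum>i<(N'::nat). c' i * (\<Prod>r<j. y (v' i r)) else 0)"
    using assms(2) by (auto simp: Sym_def)
  define d where "d = (\<lambda>i. if i < N then c i else c' (i - N))"
  define w where "w = (\<lambda>i. if i < N then v i else v' (i - N))"
  have "P y + Q y = (if y \<in> dual then \<Sum>i<N + N'. d i * (\<Prod>r<j. y (w i r)) else 0)" for y
  proof -
    have "(\<Sum>i<N + N'. d i * (\<Prod>r<j. y (w i r))) =
        (\<Sum>i<N. d i * (\<Prod>r<j. y (w i r))) + (\<Sum>i<N'. d (N + i) * (\<Prod>r<j. y (w (N + i) r)))"
      by (induction N') (auto simp: add.assoc)
    then show ?thesis by (simp add: P Q d_def w_def)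
  qed
  then show ?thesis unfolding Sym_def by blast
qed

lemma Sym_cmult:
  assumes "P \<in> Sym j" shows "(\<lambda>y. a * P y) \<in> Sym j"
proof -
  obtain N c v where P: "P = (\<lambda>y. if y \<in> dual then \<Sum>i<(N::nat). c i * (\<Prod>r<j. y (v i r)) else 0)"
    using assms by (auto simp: Sym_def)
  have "(\<lambda>y. a * P y) = (\<lambda>y. if y \<in> dual then \<Sum>i<N. (a * c i) * (\<Prod>r<j. y (v i r)) else 0)"
    by (auto simp: P sum_distrib_left mult.assoc)
  then show ?thesis
    unfolding Sym_def mem_Collect_eq by (intro exI[of _ N] exI[of _ "\<lambda>i. a * c i"] exI[of _ v])
qed

lemma Sym_linear: "P \<in> Sym j \<Longrightarrow> Q \<in> Sym j \<Longrightarrow> (\<lambda>y. a * P y + b * Q y) \<in> Sym j"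
  by (intro Sym_add Sym_cmult)

lemma Sym_sum:
  assumes "\<And>i. i \<in> I \<Longrightarrow> P i \<in> Sym j" "finite I"
  shows "(\<lambda>y. \<Sum>i\<in>I. P i y) \<in> Sym j"
  using assms(2,1)
proof (induction I)
  case empty
  have "(\<lambda>y. if y \<in> dual then 0 * (\<Prod>r<j. y ((\<lambda>_. 0) r)) else 0) \<in> Sym j" by (rule Sym_product)
  also have "(\<lambda>y. if y \<in> dual then 0 * (\<Prod>r<j. y ((\<lambda>_. 0) r)) else 0) = (\<lambda>y. \<Sum>i\<in>{}. P i y)" by auto
  finally show ?case .
qed (auto intro: Sym_add)

lemma Sym_mult_vector:
  assumes "P \<in> Sym j" shows "(\<lambda>y. y u * P y) \<in> Sym (Suc j)"
proof -
  obtain N c v where P: "P = (\<lambda>y. if y \<in> dual then \<Sum>i<(N::nat). c i * (\<Prod>r<j. y (v i r)) else 0)"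
    using assms by (auto simp: Sym_def)
  define w where "w = (\<lambda>i r. if r < j then v i r else u)"
  have "y u * P y = (if y \<in> dual then \<Sum>i<N. c i * (\<Prod>r<Suc j. y (w i r)) else 0)" for y
    by (simp add: P w_def sum_distrib_left mult_ac)
  then show ?thesis unfolding Sym_def by blast
qed

lemma Sym_homogeneous:
  assumes "P \<in> Sym j" "y \<in> dual"
  shows "P (\<lambda>v. c * y v) = c ^ j * P y"
  using assms dual_scale[of y c]
  by (auto simp: Sym_def prod.distrib sum_distrib_left mult_ac)

lemma Sym_in_L_sections:
  assumes "P \<in> Sym j"
  shows "P \<in> L_sections (int j) U"
  unfolding L_sections_def mem_Collect_eq
proof (intro conjI ballI allI impI)
  show "P (\<lambda>v. c * l v) = c powi int j * P l" if "l \<in> cone \<xi>" for \<xi> l c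
    using Sym_homogeneous[OF assms] that by (simp add: cone_def)
next
  fix l m assume "frame l m"
  then have d: "pencil l m z \<in> dual" for z by (auto simp: frame_def intro: dual_pencil)
  obtain N c v where P: "P = (\<lambda>y. if y \<in> dual then \<Sum>i<(N::nat). c i * (\<Prod>r<j. y (v i r)) else 0)"
    using assms by (auto simp: Sym_def)
  have "(\<lambda>z. \<Sum>i<N. c i * (\<Prod>r<j. l (v i r) + z * m (v i r))) holomorphic_on {z. line (pencil l m z) \<in> U}"
    by (intro holomorphic_intros)
  then show "(\<lambda>z. P (pencil l m z)) holomorphic_on {z. line (pencil l m z) \<in> U}"
    using d by (simp add: P pencil_def)
qed

lemma Sym_dual_linear:
  "\<lbrakk>\<phi> \<in> Sym_dual j; P \<in> Sym j; Q \<in> Sym j\<rbrakk> \<Longrightarrow> \<phi> (\<lambda>y. a * P y + b * Q y) = a * \<phi> P + b * \<phi> Q"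
  by (simp add: Sym_dual_def)

lemma Sym_dual_sum:
  assumes "\<phi> \<in> Sym_dual j" "\<And>i. i \<in> I \<Longrightarrow> P i \<in> Sym j" "finite I"
  shows "\<phi> (\<lambda>y. \<Sum>i\<in>I. c i * P i y) = (\<Sum>i\<in>I. c i * \<phi> (P i))"
  using assms(3,2)
proof (induction I)
  case empty
  have "(\<lambda>y. \<Sum>i\<in>{}. c i * P i y) \<in> Sym j" by (rule Sym_sum) auto
  then have Z: "(\<lambda>y. 0) \<in> Sym j" by simp
  then show ?case using Sym_dual_linear[OF assms(1) Z Z, of 0 0] by simp
next
  case (insert i I)
  have "(\<lambda>y. \<Sum>i\<in>I. c i * P i y) \<in> Sym j" using insert by (intro Sym_sum Sym_cmult) auto
  then have "\<phi> (\<lambda>y. c i * P i y + 1 * (\<Sum>i\<in>I. c i * P i y)) =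
      c i * \<phi> (P i) + 1 * \<phi> (\<lambda>y. \<Sum>i\<in>I. c i * P i y)"
    using insert.prems by (intro Sym_dual_linear[OF assms(1)]) auto
  then show ?case using insert by simp
qed

end

context oriented_plane begin

section \<open>The bivector as a determinant, lines and charts\<close>

lemma omega_linear_right:
  assumes "l \<in> dual" "m \<in> dual" "m' \<in> dual"
  shows "\<omega> l (\<lambda>v. a * m v + b * m' v) = a * \<omega> l m + b * \<omega> l m'"
proof -
  have "\<omega> l (\<lambda>v. a * m v + b * m' v) = - (a * \<omega> m l + b * \<omega> m' l)"
    unfolding omega_linear[OF assms(2,3,1), symmetric]
    by (rule omega_alternating[OF dual_combination[OF assms(2,3)] assms(1)])
  then show ?thesis
    unfolding omega_alternating[OF assms(1,2)] omega_alternating[OF assms(1,3)] by simp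
qed

lemma omega_self: "l \<in> dual \<Longrightarrow> \<omega> l l = 0"
  using omega_alternating[of l l] by (metis add_eq_0_iff2 mult_2 mult_eq_0_iff zero_neq_numeral)

lemma omega_scale_left: "\<lbrakk>l \<in> dual; m \<in> dual\<rbrakk> \<Longrightarrow> \<omega> (\<lambda>v. c * l v) m = c * \<omega> l m"
  using omega_linear[of l l m c 0] by simp

lemma omega_scale_right: "\<lbrakk>l \<in> dual; m \<in> dual\<rbrakk> \<Longrightarrow> \<omega> l (\<lambda>v. c * m v) = c * \<omega> l m"
  using omega_linear_right[of l m m c 0] by simp

text \<open>An alternating form on a plane is a multiple of the determinant in the coordinates of a
  dual basis; algebraic identities for \<open>\<omega>\<close> are reduced to this formula.\<close>

lemma omega_coordinates:
  "\<exists>x0 x1 e0 e1. x0 \<in> dual \<and> x1 \<in> dual \<and> x0 e0 = 1 \<and> x0 e1 = 0 \<and> x1 e0 = 0 \<and> x1 e1 = 1 \<and>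
    (\<forall>v. v = scale (x0 v) e0 + scale (x1 v) e1) \<and>
    (\<forall>y\<in>dual. y = (\<lambda>v. y e0 * x0 v + y e1 * x1 v)) \<and>
    (\<forall>l\<in>dual. \<forall>m\<in>dual. \<omega> l m = (l e0 * m e1 - l e1 * m e0) * \<omega> x0 x1) \<and> \<omega> x0 x1 \<noteq> 0"
proof -
  obtain x0 x1 e0 e1 where x: "x0 \<in> dual" "x1 \<in> dual" "x0 e0 = 1" "x0 e1 = 0" "x1 e0 = 0" "x1 e1 = 1"
    and cs: "\<forall>v. v = scale (x0 v) e0 + scale (x1 v) e1"
    using coordinates by blast
  note c = cs[rule_format]
  have y: "y = (\<lambda>v. y e0 * x0 v + y e1 * x1 v)" if "y \<in> dual" for y
  proof
    fix v
    have "y v = y (scale (x0 v) e0 + scale (x1 v) e1)" using c[of v] by simp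
    also have "\<dots> = y e0 * x0 v + y e1 * x1 v" using that by (simp add: dual_iff mult.commute)
    finally show "y v = y e0 * x0 v + y e1 * x1 v" .
  qed
  have om: "\<omega> l m = (l e0 * m e1 - l e1 * m e0) * \<omega> x0 x1" if l: "l \<in> dual" and m: "m \<in> dual" for l m
  proof -
    have "\<omega> l m = \<omega> (\<lambda>v. l e0 * x0 v + l e1 * x1 v) m" using y[OF l] by simp
    also have "\<dots> = l e0 * \<omega> x0 m + l e1 * \<omega> x1 m" using x m by (simp add: omega_linear)
    also have "\<omega> x0 m = m e1 * \<omega> x0 x1"
      using y[OF m] omega_linear_right[OF x(1) x(1) x(2), of "m e0" "m e1"] omega_self[OF x(1)] by simp
    also have "\<omega> x1 m = - (m e0 * \<omega> x0 x1)"
      using y[OF m] omega_linear_right[OF x(2) x(1) x(2), of "m e0" "m e1"] omega_self[OF x(2)]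
        omega_alternating[OF x(1,2)] by simp
    finally show ?thesis by (simp add: algebra_simps)
  qed
  have "\<omega> x0 x1 \<noteq> 0" using omega_nonzero om by fastforce
  with x cs y om show ?thesis by blast
qed

text \<open>Cramer's rule: three vectors of a plane satisfy a linear relation whose coefficients are
  their 2 by 2 determinants.\<close>

lemma omega_expand:
  assumes "l \<in> dual" "m \<in> dual" "y \<in> dual"
  shows "\<omega> l m * y v = \<omega> y m * l v + \<omega> l y * m v"
proof -
  obtain x0 x1 e0 e1 where x: "x0 \<in> dual" "x1 \<in> dual" "x0 e0 = 1" "x0 e1 = 0" "x1 e0 = 0" "x1 e1 = 1"
    and cs: "\<forall>v. v = scale (x0 v) e0 + scale (x1 v) e1"
    and ys: "\<forall>y\<in>dual. y = (\<lambda>v. y e0 * x0 v + y e1 * x1 v)"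
    and oms: "\<forall>l\<in>dual. \<forall>m\<in>dual. \<omega> l m = (l e0 * m e1 - l e1 * m e0) * \<omega> x0 x1"
    and nz: "\<omega> x0 x1 \<noteq> 0"
    using omega_coordinates by blast
  note c = cs[rule_format] and y = ys[rule_format] and om = oms[rule_format]
  have ev: "y v = y e0 * x0 v + y e1 * x1 v" if "y \<in> dual" for y using y[OF that] by (rule fun_cong)
  show ?thesis
    unfolding om[OF assms(1,2)] om[OF assms(3,2)] om[OF assms(1,3)]
      ev[OF assms(1)] ev[OF assms(2)] ev[OF assms(3)]
    by (simp add: algebra_simps)
qed

lemma frame_iff: "frame l m \<longleftrightarrow> l \<in> dual \<and> m \<in> dual \<and> \<omega> l m \<noteq> 0"
proof -
  have "\<forall>v. l v = 0 \<longrightarrow> m v = 0 \<longrightarrow> v = 0" if lm: "l \<in> dual" "m \<in> dual" "\<omega> l m \<noteq> 0"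
  proof (intro allI impI)
    fix v assume "l v = 0" "m v = 0"
    then have yv: "y v = 0" if "y \<in> dual" for y
      using omega_expand[OF lm(1,2) that, of v] lm(3) by simp
    show "v = 0"
    proof (rule dual_separates)
      fix y assume y: "y \<in> dual"
      show "y v = y 0" using yv[OF y] dual_zeroV[OF y] by simp
    qed
  qed
  moreover have "\<omega> l m \<noteq> 0" if lm: "l \<in> dual" "m \<in> dual" and inj: "\<forall>v. l v = 0 \<longrightarrow> m v = 0 \<longrightarrow> v = 0"
  proof
    assume z: "\<omega> l m = 0"
    obtain x0 x1 e0 e1 where x: "x0 \<in> dual" "x1 \<in> dual" "x0 e0 = 1" "x0 e1 = 0" "x1 e0 = 0" "x1 e1 = 1"
    and cs: "\<forall>v. v = scale (x0 v) e0 + scale (x1 v) e1"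
    and ys: "\<forall>y\<in>dual. y = (\<lambda>v. y e0 * x0 v + y e1 * x1 v)"
    and oms: "\<forall>l\<in>dual. \<forall>m\<in>dual. \<omega> l m = (l e0 * m e1 - l e1 * m e0) * \<omega> x0 x1"
    and nz: "\<omega> x0 x1 \<noteq> 0"
    using omega_coordinates by blast
  note c = cs[rule_format] and y = ys[rule_format] and om = oms[rule_format]
    have d: "l e0 * m e1 - l e1 * m e0 = 0" using om[OF lm] z nz by simp
    have lin: "y (scale a e0 + scale b e1) = a * y e0 + b * y e1" if "y \<in> dual" for y a b
      using that by (simp add: dual_iff)
    have zero: "y 0 = 0" if "y \<in> dual" for y
      using that by (rule dual_zeroV)
    have nonzero: "scale a e0 + scale b e1 = 0 \<Longrightarrow> a = 0 \<and> b = 0" for a b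
    proof -
      assume z: "scale a e0 + scale b e1 = 0"
      have "a * 1 + b * 0 = 0" using lin[OF x(1), of a b] zero[OF x(1)] unfolding z x by simp
      moreover have "a * 0 + b * 1 = 0" using lin[OF x(2), of a b] zero[OF x(2)] unfolding z x by simp
      ultimately show ?thesis by simp
    qed
    have k: "b = 0 \<and> a = 0" if "a * l e0 + b * l e1 = 0" "a * m e0 + b * m e1 = 0" for a b
      using inj lin[OF lm(1), of a b] lin[OF lm(2), of a b] that nonzero by metis
    \<comment> \<open>If the determinant is zero, the pairs \<open>(m e1, - m e0)\<close> and
      \<open>(l e1, - l e0)\<close> solve the homogeneous system, so both covectors vanish on the
      basis; then \<open>(1, 0)\<close> is a nonzero solution as well.\<close>
    have "m e1 = 0 \<and> m e0 = 0" using k[of "m e1" "- m e0"] d by (simp add: algebra_simps)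
    moreover have "l e1 = 0 \<and> l e0 = 0" using k[of "l e1" "- l e0"] d by (simp add: algebra_simps)
    ultimately show False using k[of 1 0] by simp
  qed
  ultimately show ?thesis unfolding frame_def by blast
qed

lemma sharp_eq:
  assumes "l \<in> dual" "m \<in> dual"
  shows "m (sharp l) = \<omega> l m"
proof -
  obtain x0 x1 e0 e1 where x: "x0 \<in> dual" "x1 \<in> dual" "x0 e0 = 1" "x0 e1 = 0" "x1 e0 = 0" "x1 e1 = 1"
    and cs: "\<forall>v. v = scale (x0 v) e0 + scale (x1 v) e1"
    and ys: "\<forall>y\<in>dual. y = (\<lambda>v. y e0 * x0 v + y e1 * x1 v)"
    and oms: "\<forall>l\<in>dual. \<forall>m\<in>dual. \<omega> l m = (l e0 * m e1 - l e1 * m e0) * \<omega> x0 x1"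
    and nz: "\<omega> x0 x1 \<noteq> 0"
    using omega_coordinates by blast
  note c = cs[rule_format] and y = ys[rule_format] and om = oms[rule_format]
  define v where "v = scale (\<omega> l x0) e0 + scale (\<omega> l x1) e1"
  have v: "m v = \<omega> l m" if m: "m \<in> dual" for m
  proof -
    have "m v = m e0 * \<omega> l x0 + m e1 * \<omega> l x1" using m by (simp add: v_def dual_iff mult.commute)
    also have "\<dots> = \<omega> l m"
      using y[OF m] omega_linear_right[OF assms(1) x(1,2), of "m e0" "m e1"] by simp
    finally show ?thesis .
  qed
  have "\<forall>m\<in>dual. m (sharp l) = \<omega> l m"
    unfolding sharp_def
  proof (rule theI)
    show "\<forall>m\<in>dual. m v = \<omega> l m" using v by blast
    show "u = v" if "\<forall>m\<in>dual. m u = \<omega> l m" for u by (rule dual_separates) (use that v in auto)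
  qed
  then show ?thesis using assms(2) by blast
qed

lemma sharp_surj: "\<exists>l\<in>dual. sharp l = v"
proof -
  obtain x0 x1 e0 e1 where x: "x0 \<in> dual" "x1 \<in> dual" "x0 e0 = 1" "x0 e1 = 0" "x1 e0 = 0" "x1 e1 = 1"
    and cs: "\<forall>v. v = scale (x0 v) e0 + scale (x1 v) e1"
    and ys: "\<forall>y\<in>dual. y = (\<lambda>v. y e0 * x0 v + y e1 * x1 v)"
    and oms: "\<forall>l\<in>dual. \<forall>m\<in>dual. \<omega> l m = (l e0 * m e1 - l e1 * m e0) * \<omega> x0 x1"
    and nz: "\<omega> x0 x1 \<noteq> 0"
    using omega_coordinates by blast
  note c = cs[rule_format] and y = ys[rule_format] and om = oms[rule_format]
  \<comment> \<open>These coordinates solve \<open>\<omega> l m = m v\<close> for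
    \<open>m = x0\<close> and \<open>m = x1\<close>, since
    \<open>\<omega> l x0 = - l e1 * \<omega> x0 x1\<close> and
    \<open>\<omega> l x1 = l e0 * \<omega> x0 x1\<close>.\<close>
  define l where "l = (\<lambda>u. (x1 v / \<omega> x0 x1) * x0 u + (- x0 v / \<omega> x0 x1) * x1 u)"
  have l: "l \<in> dual" unfolding l_def by (rule dual_combination[OF x(1,2)])
  have "sharp l = v"
  proof (rule dual_separates)
    fix m assume m: "m \<in> dual"
    have "m (sharp l) = (l e0 * m e1 - l e1 * m e0) * \<omega> x0 x1" using sharp_eq[OF l m] om[OF l m] by simp
    also have "\<dots> = x0 v * m e0 + x1 v * m e1" using nz x by (simp add: l_def field_simps)
    also have "\<dots> = m (scale (x0 v) e0 + scale (x1 v) e1)" using m by (simp add: dual_iff)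
    finally show "m (sharp l) = m v" using c[of v] by simp
  qed
  then show ?thesis using l by blast
qed

lemma omega_eq_0_iff:
  assumes "l \<in> dual" "l \<noteq> (\<lambda>_. 0)" "y \<in> dual"
  shows "\<omega> l y = 0 \<longleftrightarrow> (\<exists>c. y = (\<lambda>v. c * l v))"
proof
  assume z: "\<omega> l y = 0"
  obtain m where m: "m \<in> dual" "\<omega> l m \<noteq> 0"
  proof -
    obtain v where v: "l v \<noteq> 0" using assms(2) by auto
    obtain m where m: "m \<in> dual" "sharp m = v" using sharp_surj by blast
    then have "\<omega> m l \<noteq> 0" using v sharp_eq[OF m(1) assms(1)] by simp
    then show ?thesis using that[OF m(1)] omega_alternating[OF assms(1) m(1)] by auto
  qed
  have "y v = (\<omega> y m / \<omega> l m) * l v" for v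
    using omega_expand[OF assms(1) m(1) assms(3), of v] z m by (simp add: field_simps)
  then show "\<exists>c. y = (\<lambda>v. c * l v)" by blast
next
  assume "\<exists>c. y = (\<lambda>v. c * l v)"
  then show "\<omega> l y = 0" using omega_scale_right[OF assms(1) assms(1)] omega_self[OF assms(1)] by auto
qed

text \<open>A vector \<open>sharp y\<close> is killed by \<open>l\<close> exactly when
  \<open>\<omega> l y = 0\<close>, that is, when \<open>y\<close> is a multiple of \<open>l\<close>.
  So \<open>sharp\<close> carries the covectors vanishing on a line, the fibre of the dual of
  \<open>L\<close>, onto the line itself, the fibre of the tautological bundle.\<close>

lemma line_eq_range_sharp:
  assumes "l \<in> dual" "l \<noteq> (\<lambda>_. 0)"
  shows "line l = span {sharp l}" "sharp l \<noteq> 0"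
proof -
  have scale_sharp: "sharp (\<lambda>v. c * l v) = scale c (sharp l)" for c
  proof (rule dual_separates)
    fix m assume m: "m \<in> dual"
    show "m (sharp (\<lambda>v. c * l v)) = m (scale c (sharp l))"
      unfolding sharp_eq[OF dual_scale[OF assms(1)] m] dual_scaleV[OF m] sharp_eq[OF assms(1) m]
      by (rule omega_scale_left[OF assms(1) m])
  qed
  show "line l = span {sharp l}"
  proof
    show "span {sharp l} \<subseteq> line l"
      using sharp_eq[OF assms(1,1)] omega_self[OF assms(1)] dual_scaleV[OF assms(1)]
      by (auto simp: span_singleton line_def)
    show "line l \<subseteq> span {sharp l}"
    proof
      fix v assume v: "v \<in> line l"
      obtain y where y: "y \<in> dual" "sharp y = v" using sharp_surj by blast
      then have "\<omega> l y = 0"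
        using v sharp_eq[OF y(1) assms(1)] omega_alternating[OF assms(1) y(1)] by (simp add: line_def)
      then obtain c where "y = (\<lambda>v. c * l v)" using omega_eq_0_iff[OF assms y(1)] by blast
      then show "v \<in> span {sharp l}" using scale_sharp y by (auto simp: span_singleton)
    qed
  qed
  show "sharp l \<noteq> 0"
  proof
    assume "sharp l = 0"
    then have z: "\<omega> l m = 0" if "m \<in> dual" for m
      using sharp_eq[OF assms(1) that] dual_zeroV[OF that] by simp
    obtain v where v: "l v \<noteq> 0" using assms(2) by auto
    obtain m where m: "m \<in> dual" "sharp m = v" using sharp_surj by blast
    show False using v sharp_eq[OF m(1) assms(1)] omega_alternating[OF assms(1) m(1)] z[OF m(1)] m(2) by simp
  qed
qed

lemma line_in_X: "l \<in> dual \<Longrightarrow> l \<noteq> (\<lambda>_. 0) \<Longrightarrow> line l \<in> X"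
  using line_eq_range_sharp[of l] dim_eq_card_independent[of "{sharp l}"]
  by (simp add: X_def)

lemma X_obtain_line:
  assumes "\<xi> \<in> X"
  obtains l where "l \<in> dual" "l \<noteq> (\<lambda>_. 0)" "line l = \<xi>"
proof -
  have \<xi>: "subspace \<xi>" "dim \<xi> = 1" using assms by (auto simp: X_def)
  obtain B where B: "B \<subseteq> \<xi>" "independent B" "\<xi> \<subseteq> span B" "card B = 1"
    using basis_exists[of \<xi>] \<xi>(2) by metis
  obtain u where u: "B = {u}" using B(4) card_1_singletonE by blast
  have "u \<noteq> 0" using B(2) u by auto
  have sp: "\<xi> = span {u}" using B \<xi>(1) u span_minimal by blast
  obtain l where l: "l \<in> dual" "sharp l = u" using sharp_surj by blast
  have "l \<noteq> (\<lambda>_. 0)"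
  proof
    assume l0: "l = (\<lambda>_. 0)"
    have "sharp l = 0"
    proof (rule dual_separates)
      fix m assume m: "m \<in> dual"
      then show "m (sharp l) = m 0"
        using sharp_eq[OF l(1) m] omega_scale_left[OF l(1) m, of 0] l0 dual_zeroV[OF m] by simp
    qed
    then show False using l \<open>u \<noteq> 0\<close> by simp
  qed
  with l sp line_eq_range_sharp that show ?thesis by metis
qed

text \<open>This is why \<open>\<omega>\<close> can serve as an equation of the diagonal of
  \<open>X\<close>.\<close>

lemma line_eq_iff:
  assumes "l \<in> dual" "l \<noteq> (\<lambda>_. 0)" "m \<in> dual" "m \<noteq> (\<lambda>_. 0)"
  shows "line l = line m \<longleftrightarrow> \<omega> l m = 0"
proof
  assume "line l = line m"
  then have "sharp l \<in> line m" using line_eq_range_sharp(1)[OF assms(1,2)] span_base[of "sharp l" "{sharp l}"] by simp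
  then show "\<omega> l m = 0" using sharp_eq[OF assms(1,3)] by (simp add: line_def)
next
  assume "\<omega> l m = 0"
  then obtain c where c: "m = (\<lambda>v. c * l v)" using omega_eq_0_iff[OF assms(1-3)] by blast
  then have "c \<noteq> 0" using assms(4) by auto
  then show "line l = line m" unfolding line_def c by simp
qed

lemma zero_line_notin_X: "line (\<lambda>_. 0) \<notin> X"
  using dim_plane by (auto simp: X_def line_def)

lemma coneD:
  assumes "\<xi> \<in> X" "l \<in> cone \<xi>"
  shows "l \<in> dual" "l \<noteq> (\<lambda>_. 0)" "line l = \<xi>"
  using assms zero_line_notin_X by (auto simp: cone_def)

lemma cone_scaleE:
  assumes "\<xi> \<in> X" "l \<in> cone \<xi>" "l' \<in> cone \<xi>"
  obtains c where "c \<noteq> 0" "l' = (\<lambda>v. c * l v)"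
proof -
  note l = coneD[OF assms(1,2)] and l' = coneD[OF assms(1,3)]
  have "\<omega> l l' = 0" using line_eq_iff[OF l(1,2) l'(1,2)] l(3) l'(3) by simp
  then obtain c where "l' = (\<lambda>v. c * l v)" using omega_eq_0_iff[OF l(1,2) l'(1)] by blast
  with that l'(2) show ?thesis by (metis mult_zero_left)
qed

lemma cone_scale: "l \<in> cone \<xi> \<Longrightarrow> c \<noteq> 0 \<Longrightarrow> (\<lambda>v. c * l v) \<in> cone \<xi>"
  using dual_scale[of l c] by (auto simp: cone_def line_def)

lemma frameD: "frame l m \<Longrightarrow> l \<in> dual" "frame l m \<Longrightarrow> m \<in> dual" "frame l m \<Longrightarrow> \<omega> l m \<noteq> 0"
  by (simp_all add: frame_iff)

lemma frame_nonzero: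
  assumes "frame l m" shows "l \<noteq> (\<lambda>_. 0)" "m \<noteq> (\<lambda>_. 0)"
proof -
  note lm = frameD[OF assms]
  show "l \<noteq> (\<lambda>_. 0)"
  proof
    assume l: "l = (\<lambda>_. 0)"
    have "\<omega> (\<lambda>v. 0 * l v) m = 0" using omega_scale_left[OF lm(1,2), of 0] by simp
    then show False using lm(3) l by simp
  qed
  show "m \<noteq> (\<lambda>_. 0)"
  proof
    assume m: "m = (\<lambda>_. 0)"
    have "\<omega> l (\<lambda>v. 0 * m v) = 0" using omega_scale_right[OF lm(1,2), of 0] by simp
    then show False using lm(3) m by simp
  qed
qed

lemma omega_pencil:
  assumes "l \<in> dual" "m \<in> dual" "y \<in> dual"
  shows "\<omega> (pencil l m z) y = \<omega> l y + z * \<omega> m y" "\<omega> y (pencil l m z) = \<omega> y l + z * \<omega> y m"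
  using omega_linear[of l m y 1 z] omega_linear_right[of y l m 1 z] assms by (simp_all add: pencil_def)

text \<open>In a chart \<open>\<omega>\<close> is the local equation \<open>w - z\<close> of the
  diagonal, up to the constant \<open>\<omega> l m\<close>. All orders of zeros and poles along the
  diagonal are read off from this.\<close>

lemma omega_pencils:
  assumes "l \<in> dual" "m \<in> dual"
  shows "\<omega> (pencil l m z) (pencil l m w) = (w - z) * \<omega> l m"
    "\<omega> l (pencil l m w) = w * \<omega> l m" "\<omega> (pencil l m w) m = \<omega> l m"
  using assms omega_self[of l] omega_self[of m] omega_alternating[of l m]
  by (simp_all add: omega_pencil dual_pencil algebra_simps)

lemma frame_pencil: "frame l m \<Longrightarrow> frame (pencil l m z) m"
  by (simp add: frame_iff omega_pencils dual_pencil)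

lemma pencil_pencil: "pencil (pencil l m z) m w = pencil l m (z + w)"
  by (auto simp: pencil_def algebra_simps)

lemma pencil_0: "pencil l m 0 = l" by (simp add: pencil_def)

lemma frame_swap: "frame l m \<Longrightarrow> frame m l"
  using omega_alternating[of l m] by (auto simp: frame_iff)

lemma pencil_nonzero: "frame l m \<Longrightarrow> pencil l m z \<noteq> (\<lambda>_. 0)"
  by (rule frame_nonzero(1)[OF frame_pencil])

lemma line_pencil_in_X: "frame l m \<Longrightarrow> line (pencil l m z) \<in> X"
  by (intro line_in_X pencil_nonzero dual_pencil frameD)

lemma line_in_X_frame: "frame l m \<Longrightarrow> line l \<in> X" "frame l m \<Longrightarrow> line m \<in> X"
  using frame_nonzero frameD line_in_X by auto

lemma pencil_in_cone: "frame l m \<Longrightarrow> pencil l m z \<in> cone (line (pencil l m z))"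
  by (simp add: cone_def dual_pencil frameD)

lemma line_pencil_eq_iff: "frame l m \<Longrightarrow> line (pencil l m z) = line (pencil l m w) \<longleftrightarrow> z = w"
  by (subst line_eq_iff) (auto simp: dual_pencil frameD pencil_nonzero omega_pencils)

text \<open>The inverse of the chart, by Cramer's rule: the chart reaches every line except
  \<open>line m\<close>, its point at infinity.\<close>

lemma pencil_expand:
  assumes "frame l m" "y \<in> dual" "\<omega> y m \<noteq> 0"
  shows "y = (\<lambda>v. \<omega> y m / \<omega> l m * pencil l m (\<omega> l y / \<omega> y m) v)"
proof
  fix v
  have "\<omega> y m / \<omega> l m * pencil l m (\<omega> l y / \<omega> y m) v = (\<omega> y m * l v + \<omega> l y * m v) / \<omega> l m"
    using frameD(3)[OF assms(1)] assms(3) by (simp add: pencil_def divide_simps)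
  also have "\<dots> = y v"
    unfolding omega_expand[OF frameD(1,2)[OF assms(1)] assms(2), symmetric]
    using frameD(3)[OF assms(1)] by simp
  finally show "y v = \<omega> y m / \<omega> l m * pencil l m (\<omega> l y / \<omega> y m) v" ..
qed

lemma exists_frame:
  assumes "l \<in> dual" "l \<noteq> (\<lambda>_. 0)"
  obtains m where "frame l m"
proof -
  obtain v where v: "l v \<noteq> 0" using assms(2) by auto
  obtain m where m: "m \<in> dual" "sharp m = v" using sharp_surj by blast
  then have "\<omega> m l \<noteq> 0" using v sharp_eq[OF m(1) assms(1)] by simp
  then show ?thesis using that assms(1) m(1) omega_alternating[OF assms(1) m(1)] by (auto simp: frame_iff)
qed

lemma X_obtain_frame:
  assumes "\<xi> \<in> X"
  obtains l m where "frame l m" "line l = \<xi>" "l \<in> cone \<xi>"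
proof -
  obtain l where l: "l \<in> dual" "l \<noteq> (\<lambda>_. 0)" "line l = \<xi>" using X_obtain_line[OF assms] by blast
  obtain m where "frame l m" using exists_frame[OF l(1,2)] by blast
  with l that show ?thesis by (simp add: cone_def)
qed

text \<open>\<open>\<omega> l y\<close> and \<open>\<omega> y m\<close> are linear coordinates of
  \<open>y\<close> with respect to the frame. On \<open>pencil l m w\<close> they are
  \<open>w * \<omega> l m\<close> and \<open>\<omega> l m\<close>, so for \<open>i\<close> at most
  \<open>j\<close> the monomial restricts to \<open>\<omega> l m ^ j * w ^ i\<close>.\<close>

definition monomial :: "'v covector \<Rightarrow> 'v covector \<Rightarrow> nat \<Rightarrow> nat \<Rightarrow> 'v covector \<Rightarrow> complex" where
  "monomial l m j i = (\<lambda>y. if y \<in> dual then \<omega> l y ^ i * \<omega> y m ^ (j - i) else 0)"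

lemma monomial_in_Sym:
  assumes "l \<in> dual" "m \<in> dual" "i \<le> j"
  shows "monomial l m j i \<in> Sym j"
proof -
  define v where "v = (\<lambda>r. if r < i then sharp l else - sharp m)"
  have "(\<Prod>r<j. y (v r)) = \<omega> l y ^ i * \<omega> y m ^ (j - i)" if y: "y \<in> dual" for y
  proof -
    have "(\<Prod>r<j. y (v r)) = (\<Prod>r\<in>{..<i}. y (v r)) * (\<Prod>r\<in>{i..<j}. y (v r))"
      using assms(3) by (subst prod.union_disjoint[symmetric]) (auto simp: ivl_disj_un)
    also have "(\<Prod>r\<in>{..<i}. y (v r)) = \<omega> l y ^ i" using sharp_eq[OF assms(1) y] by (simp add: v_def)
    also have "(\<Prod>r\<in>{i..<j}. y (v r)) = \<omega> y m ^ (j - i)"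
      using sharp_eq[OF assms(2) y] omega_alternating[OF assms(2) y] by (simp add: v_def dual_minusV[OF y])
    finally show ?thesis .
  qed
  then have "monomial l m j i = (\<lambda>y. if y \<in> dual then 1 * (\<Prod>r<j. y (v r)) else 0)"
    by (auto simp: monomial_def)
  then show ?thesis using Sym_product by simp
qed

text \<open>By Cramer's rule each linear factor is a combination of \<open>\<omega> y m\<close> and
  \<open>\<omega> l y\<close>; multiplication by the first keeps the index of a monomial,
  multiplication by the second raises it by one.\<close>

lemma Sym_expand_monomials:
  assumes lm: "frame l m" and P: "P \<in> Sym j"
  obtains c where "P = (\<lambda>y. \<Sum>i\<le>j. c i * monomial l m j i y)"
proof -
  have prod: "\<exists>d. \<forall>y\<in>dual. (\<Prod>r<j. y (v r)) = (\<Sum>i\<le>j. d i * monomial l m j i y)" for v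
  proof (induction j)
    case 0 show ?case by (intro exI[of _ "\<lambda>_. 1"]) (auto simp: monomial_def)
  next
    case (Suc j)
    then obtain d where d: "\<And>y. y \<in> dual \<Longrightarrow> (\<Prod>r<j. y (v r)) = (\<Sum>i\<le>j. d i * monomial l m j i y)"
      by blast
    define a where "a = l (v j) / \<omega> l m"
    define b where "b = m (v j) / \<omega> l m"
    define d' where "d' = (\<lambda>i. (if i \<le> j then a * d i else 0) + (if 0 < i then b * d (i - 1) else 0))"
    have "(\<Prod>r<Suc j. y (v r)) = (\<Sum>i\<le>Suc j. d' i * monomial l m (Suc j) i y)" if y: "y \<in> dual" for y
    proof -
      have lin: "y (v j) = a * \<omega> y m + b * \<omega> l y"
        using omega_expand[OF frameD(1,2)[OF lm] y, of "v j"] frameD(3)[OF lm]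
        by (simp add: a_def b_def field_simps)
      have s1: "monomial l m j i y * \<omega> y m = monomial l m (Suc j) i y" if "i \<le> j" for i
        using y that by (simp add: monomial_def Suc_diff_le)
      have s2: "monomial l m j i y * \<omega> l y = monomial l m (Suc j) (Suc i) y" for i
        using y by (simp add: monomial_def)
      have "(\<Prod>r<Suc j. y (v r)) = (\<Sum>i\<le>j. d i * monomial l m j i y) * (a * \<omega> y m + b * \<omega> l y)"
        by (simp add: d[OF y] lin)
      also have "\<dots> = (\<Sum>i\<le>j. a * d i * (monomial l m j i y * \<omega> y m))
          + (\<Sum>i\<le>j. b * d i * (monomial l m j i y * \<omega> l y))"
        unfolding distrib_left sum_distrib_right by (simp only: mult_ac)
      also have "(\<Sum>i\<le>j. a * d i * (monomial l m j i y * \<omega> y m)) =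
          (\<Sum>i\<le>Suc j. (if i \<le> j then a * d i else 0) * monomial l m (Suc j) i y)"
        using s1 by (simp add: sum.atMost_Suc)
      also have "(\<Sum>i\<le>j. b * d i * (monomial l m j i y * \<omega> l y)) =
          (\<Sum>i\<le>Suc j. (if 0 < i then b * d (i - 1) else 0) * monomial l m (Suc j) i y)"
        using s2 by (simp add: sum.atMost_Suc_shift del: sum.atMost_Suc)
      finally show ?thesis by (simp only: d'_def sum.distrib[symmetric] distrib_right)
    qed
    then show ?case by blast
  qed
  obtain N a v where PN: "P = (\<lambda>y. if y \<in> dual then \<Sum>k<(N::nat). a k * (\<Prod>r<j. y (v k r)) else 0)"
    using P by (auto simp: Sym_def)
  define d where "d = (\<lambda>k. SOME d. \<forall>y\<in>dual. (\<Prod>r<j. y (v k r)) = (\<Sum>i\<le>j. d i * monomial l m j i y))"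
  have d: "(\<Prod>r<j. y (v k r)) = (\<Sum>i\<le>j. d k i * monomial l m j i y)" if "y \<in> dual" for k y
    using someI_ex[OF prod[of "v k"]] that unfolding d_def by blast
  have "P y = (\<Sum>i\<le>j. (\<Sum>k<N. a k * d k i) * monomial l m j i y)" for y
  proof (cases "y \<in> dual")
    case True
    have "P y = (\<Sum>k<N. \<Sum>i\<le>j. a k * d k i * monomial l m j i y)"
      using True by (simp add: PN d sum_distrib_left mult.assoc)
    also have "\<dots> = (\<Sum>i\<le>j. \<Sum>k<N. a k * d k i * monomial l m j i y)" by (rule sum.swap)
    finally show ?thesis by (simp add: sum_distrib_right)
  next
    case False then show ?thesis by (simp add: PN monomial_def)
  qed
  then have "P = (\<lambda>y. \<Sum>i\<le>j. (\<Sum>k<N. a k * d k i) * monomial l m j i y)" by blast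
  then show ?thesis by (rule that)
qed

text \<open>\<open>Sym_iso\<close> records a functional on the \<open>j\<close>-th powers of
  vectors. The powers of \<open>t * sharp l - sharp m\<close> are polynomials in \<open>t\<close>
  whose coefficients are the monomials times nonzero binomial coefficients; as \<open>t\<close>
  varies, agreement on powers forces agreement on every monomial.\<close>

lemma inj_on_Sym_iso: "inj_on (Sym_iso j) (Sym_dual j)"
proof (rule inj_onI)
  fix \<phi> \<psi> assume \<phi>: "\<phi> \<in> Sym_dual j" and \<psi>: "\<psi> \<in> Sym_dual j" and eq: "Sym_iso j \<phi> = Sym_iso j \<psi>"
  define pow where "pow = (\<lambda>v x. if x \<in> dual then (x v :: complex) ^ j else 0)"
  have pow: "\<phi> (pow v) = \<psi> (pow v)" for v
  proof -
    obtain y where y: "y \<in> dual" "sharp y = - v" using sharp_surj by blast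
    have "Sym_iso j \<phi> y = Sym_iso j \<psi> y" using eq by simp
    then show ?thesis using y(1) unfolding Sym_iso_def pow_def y(2) minus_minus by simp
  qed
  obtain l m where lm: "frame l m" using omega_nonzero by (auto simp: frame_iff)
  have mon: "monomial l m j i \<in> Sym j" if "i \<in> {..j}" for i
    using that by (intro monomial_in_Sym frameD[OF lm]) auto
  have sums: "\<phi> (\<lambda>x. \<Sum>i\<le>j. c i * monomial l m j i x) = (\<Sum>i\<le>j. c i * \<phi> (monomial l m j i))"
    "\<psi> (\<lambda>x. \<Sum>i\<le>j. c i * monomial l m j i x) = (\<Sum>i\<le>j. c i * \<psi> (monomial l m j i))" for c
    using mon by (intro Sym_dual_sum[OF \<phi>] Sym_dual_sum[OF \<psi>]; simp)+
  have powt: "pow (scale t (sharp l) - sharp m) = (\<lambda>x. \<Sum>i\<le>j. (of_nat (j choose i) * t^i) * monomial l m j i x)" for t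
  proof
    fix x
    show "pow (scale t (sharp l) - sharp m) x = (\<Sum>i\<le>j. (of_nat (j choose i) * t^i) * monomial l m j i x)"
    proof (cases "x \<in> dual")
      case True
      have "x (scale t (sharp l) - sharp m) = t * \<omega> l x + \<omega> x m"
      proof -
        have "x (scale t (sharp l) - sharp m) = x (scale t (sharp l) + - sharp m)" by simp
        also have "\<dots> = t * x (sharp l) + x (- sharp m)"
          unfolding dual_addV[OF True] dual_scaleV[OF True] ..
        finally show ?thesis using dual_minusV[OF True] sharp_eq[OF frameD(1)[OF lm] True]
          sharp_eq[OF frameD(2)[OF lm] True] omega_alternating[OF frameD(2)[OF lm] True] by simp
      qed
      then have "pow (scale t (sharp l) - sharp m) x = (t * \<omega> l x + \<omega> x m) ^ j"
        using True by (simp add: pow_def)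
      also have "\<dots> = (\<Sum>i\<le>j. of_nat (j choose i) * (t * \<omega> l x)^i * \<omega> x m^(j-i))"
        by (rule binomial_ring)
      finally show ?thesis using True by (simp add: monomial_def power_mult_distrib mult_ac)
    qed (simp add: pow_def monomial_def)
  qed
  have "(\<Sum>i\<le>j. (of_nat (j choose i) * (\<phi> (monomial l m j i) - \<psi> (monomial l m j i))) * t^i) = 0" for t
  proof -
    have "(\<Sum>i\<le>j. (of_nat (j choose i) * t^i) * \<phi> (monomial l m j i)) =
        (\<Sum>i\<le>j. (of_nat (j choose i) * t^i) * \<psi> (monomial l m j i))"
      using pow[of "scale t (sharp l) - sharp m"] unfolding powt sums(1) sums(2) .
    then show ?thesis by (simp add: right_diff_distrib left_diff_distrib sum_subtractf mult_ac)
  qed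
  then have "\<forall>i\<le>j. of_nat (j choose i) * (\<phi> (monomial l m j i) - \<psi> (monomial l m j i)) = 0"
    by (subst Transcendental.polyfun_eq_0[symmetric]) blast
  then have eqm: "\<phi> (monomial l m j i) = \<psi> (monomial l m j i)" if "i \<le> j" for i
    using that by (auto simp: binomial_eq_0_iff)
  show "\<phi> = \<psi>"
  proof
    fix P
    show "\<phi> P = \<psi> P"
    proof (cases "P \<in> Sym j")
      case True
      then obtain c where P: "P = (\<lambda>y. \<Sum>i\<le>j. c i * monomial l m j i y)"
        using Sym_expand_monomials[OF lm] by blast
      show ?thesis
        unfolding P sums(1) sums(2) using eqm by simp
    next
      case False then show ?thesis using \<phi> \<psi> by (simp add: Sym_dual_def)
    qed
  qed
qed

end

section \<open>Sections and subsheaves\<close>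

lemma holomorphic_on_locally:
  assumes "\<And>z. z \<in> S \<Longrightarrow> \<exists>r>0. f holomorphic_on ball z r"
  shows "f holomorphic_on S"
  unfolding holomorphic_on_def
proof
  fix z assume "z \<in> S"
  then obtain r where "0 < r" "f holomorphic_on ball z r" using assms by blast
  then have "f field_differentiable at z" by (simp add: holomorphic_on_imp_differentiable_at)
  then show "f field_differentiable at z within S" by (rule field_differentiable_at_within)
qed

text \<open>What the quotient arguments use about a subsheaf \<open>G\<close> of \<open>F\<close>.
  Restriction is along arbitrary subsets, since sections are total functions that a restriction
  leaves unchanged. The locality axiom for \<open>G\<close> turns pointwise equality of stalk
  classes into membership of a difference.\<close>

locale subsheaf =
  fixes T :: "'m topology" and F G :: "'m set \<Rightarrow> ('y \<Rightarrow> complex) set"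
  assumes F_restrict: "f \<in> F N \<Longrightarrow> N' \<subseteq> N \<Longrightarrow> f \<in> F N'"
    and G_restrict: "f \<in> G N \<Longrightarrow> N' \<subseteq> N \<Longrightarrow> f \<in> G N'"
    and F_diff: "f \<in> F N \<Longrightarrow> g \<in> F N \<Longrightarrow> (\<lambda>y. f y - g y) \<in> F N"
    and G_diff: "f \<in> G N \<Longrightarrow> g \<in> G N \<Longrightarrow> (\<lambda>y. f y - g y) \<in> G N"
    and G_zero: "(\<lambda>y. 0) \<in> G N"
    and G_sub: "f \<in> G N \<Longrightarrow> f \<in> F N"
    and G_local: "f \<in> F N \<Longrightarrow> (\<And>p. p \<in> N \<Longrightarrow> \<exists>N'. openin T N' \<and> p \<in> N' \<and> f \<in> G N') \<Longrightarrow> f \<in> G N"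
begin

lemma G_minus: "f \<in> G N \<Longrightarrow> (\<lambda>y. - f y) \<in> G N"
  using G_diff[OF G_zero] by force

lemma stalk_class_self: "openin T N \<Longrightarrow> p \<in> N \<Longrightarrow> f \<in> F N \<Longrightarrow> f \<in> stalk_class T F G p f"
  unfolding stalk_class_def using G_zero[of N] by auto

lemma stalk_class_eqI:
  assumes N: "openin T N" "p \<in> N" "f \<in> F N" "g \<in> F N" "(\<lambda>y. f y - g y) \<in> G N"
  shows "stalk_class T F G p f = stalk_class T F G p g"
proof -
  have *: "stalk_class T F G p f \<subseteq> stalk_class T F G p g"
    if fg: "f \<in> F N" "g \<in> F N" "(\<lambda>y. f y - g y) \<in> G N" for f g
  proof
    fix f' assume "f' \<in> stalk_class T F G p f"
    then obtain M where M: "openin T M" "p \<in> M" "f' \<in> F M" "(\<lambda>y. f y - f' y) \<in> G M"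
      unfolding stalk_class_def by blast
    have "(\<lambda>y. (f y - f' y) - (f y - g y)) \<in> G (N \<inter> M)"
      by (rule G_diff) (use fg M in \<open>auto intro: G_restrict\<close>)
    then have "(\<lambda>y. g y - f' y) \<in> G (N \<inter> M)" by simp
    moreover have "g \<in> F (N \<inter> M)" "f' \<in> F (N \<inter> M)" using fg M by (auto intro: F_restrict)
    ultimately show "f' \<in> stalk_class T F G p g"
      unfolding stalk_class_def using N(1,2) M(1,2) by (blast intro: openin_Int)
  qed
  have "(\<lambda>y. g y - f y) \<in> G N" using G_minus[OF N(5)] by simp
  then show ?thesis using *[OF N(3,4,5)] *[OF N(4,3)] by blast
qed

lemma stalk_class_eqD:
  assumes N: "openin T N" "p \<in> N" "g \<in> F N"
    and eq: "stalk_class T F G p f = stalk_class T F G p g"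
  shows "\<exists>N'. openin T N' \<and> p \<in> N' \<and> f \<in> F N' \<and> (\<lambda>y. f y - g y) \<in> G N'"
proof -
  have "g \<in> stalk_class T F G p f" using stalk_class_self[OF N] eq by simp
  then show ?thesis unfolding stalk_class_def by blast
qed

text \<open>\<open>quotient_diff\<close> ranges over all pairs of representatives; because
  \<open>G\<close> is closed under differences, they all lead to one stalk class.\<close>

lemma quotient_diff_stalk:
  assumes N: "openin T N" "p \<in> N" "f1 \<in> F N" "f2 \<in> F N"
    and q: "q1 p = stalk_class T F G p f1" "q2 p = stalk_class T F G p f2"
  shows "quotient_diff T F G q1 q2 p = stalk_class T F G p (\<lambda>y. f1 y - f2 y)"
proof
  show "stalk_class T F G p (\<lambda>y. f1 y - f2 y) \<subseteq> quotient_diff T F G q1 q2 p"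
    unfolding quotient_diff_def q using stalk_class_self[OF N(1,2)] N(3,4) by blast
  show "quotient_diff T F G q1 q2 p \<subseteq> stalk_class T F G p (\<lambda>y. f1 y - f2 y)"
  proof
    fix f assume "f \<in> quotient_diff T F G q1 q2 p"
    then obtain g1 g2 where g: "g1 \<in> stalk_class T F G p f1" "g2 \<in> stalk_class T F G p f2"
      "f \<in> stalk_class T F G p (\<lambda>y. g1 y - g2 y)"
      unfolding quotient_diff_def q by blast
    obtain M1 where M1: "openin T M1" "p \<in> M1" "f1 \<in> F M1" "g1 \<in> F M1" "(\<lambda>y. f1 y - g1 y) \<in> G M1"
      using g(1) unfolding stalk_class_def by blast
    obtain M2 where M2: "openin T M2" "p \<in> M2" "f2 \<in> F M2" "g2 \<in> F M2" "(\<lambda>y. f2 y - g2 y) \<in> G M2"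
      using g(2) unfolding stalk_class_def by blast
    have "(\<lambda>y. (f1 y - g1 y) - (f2 y - g2 y)) \<in> G (M1 \<inter> M2)"
      by (rule G_diff) (use M1 M2 in \<open>auto intro: G_restrict\<close>)
    then have "(\<lambda>y. (f1 y - f2 y) - (g1 y - g2 y)) \<in> G (M1 \<inter> M2)"
      by (simp add: algebra_simps)
    moreover have "(\<lambda>y. f1 y - f2 y) \<in> F (M1 \<inter> M2)" "(\<lambda>y. g1 y - g2 y) \<in> F (M1 \<inter> M2)"
      by (rule F_diff; use M1 M2 in \<open>auto intro: F_restrict\<close>)+
    ultimately have "stalk_class T F G p (\<lambda>y. f1 y - f2 y) = stalk_class T F G p (\<lambda>y. g1 y - g2 y)"
      using M1 M2 by (intro stalk_class_eqI[of "M1 \<inter> M2"]) auto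
    then show "f \<in> stalk_class T F G p (\<lambda>y. f1 y - f2 y)" using g(3) by simp
  qed
qed

lemma quotient_sectionsD:
  assumes "q \<in> quotient_sections T F G N" "p \<in> N"
  obtains N' f where "openin T N'" "p \<in> N'" "N' \<subseteq> N" "f \<in> F N'"
    "\<And>p'. p' \<in> N' \<Longrightarrow> q p' = stalk_class T F G p' f"
proof -
  have "\<exists>N'. openin T N' \<and> p \<in> N' \<and> N' \<subseteq> N \<and> (\<exists>f\<in>F N'. \<forall>p'\<in>N'. q p' = stalk_class T F G p' f)"
    using assms unfolding quotient_sections_def by blast
  then show ?thesis using that by blast
qed

lemma quotient_sections_outside: "q \<in> quotient_sections T F G N \<Longrightarrow> p \<notin> N \<Longrightarrow> q p = {}"
  unfolding quotient_sections_def by blast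

lemma quotient_sectionsI:
  assumes "\<And>p. p \<in> N \<Longrightarrow> \<exists>N' f. openin T N' \<and> p \<in> N' \<and> N' \<subseteq> N \<and> f \<in> F N' \<and>
      (\<forall>p'\<in>N'. q p' = stalk_class T F G p' f)"
    and "\<And>p. p \<notin> N \<Longrightarrow> q p = {}"
  shows "q \<in> quotient_sections T F G N"
  unfolding quotient_sections_def
proof (intro CollectI conjI ballI allI impI assms(2))
  fix p assume "p \<in> N"
  from assms(1)[OF this] obtain N' f where "openin T N'" "p \<in> N'" "N' \<subseteq> N" "f \<in> F N'"
      "\<forall>p'\<in>N'. q p' = stalk_class T F G p' f" by (elim exE conjE)
  then show "\<exists>N'. openin T N' \<and> p \<in> N' \<and> N' \<subseteq> N \<and> (\<exists>f\<in>F N'. \<forall>p'\<in>N'. q p' = stalk_class T F G p' f)"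
    by (intro exI[of _ N'] conjI bexI[of _ f])
qed

lemma quotient_diff_sections:
  assumes "q1 \<in> quotient_sections T F G N" "q2 \<in> quotient_sections T F G N"
  shows "quotient_diff T F G q1 q2 \<in> quotient_sections T F G N"
proof (rule quotient_sectionsI)
  fix p assume p: "p \<in> N"
  obtain N1 f1 where 1: "openin T N1" "p \<in> N1" "N1 \<subseteq> N" "f1 \<in> F N1"
    "\<And>p'. p' \<in> N1 \<Longrightarrow> q1 p' = stalk_class T F G p' f1"
    using quotient_sectionsD[OF assms(1) p] by blast
  obtain N2 f2 where 2: "openin T N2" "p \<in> N2" "N2 \<subseteq> N" "f2 \<in> F N2"
    "\<And>p'. p' \<in> N2 \<Longrightarrow> q2 p' = stalk_class T F G p' f2"
    using quotient_sectionsD[OF assms(2) p] by blast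
  have o: "openin T (N1 \<inter> N2)" using 1 2 by blast
  have f: "f1 \<in> F (N1 \<inter> N2)" "f2 \<in> F (N1 \<inter> N2)" using 1 2 by (auto intro: F_restrict)
  have "quotient_diff T F G q1 q2 p' = stalk_class T F G p' (\<lambda>y. f1 y - f2 y)" if "p' \<in> N1 \<inter> N2" for p'
    using quotient_diff_stalk[OF o that f] 1(5) 2(5) that by blast
  then show "\<exists>N' f. openin T N' \<and> p \<in> N' \<and> N' \<subseteq> N \<and> f \<in> F N' \<and>
      (\<forall>p'\<in>N'. quotient_diff T F G q1 q2 p' = stalk_class T F G p' f)"
    using o f F_diff 1(2,3) 2(2) by (intro exI[of _ "N1 \<inter> N2"] exI[of _ "\<lambda>y. f1 y - f2 y"]) auto
next
  fix p assume "p \<notin> N"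
  then show "quotient_diff T F G q1 q2 p = {}"
    using quotient_sections_outside[OF assms(1)] by (simp add: quotient_diff_def)
qed

text \<open>Two choices of local lifts of \<open>q\<close> differ near each point by a section of
  \<open>G\<close>. These differences form the 0-cochain whose coboundary separates the two
  cocycles.\<close>

lemma representatives_cohomologous:
  assumes "\<And>p. p \<in> N \<Longrightarrow> openin T (W p) \<and> p \<in> W p \<and> f p \<in> F (W p) \<and> q p = stalk_class T F G p (f p)"
    and "\<And>p. p \<in> N \<Longrightarrow> openin T (W' p) \<and> p \<in> W' p \<and> f' p \<in> F (W' p) \<and> q p = stalk_class T F G p (f' p)"
  shows "cohomologous T C G N (W, \<lambda>p p' y. f p' y - f p y) (W', \<lambda>p p' y. f' p' y - f' p y)"
proof -
  have "\<exists>V. openin T V \<and> p \<in> V \<and> V \<subseteq> W p \<inter> W' p \<and> (\<lambda>y. f' p y - f p y) \<in> G V" if p: "p \<in> N" for p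
  proof -
    have "stalk_class T F G p (f' p) = stalk_class T F G p (f p)" using assms[OF p] by simp
    then obtain M where M: "openin T M" "p \<in> M" "(\<lambda>y. f' p y - f p y) \<in> G M"
      using stalk_class_eqD[of "W p" p "f p" "f' p"] assms(1)[OF p] by blast
    then show ?thesis using assms[OF p]
      by (intro exI[of _ "M \<inter> (W p \<inter> W' p)"]) (auto intro: G_restrict)
  qed
  then obtain V where V: "\<forall>p\<in>N. openin T (V p) \<and> p \<in> V p \<and> V p \<subseteq> W p \<inter> W' p \<and>
      (\<lambda>y. f' p y - f p y) \<in> G (V p)"
    by metis
  show ?thesis
    unfolding cohomologous.simps
    by (rule exI[of _ V], rule exI[of _ "\<lambda>p y. f' p y - f p y"]) (use V in \<open>auto simp: agree_on_def\<close>)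
qed

end

text \<open>The image is a union, over all representatives modulo \<open>G\<close>, of their classes
  modulo \<open>G'\<close>; since \<open>G\<close> is contained in \<open>G'\<close>, all these
  classes coincide.\<close>

lemma quotient_map_to_stalk:
  assumes "subsheaf T F G" "subsheaf T F G'" and sub: "\<And>N. G N \<subseteq> G' N"
    and N: "openin T N" "p \<in> N" "f \<in> F N" and q: "q p = stalk_class T F G p f"
  shows "quotient_map_to T F G' q p = stalk_class T F G' p f"
proof -
  interpret G: subsheaf T F G by fact
  interpret G': subsheaf T F G' by fact
  have eq: "stalk_class T F G' p g = stalk_class T F G' p f" if g: "g \<in> stalk_class T F G p f" for g
  proof -
    obtain M where "openin T M" "p \<in> M" "f \<in> F M" "g \<in> F M" "(\<lambda>y. f y - g y) \<in> G M"
      using g unfolding stalk_class_def by blast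
    then show ?thesis using subsetD[OF sub] by (intro G'.stalk_class_eqI[of M, symmetric])
  qed
  have ne: "stalk_class T F G p f \<noteq> {}" using G.stalk_class_self[OF N] by (rule ex_in_conv[THEN iffD1, OF exI])
  have "quotient_map_to T F G' q p = (\<Union>g\<in>stalk_class T F G p f. stalk_class T F G' p g)"
    by (auto simp: quotient_map_to_def q)
  also have "\<dots> = stalk_class T F G' p f"
    by (rule SUP_eq_const[OF ne eq])
  finally show ?thesis .
qed

context oriented_plane begin

section \<open>The topology of the projective line and of its square\<close>

lemma topspace_X_top: "topspace X_top = X"
proof
  have "openin X_top X" unfolding openin_X_top by (auto simp: line_pencil_in_X)
  then show "X \<subseteq> topspace X_top" by (rule openin_subset)
  show "topspace X_top \<subseteq> X" using openin_topspace[of X_top] unfolding openin_X_top by blast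
qed

lemma openin_X: "openin X_top X" using openin_topspace[of X_top] by (simp add: topspace_X_top)

lemma openin_X_subset: "openin X_top U \<Longrightarrow> U \<subseteq> X"
  using openin_subset topspace_X_top by blast

lemma openin_Times: "openin X_top U \<Longrightarrow> openin X_top V \<Longrightarrow> openin XX_top (U \<times> V)"
  by (simp add: XX_top_def openin_prod_Times_iff)

lemma open_chart: "openin X_top U \<Longrightarrow> frame l m \<Longrightarrow> open {z. line (pencil l m z) \<in> U}"
  by (simp add: openin_X_top)

lemma openin_XX_box:
  assumes "openin XX_top N" "(\<xi>, \<eta>) \<in> N"
  shows "\<exists>V W. openin X_top V \<and> openin X_top W \<and> \<xi> \<in> V \<and> \<eta> \<in> W \<and> V \<times> W \<subseteq> N"
  by (rule openin_prod_topology_alt[THEN iffD1, rule_format, OF assms[unfolded XX_top_def]])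

lemma open_chart2:
  assumes N: "openin XX_top N" and fr: "frame l m" "frame l' m'"
  shows "open {(z, w). (line (pencil l m z), line (pencil l' m' w)) \<in> N}"
proof (subst open_prod_def, clarify)
  fix z w assume *: "(line (pencil l m z), line (pencil l' m' w)) \<in> N"
  obtain V W where VW: "openin X_top V" "openin X_top W" "line (pencil l m z) \<in> V"
    "line (pencil l' m' w) \<in> W" "V \<times> W \<subseteq> N"
    using openin_XX_box[OF N *] by blast
  show "\<exists>A B. open A \<and> open B \<and> (z, w) \<in> A \<times> B \<and>
      A \<times> B \<subseteq> {(z, w). (line (pencil l m z), line (pencil l' m' w)) \<in> N}"
    by (rule exI[of _ "{z. line (pencil l m z) \<in> V}"], rule exI[of _ "{w. line (pencil l' m' w) \<in> W}"])
      (use VW open_chart fr in auto)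
qed

lemma openin_slice:
  assumes N: "openin XX_top N"
  shows "openin X_top {\<eta>. (\<xi>, \<eta>) \<in> N}"
proof (subst openin_subopen, clarify)
  fix \<eta> assume *: "(\<xi>, \<eta>) \<in> N"
  obtain V W where "openin X_top V" "openin X_top W" "\<xi> \<in> V" "\<eta> \<in> W" "V \<times> W \<subseteq> N"
    using openin_XX_box[OF N *] by blast
  then show "\<exists>T. openin X_top T \<and> \<eta> \<in> T \<and> T \<subseteq> {\<eta>. (\<xi>, \<eta>) \<in> N}" by blast
qed

lemma openin_diff_finite:
  assumes "openin X_top U" "finite D"
  shows "openin X_top (U - D)"
  unfolding openin_X_top
proof (intro conjI allI impI)
  show "U - D \<subseteq> X" using openin_X_subset[OF assms(1)] by blast
  fix l m assume lm: "frame l m"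
  have "inj (\<lambda>z. line (pencil l m z))" using line_pencil_eq_iff[OF lm] by (simp add: inj_def)
  then have "finite ((\<lambda>z. line (pencil l m z)) -` D)" using assms(2) by (rule finite_vimageI[rotated])
  then have "open ({z. line (pencil l m z) \<in> U} - (\<lambda>z. line (pencil l m z)) -` D)"
    using open_chart[OF assms(1) lm] by (intro open_Diff finite_imp_closed)
  also have "{z. line (pencil l m z) \<in> U} - (\<lambda>z. line (pencil l m z)) -` D = {z. line (pencil l m z) \<in> U - D}"
    by auto
  finally show "open {z. line (pencil l m z) \<in> U - D}" .
qed

text \<open>The condition that \<open>\<omega> a y\<close> be smaller in norm than
  \<open>\<omega> b y\<close> is invariant under scaling \<open>y\<close>, hence defines a set of
  lines, and it is open in every chart. This set contains \<open>line a\<close>, where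
  \<open>\<omega> a\<close> is zero, and is disjoint from the one with \<open>a\<close> and
  \<open>b\<close> exchanged. Separation makes the complement of the diagonal open.\<close>

lemma X_separate:
  assumes "\<xi> \<in> X" "\<eta> \<in> X" "\<xi> \<noteq> \<eta>"
  shows "\<exists>A B. openin X_top A \<and> openin X_top B \<and> \<xi> \<in> A \<and> \<eta> \<in> B \<and> A \<inter> B = {}"
proof -
  obtain a where a: "a \<in> dual" "a \<noteq> (\<lambda>_. 0)" "line a = \<xi>" using X_obtain_line[OF assms(1)] by blast
  obtain b where b: "b \<in> dual" "b \<noteq> (\<lambda>_. 0)" "line b = \<eta>" using X_obtain_line[OF assms(2)] by blast
  have ab: "\<omega> a b \<noteq> 0" using line_eq_iff[OF a(1,2) b(1,2)] a b assms(3) by simp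
  define R where "R = (\<lambda>a b. {\<zeta>. \<exists>y\<in>dual. line y = \<zeta> \<and> norm (\<omega> a y) < norm (\<omega> b y)})"
  have R_iff: "line y \<in> R a b \<longleftrightarrow> norm (\<omega> a y) < norm (\<omega> b y)"
    if ab: "a \<in> dual" "b \<in> dual" and y: "y \<in> dual" "line y \<in> X" for a b y
  proof
    assume "line y \<in> R a b"
    then obtain y' where y': "y' \<in> dual" "line y' = line y" "norm (\<omega> a y') < norm (\<omega> b y')"
      unfolding R_def by blast
    have "y \<in> cone (line y)" "y' \<in> cone (line y)" using y y' by (auto simp: cone_def)
    then obtain c where c: "c \<noteq> 0" "y' = (\<lambda>v. c * y v)" using cone_scaleE[OF y(2)] by blast
    then show "norm (\<omega> a y) < norm (\<omega> b y)"
      using y'(3) omega_scale_right[OF ab(1) y(1), of c] omega_scale_right[OF ab(2) y(1), of c]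
      by (simp add: norm_mult)
  next
    assume "norm (\<omega> a y) < norm (\<omega> b y)"
    then show "line y \<in> R a b" unfolding R_def using y by blast
  qed
  have R_X: "R a b \<subseteq> X" if ab: "a \<in> dual" "b \<in> dual" for a b
  proof
    fix \<zeta> assume "\<zeta> \<in> R a b"
    then obtain y where y: "y \<in> dual" "line y = \<zeta>" "norm (\<omega> a y) < norm (\<omega> b y)" unfolding R_def by blast
    have "y \<noteq> (\<lambda>_. 0)"
    proof
      assume "y = (\<lambda>_. 0)"
      then have "\<omega> b y = 0" using omega_scale_right[OF ab(2) y(1), of 0] by simp
      then show False using y(3) by simp
    qed
    then show "\<zeta> \<in> X" using line_in_X y by blast
  qed
  have R_open: "openin X_top (R a b)" if ab: "a \<in> dual" "b \<in> dual" for a b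
    unfolding openin_X_top
  proof (intro conjI allI impI)
    show "R a b \<subseteq> X" by (rule R_X[OF ab])
    fix l m assume lm: "frame l m"
    have "{z. line (pencil l m z) \<in> R a b} =
        {z. norm (\<omega> a l + z * \<omega> a m) < norm (\<omega> b l + z * \<omega> b m)}"
      using R_iff[OF ab] line_pencil_in_X[OF lm] frameD(1,2)[OF lm] ab
      by (simp add: dual_pencil omega_pencil)
    also have "open \<dots>" by (intro open_Collect_less continuous_intros)
    finally show "open {z. line (pencil l m z) \<in> R a b}" .
  qed
  have "R a b \<inter> R b a = {}"
  proof (rule ccontr)
    assume "R a b \<inter> R b a \<noteq> {}"
    then obtain \<zeta> where \<zeta>: "\<zeta> \<in> R a b" "\<zeta> \<in> R b a" by blast
    then have "\<zeta> \<in> X" using R_X[OF a(1) b(1)] by blast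
    then obtain y where "y \<in> dual" "line y = \<zeta>" using X_obtain_line by blast
    then show False using \<zeta> \<open>\<zeta> \<in> X\<close> R_iff[OF a(1) b(1), of y] R_iff[OF b(1) a(1), of y] by simp
  qed
  moreover have "\<xi> \<in> R a b" "\<eta> \<in> R b a"
    using R_iff[OF a(1) b(1) a(1)] R_iff[OF b(1) a(1) b(1)] a b assms(1,2) ab
      omega_self[OF a(1)] omega_self[OF b(1)] omega_alternating[OF a(1) b(1)] by auto
  ultimately show ?thesis using R_open[OF a(1) b(1)] R_open[OF b(1) a(1)] by blast
qed

lemma openin_off_diagonal: "openin XX_top {(\<xi>, \<eta>). \<xi> \<in> X \<and> \<eta> \<in> X \<and> \<xi> \<noteq> \<eta>}"
  unfolding XX_top_def openin_prod_topology_alt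
proof (intro allI impI)
  fix \<xi> \<eta> assume "(\<xi>, \<eta>) \<in> {(\<xi>, \<eta>). \<xi> \<in> X \<and> \<eta> \<in> X \<and> \<xi> \<noteq> \<eta>}"
  then obtain A B where AB: "openin X_top A" "openin X_top B" "\<xi> \<in> A" "\<eta> \<in> B" "A \<inter> B = {}"
    using X_separate[of \<xi> \<eta>] by blast
  then have "A \<times> B \<subseteq> {(\<xi>, \<eta>). \<xi> \<in> X \<and> \<eta> \<in> X \<and> \<xi> \<noteq> \<eta>}"
    using openin_X_subset by blast
  with AB show "\<exists>U V. openin X_top U \<and> openin X_top V \<and> \<xi> \<in> U \<and> \<eta> \<in> V \<and>
      U \<times> V \<subseteq> {(\<xi>, \<eta>). \<xi> \<in> X \<and> \<eta> \<in> X \<and> \<xi> \<noteq> \<eta>}" by blast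
qed

section \<open>Sections of powers of \<open>L\<close>, sections on the product, and vanishing along
  the diagonal\<close>

lemma L_sections_restrict: "f \<in> L_sections d U \<Longrightarrow> U' \<subseteq> U \<Longrightarrow> f \<in> L_sections d U'"
  unfolding L_sections_def by (blast intro: holomorphic_on_subset)

lemma L_sections_diff:
  "f \<in> L_sections d U \<Longrightarrow> g \<in> L_sections d U \<Longrightarrow> (\<lambda>y. f y - g y) \<in> L_sections d U"
  unfolding L_sections_def by (auto simp: algebra_simps intro!: holomorphic_intros)

lemma L_sections_add:
  "f \<in> L_sections d U \<Longrightarrow> g \<in> L_sections d U \<Longrightarrow> (\<lambda>y. f y + g y) \<in> L_sections d U"
  unfolding L_sections_def by (auto simp: algebra_simps intro!: holomorphic_intros)

lemma L_sections_cmult: "f \<in> L_sections d U \<Longrightarrow> (\<lambda>y. c * f y) \<in> L_sections d U"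
  unfolding L_sections_def by (auto simp: algebra_simps intro!: holomorphic_intros)

lemma L_sections_zero: "(\<lambda>y. 0) \<in> L_sections d U"
  unfolding L_sections_def by auto

lemma L_sections_mult:
  "f \<in> L_sections d U \<Longrightarrow> g \<in> L_sections e U \<Longrightarrow> (\<lambda>y. f y * g y) \<in> L_sections (d + e) U"
  unfolding L_sections_def by (auto simp: power_int_add intro!: holomorphic_intros)

lemma L_sections_inverse_omega:
  assumes l: "l \<in> dual" "l \<noteq> (\<lambda>_. 0)" and U: "U \<subseteq> X" "line l \<notin> U"
  shows "(\<lambda>y. 1 / \<omega> l y ^ k) \<in> L_sections (- int k) U"
  unfolding L_sections_def mem_Collect_eq
proof (intro conjI ballI allI impI)
  fix \<xi> y and c :: complex assume "\<xi> \<in> U" "y \<in> cone \<xi>" and c: "c \<noteq> 0"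
  then have "y \<in> dual" by (simp add: cone_def)
  then show "1 / \<omega> l (\<lambda>v. c * y v) ^ k = c powi - int k * (1 / \<omega> l y ^ k)"
    using omega_scale_right[OF l(1), of y c] c
    by (simp add: power_int_minus power_mult_distrib field_simps)
next
  fix l' m' assume fr: "frame l' m'"
  have nz: "\<omega> l (pencil l' m' z) \<noteq> 0" if "line (pencil l' m' z) \<in> U" for z
    using line_eq_iff[OF l dual_pencil[OF frameD(1,2)[OF fr]] pencil_nonzero[OF fr], of z] that U by auto
  have "(\<lambda>z. 1 / (\<omega> l l' + z * \<omega> l m') ^ k) holomorphic_on {z. line (pencil l' m' z) \<in> U}"
    using nz frameD(1,2)[OF fr] l by (intro holomorphic_intros) (simp add: omega_pencil)
  then show "(\<lambda>z. 1 / \<omega> l (pencil l' m' z) ^ k) holomorphic_on {z. line (pencil l' m' z) \<in> U}"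
    using frameD(1,2)[OF fr] l by (simp add: omega_pencil)
qed

lemma LL_homogeneous:
  assumes "f \<in> LL_sections a b N" "(\<xi>, \<eta>) \<in> N" "l \<in> cone \<xi>" "m \<in> cone \<eta>" "c \<noteq> 0"
  shows "f (\<lambda>v. c * l v, m) = c powi a * f (l, m)" "f (l, \<lambda>v. c * m v) = c powi b * f (l, m)"
proof -
  have "(l, m) \<in> cone2 (\<xi>, \<eta>)" using assms by (simp add: cone2_def)
  then have "f (\<lambda>v. c * l v, m) = c powi a * f (l, m) \<and> f (l, \<lambda>v. c * m v) = c powi b * f (l, m)"
    using assms(1,2,5) unfolding LL_sections_def by blast
  then show "f (\<lambda>v. c * l v, m) = c powi a * f (l, m)" "f (l, \<lambda>v. c * m v) = c powi b * f (l, m)"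
    by auto
qed

lemma LL_holomorphic2:
  assumes "f \<in> LL_sections a b N" "frame l m" "frame l' m'"
  shows "holomorphic2_on (\<lambda>(z, w). f (pencil l m z, pencil l' m' w))
    {(z, w). (line (pencil l m z), line (pencil l' m' w)) \<in> N}"
  using assms unfolding LL_sections_def by blast

lemma LL_I:
  assumes "\<And>\<xi> \<eta> l m c. (\<xi>, \<eta>) \<in> N \<Longrightarrow> l \<in> cone \<xi> \<Longrightarrow> m \<in> cone \<eta> \<Longrightarrow> c \<noteq> 0 \<Longrightarrow>
      f (\<lambda>v. c * l v, m) = c powi a * f (l, m) \<and> f (l, \<lambda>v. c * m v) = c powi b * f (l, m)"
    and "\<And>l m l' m'. frame l m \<Longrightarrow> frame l' m' \<Longrightarrow>
      holomorphic2_on (\<lambda>(z, w). f (pencil l m z, pencil l' m' w))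
        {(z, w). (line (pencil l m z), line (pencil l' m' w)) \<in> N}"
  shows "f \<in> LL_sections a b N"
  unfolding LL_sections_def mem_Collect_eq
proof (intro conjI ballI allI impI assms(2))
  fix p lm assume "p \<in> N" "lm \<in> cone2 p"
  then show "case lm of (l, m) \<Rightarrow> \<forall>c. c \<noteq> 0 \<longrightarrow> f (\<lambda>v. c * l v, m) = c powi a * f (l, m) \<and>
      f (l, \<lambda>v. c * m v) = c powi b * f (l, m)"
    using assms(1) by (cases p, cases lm) (simp add: cone2_def)
qed

lemma LL_restrict:
  assumes f: "f \<in> LL_sections a b N" and sub: "N' \<subseteq> N"
  shows "f \<in> LL_sections a b N'"
proof (rule LL_I, goal_cases)
  case (1 \<xi> \<eta> l m c)
  then show ?case using LL_homogeneous[OF f] sub by blast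
next
  case (2 l m l' m')
  show ?case by (rule holomorphic2_on_subset[OF LL_holomorphic2[OF f 2]]) (use sub in auto)
qed

lemma LL_diff:
  assumes f: "f \<in> LL_sections a b N" and g: "g \<in> LL_sections a b N"
  shows "(\<lambda>y. f y - g y) \<in> LL_sections a b N"
proof (rule LL_I, goal_cases)
  case (1 \<xi> \<eta> l m c)
  then show ?case
    using LL_homogeneous[OF f 1] LL_homogeneous[OF g 1] by (simp add: right_diff_distrib)
next
  case (2 l m l' m')
  from holomorphic2_on_diff[OF LL_holomorphic2[OF f 2] LL_holomorphic2[OF g 2]]
  show ?case by (simp add: case_prod_beta')
qed

lemma LL_zero: "(\<lambda>y. 0) \<in> LL_sections a b N"
  by (rule LL_I) (auto simp: case_prod_beta' intro: holomorphic2_on_const)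

lemma LL_slice:
  assumes f: "f \<in> LL_sections a b N" and N: "openin XX_top N" and l: "l \<in> dual" "l \<noteq> (\<lambda>_. 0)"
  shows "(\<lambda>y. f (l, y)) \<in> L_sections b {\<eta>. (line l, \<eta>) \<in> N}"
  unfolding L_sections_def mem_Collect_eq
proof (intro conjI ballI allI impI)
  fix \<xi> y and c :: complex assume "\<xi> \<in> {\<eta>. (line l, \<eta>) \<in> N}" "y \<in> cone \<xi>" "c \<noteq> 0"
  then show "f (l, \<lambda>v. c * y v) = c powi b * f (l, y)"
    using LL_homogeneous(2)[OF f _ _ _ , of "line l" \<xi> l y c] l by (simp add: cone_def)
next
  fix l' m' assume fr: "frame l' m'"
  \<comment> \<open>In a frame starting with \<open>l\<close>, the point \<open>line l\<close> has
    parameter 0, so the slice is the restriction to \<open>z = 0\<close> of a function of two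
    variables.\<close>
  obtain m where lm: "frame l m" using exists_frame[OF l] by blast
  have "(\<lambda>w. (\<lambda>(z, w). f (pencil l m z, pencil l' m' w)) (0, w)) holomorphic_on
      {w. (line l, line (pencil l' m' w)) \<in> N}"
  proof (rule holomorphic2_on_slice[OF LL_holomorphic2[OF f lm fr]])
    show "open {w. (line l, line (pencil l' m' w)) \<in> N}"
      using open_chart[OF openin_slice[OF N, of "line l"] fr] by simp
  qed (auto intro!: holomorphic_intros simp: pencil_0)
  then show "(\<lambda>z. f (l, pencil l' m' z)) holomorphic_on {z. (line l, line (pencil l' m' z)) \<in> N}"
    by (simp add: pencil_0)
qed

lemma vanishing_in_LL: "f \<in> vanishing_sections k b N \<Longrightarrow> f \<in> LL_sections 0 b N"
  unfolding vanishing_sections_def by blast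

lemma vanishing_local:
  assumes "f \<in> vanishing_sections k b N" "frame l m" "(line (pencil l m z), line (pencil l m z)) \<in> N"
  shows "\<exists>S h. open S \<and> (z, z) \<in> S \<and> holomorphic2_on h S \<and>
    (\<forall>z w. (z, w) \<in> S \<longrightarrow> f (pencil l m z, pencil l m w) = (z - w) ^ k * h (z, w))"
proof -
  have "\<exists>S h. open S \<and> (z, z) \<in> S \<and> holomorphic2_on h S \<and>
    (\<forall>(z, w)\<in>S. f (pencil l m z, pencil l m w) = (z - w) ^ k * h (z, w))"
    using assms unfolding vanishing_sections_def by blast
  then show ?thesis unfolding Ball_def split_paired_All prod.case .
qed

lemma vanishing_restrict: "f \<in> vanishing_sections k b N \<Longrightarrow> N' \<subseteq> N \<Longrightarrow> f \<in> vanishing_sections k b N'"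
  unfolding vanishing_sections_def using LL_restrict by blast

lemma vanishing_antimono:
  assumes "j \<le> k" "f \<in> vanishing_sections k b N"
  shows "f \<in> vanishing_sections j b N"
  unfolding vanishing_sections_def mem_Collect_eq
proof (intro conjI allI impI)
  show "f \<in> LL_sections 0 b N" by (rule vanishing_in_LL[OF assms(2)])
  fix l m z assume lmz: "frame l m" "(line (pencil l m z), line (pencil l m z)) \<in> N"
  obtain S h where S: "open S" "(z, z) \<in> S" "holomorphic2_on h S"
    "\<forall>z w. (z, w) \<in> S \<longrightarrow> f (pencil l m z, pencil l m w) = (z - w) ^ k * h (z, w)"
    using vanishing_local[OF assms(2) lmz] by blast
  define h' where "h' = (\<lambda>p. (fst p - snd p) ^ (k - j) * h p)"
  have "holomorphic2_on h' S" unfolding h'_def by (intro holomorphic2_intros S)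
  moreover have "f (pencil l m z, pencil l m w) = (z - w) ^ j * h' (z, w)" if "(z, w) \<in> S" for z w
    using S(4)[rule_format, OF that] assms(1) by (simp add: h'_def mult.assoc[symmetric] power_add[symmetric])
  ultimately show "\<exists>S h. open S \<and> (z, z) \<in> S \<and> holomorphic2_on h S \<and>
      (\<forall>(z, w)\<in>S. f (pencil l m z, pencil l m w) = (z - w) ^ j * h (z, w))"
    using S(1,2) by (intro exI[of _ S] exI[of _ h']) auto
qed

lemma vanishing_diff:
  assumes "f \<in> vanishing_sections k b N" "g \<in> vanishing_sections k b N"
  shows "(\<lambda>y. f y - g y) \<in> vanishing_sections k b N"
  unfolding vanishing_sections_def mem_Collect_eq
proof (intro conjI allI impI)
  show "(\<lambda>y. f y - g y) \<in> LL_sections 0 b N" using assms vanishing_in_LL by (blast intro: LL_diff)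
  fix l m z assume lmz: "frame l m" "(line (pencil l m z), line (pencil l m z)) \<in> N"
  obtain S h where S: "open S" "(z, z) \<in> S" "holomorphic2_on h S"
    "\<forall>z w. (z, w) \<in> S \<longrightarrow> f (pencil l m z, pencil l m w) = (z - w) ^ k * h (z, w)"
    using vanishing_local[OF assms(1) lmz] by blast
  obtain S' h' where S': "open S'" "(z, z) \<in> S'" "holomorphic2_on h' S'"
    "\<forall>z w. (z, w) \<in> S' \<longrightarrow> g (pencil l m z, pencil l m w) = (z - w) ^ k * h' (z, w)"
    using vanishing_local[OF assms(2) lmz] by blast
  have "holomorphic2_on (\<lambda>p. h p - h' p) (S \<inter> S')"
    by (intro holomorphic2_on_diff; rule holomorphic2_on_subset, rule S S', blast)
  then show "\<exists>S h. open S \<and> (z, z) \<in> S \<and> holomorphic2_on h S \<and>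
      (\<forall>(z, w)\<in>S. f (pencil l m z, pencil l m w) - g (pencil l m z, pencil l m w) = (z - w) ^ k * h (z, w))"
    using S S' by (intro exI[of _ "S \<inter> S'"] exI[of _ "\<lambda>p. h p - h' p"]) (auto simp: right_diff_distrib)
qed

lemma vanishing_zero: "(\<lambda>y. 0) \<in> vanishing_sections k b N"
  unfolding vanishing_sections_def mem_Collect_eq
  by (intro conjI allI impI LL_zero exI[of _ UNIV] exI[of _ "\<lambda>_. 0"])
    (auto intro: holomorphic2_on_const)

lemma subsheaf_vanishing: "subsheaf XX_top (LL_sections 0 b) (vanishing_sections k b)"
proof
  fix f N assume f: "f \<in> LL_sections 0 b N"
    and loc: "\<And>p. p \<in> N \<Longrightarrow> \<exists>N'. openin XX_top N' \<and> p \<in> N' \<and> f \<in> vanishing_sections k b N'"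
  show "f \<in> vanishing_sections k b N"
    unfolding vanishing_sections_def mem_Collect_eq
  proof (intro conjI allI impI f)
    fix l m z assume lm: "frame l m" and z: "(line (pencil l m z), line (pencil l m z)) \<in> N"
    obtain N' where "(line (pencil l m z), line (pencil l m z)) \<in> N'" "f \<in> vanishing_sections k b N'"
      using loc[OF z] by blast
    then show "\<exists>S h. open S \<and> (z, z) \<in> S \<and> holomorphic2_on h S \<and>
      (\<forall>(z, w)\<in>S. f (pencil l m z, pencil l m w) = (z - w) ^ k * h (z, w))"
      using lm unfolding vanishing_sections_def by blast
  qed
qed (auto intro: LL_restrict vanishing_restrict LL_diff vanishing_diff vanishing_zero dest: vanishing_in_LL)

text \<open>Freezing the first point at \<open>line l\<close>, which has parameter 0, turns
  divisibility by a power of \<open>z - w\<close> into vanishing at \<open>w = 0\<close>; the sign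
  \<open>(-1)^k\<close> goes into \<open>H\<close>.\<close>

lemma slice_vanishing:
  assumes g: "g \<in> vanishing_sections k b N" and lm: "frame l m" and N: "(line l, line l) \<in> N"
  shows "\<exists>r H. 0 < r \<and> H holomorphic_on ball 0 r \<and> (\<forall>w\<in>ball 0 r. g (l, pencil l m w) = w ^ k * H w)"
proof -
  have N': "(line (pencil l m 0), line (pencil l m 0)) \<in> N" using N by (simp add: pencil_0)
  obtain S h where S: "open S" "(0, 0) \<in> S" "holomorphic2_on h S"
    "\<forall>z w. (z, w) \<in> S \<longrightarrow> g (pencil l m z, pencil l m w) = (z - w) ^ k * h (z, w)"
    using vanishing_local[OF g lm N'] by blast
  obtain A B where AB: "open A" "open B" "(0, 0) \<in> A \<times> B" "A \<times> B \<subseteq> S"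
    using open_prod_elim[OF S(1,2)] by blast
  then have "0 \<in> B" by blast
  then obtain r where r: "0 < r" "ball 0 r \<subseteq> B" using AB(2) unfolding open_contains_ball by blast
  define H where "H = (\<lambda>w. (-1) ^ k * h (0, w))"
  have sub: "(0, w) \<in> S" if "w \<in> ball 0 r" for w using that r AB by auto
  have "(\<lambda>w. h (0, w)) holomorphic_on ball 0 r"
    by (rule holomorphic2_on_slice[OF S(3)]) (use sub in \<open>auto intro!: holomorphic_intros\<close>)
  then have "H holomorphic_on ball 0 r" unfolding H_def by (intro holomorphic_intros)
  moreover have "g (l, pencil l m w) = w ^ k * H w" if "w \<in> ball 0 r" for w
    using S(4)[rule_format, OF sub[OF that]] by (simp add: pencil_0 H_def mult.assoc[symmetric] power_mult_distrib[symmetric])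
  ultimately show ?thesis using r(1) by blast
qed

end

section \<open>Osculating polynomials\<close>

text \<open>The Moebius map is the change of parameter between two charts with the same centre, see
  \<open>chart_change\<close>.\<close>

lemma chart_change_ball:
  fixes c \<alpha> \<beta> :: complex
  assumes "c \<noteq> 0" "open B" "0 \<in> B"
  shows "\<exists>r>0. \<forall>w\<in>ball 0 r. c + w * \<alpha> \<noteq> 0 \<and> w * \<beta> / (c + w * \<alpha>) \<in> B"
proof -
  have D: "open {w. c + w * \<alpha> \<noteq> 0}"
    by (intro open_Collect_neq continuous_intros)
  have "continuous_on {w. c + w * \<alpha> \<noteq> 0} (\<lambda>w. w * \<beta> / (c + w * \<alpha>))"
    by (intro continuous_intros) auto
  then have "open ({w. c + w * \<alpha> \<noteq> 0} \<inter> (\<lambda>w. w * \<beta> / (c + w * \<alpha>)) -` B)"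
    using D assms(2) by (rule continuous_open_preimage)
  moreover have "0 \<in> {w. c + w * \<alpha> \<noteq> 0} \<inter> (\<lambda>w. w * \<beta> / (c + w * \<alpha>)) -` B"
    using assms by simp
  ultimately obtain r where "0 < r" "ball 0 r \<subseteq> {w. c + w * \<alpha> \<noteq> 0} \<inter> (\<lambda>w. w * \<beta> / (c + w * \<alpha>)) -` B"
    unfolding open_contains_ball by blast
  then show ?thesis by (intro exI[of _ r]) auto
qed

context oriented_plane begin

sublocale jets: subsheaf XX_top "LL_sections 0 b" "vanishing_sections k b" for b k
  by (rule subsheaf_vanishing)

abbreviation jet_stalk ::
  "nat \<Rightarrow> nat \<Rightarrow> 'v set \<times> 'v set \<Rightarrow> ('v covector \<times> 'v covector \<Rightarrow> complex) \<Rightarrow>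
   ('v covector \<times> 'v covector \<Rightarrow> complex) set" where
  "jet_stalk k n \<equiv> stalk_class XX_top (LL_sections 0 (int n)) (vanishing_sections (k + 1) (int n))"

lemma L_homogeneous:
  assumes "f \<in> L_sections d U" "\<xi> \<in> U" "l \<in> cone \<xi>" "c \<noteq> 0"
  shows "f (\<lambda>v. c * l v) = c powi d * f l"
  using assms unfolding L_sections_def by blast

lemma L_holomorphic:
  assumes "f \<in> L_sections d U" "frame l m"
  shows "(\<lambda>z. f (pencil l m z)) holomorphic_on {z. line (pencil l m z) \<in> U}"
  using assms unfolding L_sections_def by blast

text \<open>Equal centres force \<open>l2 = c * l1\<close>, and Cramer's rule gives
  \<open>m2 = \<alpha> * l1 + \<beta> * m1\<close>. Collecting terms in \<open>l2 + w * m2\<close>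
  yields the scaling factor \<open>c + w * \<alpha>\<close>, through which homogeneity enters, and
  the new parameter.\<close>

lemma chart_change:
  assumes f1: "frame l1 m1" and f2: "frame l2 m2" and eq: "line l1 = line l2"
  shows "\<exists>c \<alpha> \<beta>. c \<noteq> 0 \<and> \<beta> \<noteq> 0 \<and> \<omega> l2 m2 = c * \<beta> * \<omega> l1 m1 \<and>
    (\<forall>w. c + w * \<alpha> \<noteq> 0 \<longrightarrow> pencil l2 m2 w = (\<lambda>v. (c + w * \<alpha>) * pencil l1 m1 (w * \<beta> / (c + w * \<alpha>)) v))"
proof -
  note l1 = frameD[OF f1] and l2 = frameD[OF f2]
  have "l1 \<in> cone (line l1)" "l2 \<in> cone (line l1)" using l1 l2 eq by (auto simp: cone_def)
  then obtain c where c: "c \<noteq> 0" "l2 = (\<lambda>v. c * l1 v)"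
    using cone_scaleE[OF line_in_X_frame(1)[OF f1]] by blast
  define \<alpha> where "\<alpha> = \<omega> m2 m1 / \<omega> l1 m1"
  define \<beta> where "\<beta> = \<omega> l1 m2 / \<omega> l1 m1"
  have m2: "m2 v = \<alpha> * l1 v + \<beta> * m1 v" for v
    using omega_expand[OF l1(1,2) l2(2), of v] l1(3) by (simp add: \<alpha>_def \<beta>_def field_simps)
  have om: "\<omega> l2 m2 = c * \<omega> l1 m2" unfolding c(2) by (rule omega_scale_left[OF l1(1) l2(2)])
  have \<beta>: "\<beta> \<noteq> 0" using om l2(3) by (auto simp: \<beta>_def l1(3))
  have "pencil l2 m2 w = (\<lambda>v. (c + w * \<alpha>) * pencil l1 m1 (w * \<beta> / (c + w * \<alpha>)) v)"
    if nz: "c + w * \<alpha> \<noteq> 0" for w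
  proof
    fix v
    have "(c + w * \<alpha>) * pencil l1 m1 (w * \<beta> / (c + w * \<alpha>)) v =
        (c + w * \<alpha>) * l1 v + ((c + w * \<alpha>) * (w * \<beta> / (c + w * \<alpha>))) * m1 v"
      by (simp add: pencil_def distrib_left)
    also have "(c + w * \<alpha>) * (w * \<beta> / (c + w * \<alpha>)) = w * \<beta>" using nz by simp
    also have "(c + w * \<alpha>) * l1 v + (w * \<beta>) * m1 v = pencil l2 m2 w v"
      by (simp add: pencil_def m2 c(2) algebra_simps)
    finally show "pencil l2 m2 w v = (c + w * \<alpha>) * pencil l1 m1 (w * \<beta> / (c + w * \<alpha>)) v" ..
  qed
  moreover have "\<omega> l2 m2 = c * \<beta> * \<omega> l1 m1" using om l1(3) by (simp add: \<beta>_def)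
  ultimately show ?thesis using c(1) \<beta> by blast
qed

text \<open>Order of vanishing at the centre of a chart, asked in every frame that starts with
  \<open>l\<close>, so that it can be used in whichever frame is at hand;
  \<open>vanishes_atI\<close> reduces it to a single frame.\<close>

definition vanishes_at :: "nat \<Rightarrow> 'v covector \<Rightarrow> ('v covector \<Rightarrow> complex) \<Rightarrow> bool" where
  "vanishes_at k l s \<longleftrightarrow> (\<forall>m. frame l m \<longrightarrow>
     (\<exists>r H. 0 < r \<and> H holomorphic_on ball 0 r \<and> (\<forall>w\<in>ball 0 r. s (pencil l m w) = w ^ k * H w)))"

text \<open>A change of chart multiplies the parameter by the unit
  \<open>\<beta> / (c + w * \<alpha>)\<close> and the section by a power of the unit
  \<open>c + w * \<alpha>\<close>; neither affects the order of vanishing.\<close>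

lemma vanishes_atI:
  assumes s: "s \<in> L_sections d N" and N: "openin X_top N" "line l1 \<in> N"
    and f1: "frame l1 m1" and l2: "l2 \<in> dual" "line l1 = line l2"
    and r: "0 < r" and H: "H holomorphic_on ball 0 r"
    and eq: "\<And>w. w \<in> ball 0 r \<Longrightarrow> s (pencil l1 m1 w) = w ^ k * H w"
  shows "vanishes_at k l2 s"
  unfolding vanishes_at_def
proof (intro allI impI)
  fix m2 assume f2: "frame l2 m2"
  obtain c \<alpha> \<beta> where cc: "c \<noteq> 0" "\<beta> \<noteq> 0" "\<omega> l2 m2 = c * \<beta> * \<omega> l1 m1"
    and pen: "\<forall>w. c + w * \<alpha> \<noteq> 0 \<longrightarrow> pencil l2 m2 w = (\<lambda>v. (c + w * \<alpha>) * pencil l1 m1 (w * \<beta> / (c + w * \<alpha>)) v)"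
    using chart_change[OF f1 f2 l2(2)] by blast
  define \<phi> where "\<phi> = (\<lambda>w. w * \<beta> / (c + w * \<alpha>))"
  define B where "B = ball 0 r \<inter> {z. line (pencil l1 m1 z) \<in> N}"
  have "open B" "0 \<in> B" using open_chart[OF N(1) f1] N(2) r by (auto simp: B_def pencil_0)
  then obtain r' where r': "0 < r'" and b: "\<forall>w\<in>ball 0 r'. c + w * \<alpha> \<noteq> 0 \<and> \<phi> w \<in> B"
    using chart_change_ball[OF cc(1), of B \<alpha> \<beta>] unfolding \<phi>_def by blast
  have nz: "c + w * \<alpha> \<noteq> 0" and \<phi>B: "\<phi> w \<in> ball 0 r" "line (pencil l1 m1 (\<phi> w)) \<in> N" if "w \<in> ball 0 r'" for w
    using b that by (auto simp: B_def)
  define H' where "H' = (\<lambda>w. (c + w * \<alpha>) powi d * (\<beta> / (c + w * \<alpha>)) ^ k * H (\<phi> w))"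
  have \<phi>h: "\<phi> holomorphic_on ball 0 r'"
    unfolding \<phi>_def using nz by (intro holomorphic_intros)
  have "(H \<circ> \<phi>) holomorphic_on ball 0 r'"
    by (rule holomorphic_on_compose_gen[OF \<phi>h H]) (use \<phi>B in auto)
  then have "(\<lambda>w. H (\<phi> w)) holomorphic_on ball 0 r'" by (simp add: o_def)
  then have "H' holomorphic_on ball 0 r'"
    unfolding H'_def using nz by (intro holomorphic_intros) auto
  moreover have "s (pencil l2 m2 w) = w ^ k * H' w" if w: "w \<in> ball 0 r'" for w
  proof -
    have "s (pencil l2 m2 w) = s (\<lambda>v. (c + w * \<alpha>) * pencil l1 m1 (\<phi> w) v)"
      using pen nz[OF w] by (simp add: \<phi>_def)
    also have "\<dots> = (c + w * \<alpha>) powi d * s (pencil l1 m1 (\<phi> w))"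
      by (rule L_homogeneous[OF s \<phi>B(2)[OF w] pencil_in_cone[OF f1] nz[OF w]])
    also have "\<dots> = (c + w * \<alpha>) powi d * (\<phi> w ^ k * H (\<phi> w))" using eq \<phi>B(1)[OF w] by simp
    also have "\<phi> w ^ k = w ^ k * (\<beta> / (c + w * \<alpha>)) ^ k"
      by (simp add: \<phi>_def power_mult_distrib[symmetric])
    finally show ?thesis by (simp add: H'_def mult_ac)
  qed
  ultimately show "\<exists>r H. 0 < r \<and> H holomorphic_on ball 0 r \<and> (\<forall>w\<in>ball 0 r. s (pencil l2 m2 w) = w ^ k * H w)"
    using r' by blast
qed

lemma Sym_on_pencil:
  assumes lm: "frame l m" and P: "P \<in> Sym j"
  obtains c where "P = (\<lambda>y. \<Sum>i\<le>j. c i * monomial l m j i y)"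
    "\<And>w. P (pencil l m w) = (\<Sum>i\<le>j. (c i * \<omega> l m ^ j) * w ^ i)"
proof -
  obtain c where c: "P = (\<lambda>y. \<Sum>i\<le>j. c i * monomial l m j i y)"
    using Sym_expand_monomials[OF lm P] by blast
  have "P (pencil l m w) = (\<Sum>i\<le>j. (c i * \<omega> l m ^ j) * w ^ i)" for w
    unfolding c
  proof (rule sum.cong)
    fix i assume "i \<in> {..j}"
    then have "monomial l m j i (pencil l m w) = w ^ i * (\<omega> l m ^ i * \<omega> l m ^ (j - i))"
      using frameD[OF lm] by (simp add: monomial_def omega_pencils dual_pencil power_mult_distrib)
    also have "\<omega> l m ^ i * \<omega> l m ^ (j - i) = \<omega> l m ^ j"
      using \<open>i \<in> {..j}\<close> by (simp add: power_add[symmetric])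
    finally show "c i * monomial l m j i (pencil l m w) = c i * \<omega> l m ^ j * w ^ i" by (simp add: mult_ac)
  qed simp
  with c that show ?thesis by blast
qed

text \<open>In a chart the form is a polynomial of degree at most \<open>n\<close>, which is zero
  once it vanishes to order \<open>n + 1\<close>. Uniqueness in J^n(L^n) = V_n comes from
  here.\<close>

lemma Sym_vanishing:
  assumes P: "P \<in> Sym n" and lm: "frame l m" and r: "0 < r" and H: "H holomorphic_on ball 0 r"
    and eq: "\<And>w. w \<in> ball 0 r \<Longrightarrow> P (pencil l m w) = w ^ Suc n * H w"
  shows "P = (\<lambda>_. 0)"
proof -
  obtain c where c: "P = (\<lambda>y. \<Sum>i\<le>n. c i * monomial l m n i y)"
    "\<And>w. P (pencil l m w) = (\<Sum>i\<le>n. (c i * \<omega> l m ^ n) * w ^ i)"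
    using Sym_on_pencil[OF lm P] by blast
  have "(\<Sum>i<Suc n. (c i * \<omega> l m ^ n) * w ^ i) = w ^ Suc n * H w" if "w \<in> ball 0 r - {0}" for w
    using eq[of w] that unfolding c(2) lessThan_Suc_atMost by blast
  from polynomial_vanishing_order[OF r holomorphic_on_imp_continuous_on[OF H] this]
  have "c i = 0" if "i \<le> n" for i using that frameD(3)[OF lm] by (simp add: less_Suc_eq_le)
  then show ?thesis unfolding c(1) by simp
qed

text \<open>\<open>V_sections\<close> asks for holomorphy in the base point for each fixed covector.
  Since every value of \<open>\<sigma>\<close> is a polynomial of degree at most \<open>n\<close> in
  the second parameter, interpolation at \<open>n + 1\<close> fixed covectors gives joint
  holomorphy.\<close>

lemma V_sections_in_LL:
  assumes U: "openin X_top U" and \<sigma>: "\<sigma> \<in> V_sections n U"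
  shows "(\<lambda>(l, y). \<sigma> (line l) y) \<in> LL_sections 0 (int n) (U \<times> X)"
proof (rule LL_I, goal_cases)
  case (1 \<xi> \<eta> l y c)
  have P: "\<sigma> \<xi> \<in> Sym n" using \<sigma> 1(1) by (auto simp: V_sections_def)
  have "line (\<lambda>v. c * l v) = line l" using 1(4) by (auto simp: line_def)
  moreover have "line l = \<xi>" "y \<in> dual" using 1 by (auto simp: cone_def)
  ultimately show ?case using Sym_homogeneous[OF P, of y c] by simp
next
  case (2 l m l' m')
  obtain b :: "nat \<Rightarrow> complex \<Rightarrow> complex" where bh: "\<And>j. b j holomorphic_on UNIV"
    and b: "\<And>c w. (\<Sum>i\<le>n. c i * w^i) = (\<Sum>j\<le>n. (\<Sum>i\<le>n. c i * of_nat j^i) * b j w)"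
    using lagrange_interpolation[of n] by blast
  let ?U = "{z. line (pencil l m z) \<in> U}"
  have hol: "(\<lambda>z. \<sigma> (line (pencil l m z)) (pencil l' m' (of_nat j))) holomorphic_on ?U" for j
    using \<sigma> 2 frameD(1,2)[OF 2(2)] dual_pencil unfolding V_sections_def by blast
  have S: "{(z, w). (line (pencil l m z), line (pencil l' m' w)) \<in> U \<times> X} = ?U \<times> UNIV"
    using line_pencil_in_X[OF 2(2)] by auto
  have hs: "holomorphic2_on (\<lambda>p. \<Sum>j\<le>n. \<sigma> (line (pencil l m (fst p))) (pencil l' m' (of_nat j)) * b j (snd p)) (?U \<times> UNIV)"
  proof (intro holomorphic2_on_sum holomorphic2_on_mult)
    fix j
    show "holomorphic2_on (\<lambda>p. \<sigma> (line (pencil l m (fst p))) (pencil l' m' (of_nat j))) (?U \<times> UNIV)"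
      by (rule holomorphic2_on_outer[OF hol open_chart[OF U 2(1)] holomorphic2_on_fst]) auto
    show "holomorphic2_on (\<lambda>p. b j (snd p)) (?U \<times> UNIV)"
      by (rule holomorphic2_on_outer[OF bh open_UNIV holomorphic2_on_snd]) auto
  qed
  have es: "(\<Sum>j\<le>n. \<sigma> (line (pencil l m (fst p))) (pencil l' m' (of_nat j)) * b j (snd p)) =
      (case p of (z, w) \<Rightarrow> (\<lambda>(l, y). \<sigma> (line l) y) (pencil l m z, pencil l' m' w))" if "p \<in> ?U \<times> UNIV" for p
  proof -
    obtain z w where p: "p = (z, w)" by (cases p)
    have P: "\<sigma> (line (pencil l m z)) \<in> Sym n" using \<sigma> that p by (auto simp: V_sections_def)
    obtain c where c: "\<And>w. \<sigma> (line (pencil l m z)) (pencil l' m' w) = (\<Sum>i\<le>n. (c i * \<omega> l' m' ^ n) * w ^ i)"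
      using Sym_on_pencil[OF 2(2) P] by blast
    show ?thesis unfolding p prod.case fst_conv snd_conv c by (rule b[symmetric])
  qed
  have "open (?U \<times> (UNIV :: complex set))" using open_chart[OF U 2(1)] by (intro open_Times open_UNIV)
  from holomorphic2_on_transform[OF hs this es] show ?case unfolding S .
qed

text \<open>\<open>T z\<close> is the Taylor polynomial of degree \<open>n\<close> of
  \<open>f\<close> in the second variable at the point with parameter \<open>z\<close>, made
  homogeneous. The expansion with parameters makes it holomorphic in \<open>z\<close>, with one
  remainder \<open>h\<close> for all \<open>z\<close> at once.\<close>

lemma osculating_family:
  assumes f: "f \<in> LL_sections 0 (int n) N" and N: "openin XX_top N" and lm: "frame l m"
    and z0: "(line (pencil l m z0), line (pencil l m z0)) \<in> N"
  shows "\<exists>r T h. 0 < r \<and>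
    (\<forall>z\<in>ball z0 r. (line (pencil l m z), line (pencil l m z)) \<in> N \<and> T z \<in> Sym n \<and>
       (\<forall>l'\<in>cone (line (pencil l m z)). vanishes_at (Suc n) l' (\<lambda>y. f (l', y) - T z y))) \<and>
    (\<forall>y\<in>dual. (\<lambda>z. T z y) holomorphic_on ball z0 r) \<and>
    holomorphic2_on h (ball z0 r \<times> ball z0 r) \<and>
    (\<forall>z\<in>ball z0 r. \<forall>w\<in>ball z0 r.
       f (pencil l m z, pencil l m w) - T z (pencil l m w) = (z - w) ^ Suc n * h (z, w))"
proof -
  let ?S = "{(z, w). (line (pencil l m z), line (pencil l m w)) \<in> N}"
  have S0: "(z0, z0) \<in> ?S" using z0 by simp
  obtain r a h where r: "0 < r" "ball z0 r \<times> ball z0 r \<subseteq> ?S"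
    and a: "\<forall>i<Suc n. a i holomorphic_on ball z0 r"
    and h: "holomorphic2_on h (ball z0 r \<times> ball z0 r)"
    and eq: "\<forall>z\<in>ball z0 r. \<forall>w\<in>ball z0 r. (\<lambda>(z, w). f (pencil l m z, pencil l m w)) (z, w) =
       (\<Sum>i<Suc n. a i z * (w - z)^i) + (w - z)^Suc n * h (z, w)"
    using diagonal_expansion[OF LL_holomorphic2[OF f lm lm] open_chart2[OF N lm lm] S0, of "Suc n"] by blast
  note l = frameD[OF lm]
  \<comment> \<open>The frame \<open>(pencil l m z, m)\<close> is centred at the point with
    parameter \<open>z\<close>, so its monomials restrict to the powers of \<open>w - z\<close>, up
    to the factor \<open>\<omega> l m ^ n\<close> that is divided out.\<close>
  define T where "T = (\<lambda>z y. \<Sum>i\<le>n. (a i z / \<omega> l m ^ n) * monomial (pencil l m z) m n i y)"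
  have TS: "T z \<in> Sym n" for z
    unfolding T_def using l by (intro Sym_sum Sym_cmult monomial_in_Sym dual_pencil) auto
  have Tp: "T z (pencil l m w) = (\<Sum>i<Suc n. a i z * (w - z)^i)" for z w
    unfolding T_def lessThan_Suc_atMost
  proof (rule sum.cong)
    fix i assume i: "i \<in> {..n}"
    have "monomial (pencil l m z) m n i (pencil l m w) = (w - z) ^ i * (\<omega> l m ^ i * \<omega> l m ^ (n - i))"
      using l by (simp add: monomial_def omega_pencils dual_pencil power_mult_distrib)
    also have "\<omega> l m ^ i * \<omega> l m ^ (n - i) = \<omega> l m ^ n" using i by (simp add: power_add[symmetric])
    finally show "a i z / \<omega> l m ^ n * monomial (pencil l m z) m n i (pencil l m w) = a i z * (w - z) ^ i"
      using l(3) by simp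
  qed simp
  have dif: "f (pencil l m z, pencil l m w) - T z (pencil l m w) = (w - z) ^ Suc n * h (z, w)"
    if "z \<in> ball z0 r" "w \<in> ball z0 r" for z w
    using eq that unfolding Tp by (simp del: sum.lessThan_Suc power_Suc)
  have inN: "(line (pencil l m z), line (pencil l m w)) \<in> N" if "z \<in> ball z0 r" "w \<in> ball z0 r" for z w
    using r(2) that by blast
  have van: "vanishes_at (Suc n) l' (\<lambda>y. f (l', y) - T z y)"
    if z: "z \<in> ball z0 r" and l': "l' \<in> cone (line (pencil l m z))" for z l'
  proof -
    let ?\<zeta> = "line (pencil l m z)"
    have \<zeta>X: "?\<zeta> \<in> X" by (rule line_pencil_in_X[OF lm])
    note l'd = coneD[OF \<zeta>X l']
    obtain c where c: "c \<noteq> 0" "l' = (\<lambda>v. c * pencil l m z v)"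
      using cone_scaleE[OF \<zeta>X pencil_in_cone[OF lm] l'] by blast
    have sl: "(\<lambda>y. f (l', y)) \<in> L_sections (int n) {\<eta>. (?\<zeta>, \<eta>) \<in> N}"
      using LL_slice[OF f N l'd(1,2)] by (simp add: l'd(3))
    define s where "s = (\<lambda>y. f (l', y) - T z y)"
    have s: "s \<in> L_sections (int n) {\<eta>. (?\<zeta>, \<eta>) \<in> N}"
      unfolding s_def by (rule L_sections_diff[OF sl Sym_in_L_sections[OF TS]])
    obtain r' where r': "0 < r'" "ball z r' \<subseteq> ball z0 r"
      using z open_contains_ball[of "ball z0 r"] open_ball by blast
    have zw: "z + w \<in> ball z0 r" if "w \<in> ball 0 r'" for w
    proof -
      have "z + w \<in> ball z r'" using that by (simp add: dist_norm)
      then show ?thesis using r'(2) by blast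
    qed
    have "vanishes_at (Suc n) l' s"
    proof (rule vanishes_atI[OF s openin_slice[OF N] _ frame_pencil[OF lm, of z] l'd(1) _ r'(1)])
      show "?\<zeta> \<in> {\<eta>. (?\<zeta>, \<eta>) \<in> N}" using inN[OF z z] by simp
      show "?\<zeta> = line l'" using l'd(3) by simp
      show "(\<lambda>w. h (z, z + w)) holomorphic_on ball 0 r'"
        by (rule holomorphic2_on_slice[OF h]) (use z zw in \<open>auto intro!: holomorphic_intros\<close>)
      fix w :: complex assume w: "w \<in> ball 0 r'"
      \<comment> \<open>\<open>f\<close> is homogeneous of degree 0 in its first argument, so every
        covector of the cone gives the same slice.\<close>
      have "f (l', pencil l m (z + w)) = f (pencil l m z, pencil l m (z + w))"
        using LL_homogeneous(1)[OF f inN[OF z zw[OF w]] pencil_in_cone[OF lm] pencil_in_cone[OF lm] c(1)]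
        unfolding c(2) by simp
      then show "s (pencil (pencil l m z) m w) = w ^ Suc n * h (z, z + w)"
        using dif[OF z zw[OF w]] unfolding s_def pencil_pencil by simp
    qed
    then show ?thesis by (simp add: s_def)
  qed
  have hol: "(\<lambda>z. T z y) holomorphic_on ball z0 r" if y: "y \<in> dual" for y
  proof -
    have "(\<lambda>z. \<Sum>i\<le>n. (a i z / \<omega> l m ^ n) * ((\<omega> l y + z * \<omega> m y) ^ i * \<omega> y m ^ (n - i))) holomorphic_on ball z0 r"
      using a l(3) by (intro holomorphic_intros) auto
    then show ?thesis using y l by (simp add: T_def monomial_def omega_pencil)
  qed
  \<comment> \<open>The sign turns powers of \<open>w - z\<close> into the powers of
    \<open>z - w\<close> that \<open>vanishing_sections\<close> uses.\<close>
  define h' where "h' = (\<lambda>p. (-1) ^ Suc n * h p)"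
  have "holomorphic2_on h' (ball z0 r \<times> ball z0 r)"
    unfolding h'_def by (intro holomorphic2_intros h)
  moreover have "f (pencil l m z, pencil l m w) - T z (pencil l m w) = (z - w) ^ Suc n * h' (z, w)"
    if "z \<in> ball z0 r" "w \<in> ball z0 r" for z w
  proof -
    have "(w - z) ^ Suc n = (z - w) ^ Suc n * (-1) ^ Suc n"
      unfolding power_mult_distrib[symmetric] by simp
    then show ?thesis unfolding dif[OF that] h'_def by (simp only: mult.assoc)
  qed
  ultimately show ?thesis
    using r(1) TS van hol inN by (intro exI[of _ r] exI[of _ T] exI[of _ h'] conjI ballI) auto
qed

text \<open>\<open>P\<close> is the form with the \<open>n\<close>-jet that \<open>q\<close>
  prescribes at \<open>\<zeta>\<close>. One representative of the stalk at the diagonal point is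
  enough: by \<open>osculates_unique\<close> its choice does not affect \<open>P\<close>.\<close>

definition osculates :: "nat \<Rightarrow> 'v jet_section \<Rightarrow> 'v set \<Rightarrow> ('v covector \<Rightarrow> complex) \<Rightarrow> bool" where
  "osculates n q \<zeta> P \<longleftrightarrow> P \<in> Sym n \<and> (\<exists>N f. openin XX_top N \<and> (\<zeta>, \<zeta>) \<in> N \<and>
     f \<in> LL_sections 0 (int n) N \<and>
     q (\<zeta>, \<zeta>) = jet_stalk n n (\<zeta>, \<zeta>) f \<and>
     (\<forall>l\<in>cone \<zeta>. vanishes_at (Suc n) l (\<lambda>y. f (l, y) - P y)))"

text \<open>Two representatives of the stalk differ by a function vanishing to order
  \<open>n + 1\<close> on the slice through \<open>\<zeta>\<close>. The same then holds for the two
  forms, and \<open>Sym_vanishing\<close> applies.\<close>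

lemma osculates_unique:
  assumes "osculates n q \<zeta> P1" "osculates n q \<zeta> P2" "\<zeta> \<in> X"
  shows "P1 = P2"
proof -
  let ?st = "jet_stalk n n (\<zeta>, \<zeta>)"
  obtain N1 f1 where 1: "P1 \<in> Sym n" "openin XX_top N1" "(\<zeta>, \<zeta>) \<in> N1" "f1 \<in> LL_sections 0 (int n) N1"
    "q (\<zeta>, \<zeta>) = ?st f1" "\<forall>l\<in>cone \<zeta>. vanishes_at (Suc n) l (\<lambda>y. f1 (l, y) - P1 y)"
    using assms(1) unfolding osculates_def by blast
  obtain N2 f2 where 2: "P2 \<in> Sym n" "openin XX_top N2" "(\<zeta>, \<zeta>) \<in> N2" "f2 \<in> LL_sections 0 (int n) N2"
    "q (\<zeta>, \<zeta>) = ?st f2" "\<forall>l\<in>cone \<zeta>. vanishes_at (Suc n) l (\<lambda>y. f2 (l, y) - P2 y)"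
    using assms(2) unfolding osculates_def by blast
  have "?st f1 = ?st f2" using 1(5) 2(5) by simp
  then obtain N where N: "(\<zeta>, \<zeta>) \<in> N" "(\<lambda>y. f1 y - f2 y) \<in> vanishing_sections (n + 1) (int n) N"
    using jets.stalk_class_eqD[OF 2(2,3,4)] by blast
  obtain l m where lm: "frame l m" "line l = \<zeta>" "l \<in> cone \<zeta>" using X_obtain_frame[OF assms(3)] by blast
  have "(line l, line l) \<in> N" using N(1) lm(2) by simp
  from slice_vanishing[OF N(2) lm(1) this]
  obtain r H where r: "0 < r" "H holomorphic_on ball 0 r"
    "\<forall>w\<in>ball 0 r. f1 (l, pencil l m w) - f2 (l, pencil l m w) = w ^ (n + 1) * H w" by blast
  obtain r1 H1 where r1: "0 < r1" "H1 holomorphic_on ball 0 r1"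
    "\<forall>w\<in>ball 0 r1. f1 (l, pencil l m w) - P1 (pencil l m w) = w ^ Suc n * H1 w"
    using 1(6) lm unfolding vanishes_at_def by blast
  obtain r2 H2 where r2: "0 < r2" "H2 holomorphic_on ball 0 r2"
    "\<forall>w\<in>ball 0 r2. f2 (l, pencil l m w) - P2 (pencil l m w) = w ^ Suc n * H2 w"
    using 2(6) lm unfolding vanishes_at_def by blast
  define \<rho> where "\<rho> = min r (min r1 r2)"
  have sub: "ball 0 \<rho> \<subseteq> ball 0 r" "ball 0 \<rho> \<subseteq> ball 0 r1" "ball 0 \<rho> \<subseteq> ball (0::complex) r2"
    by (auto simp: \<rho>_def)
  have "(\<lambda>y. 1 * P1 y + (- 1) * P2 y) = (\<lambda>_. 0)"
  proof (rule Sym_vanishing[OF Sym_linear[OF 1(1) 2(1)] lm(1)])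
    show "0 < \<rho>" using r(1) r1(1) r2(1) by (simp add: \<rho>_def)
    show "(\<lambda>w. H w - H1 w + H2 w) holomorphic_on ball 0 \<rho>"
      using r(2) r1(2) r2(2) sub by (intro holomorphic_intros) (auto elim: holomorphic_on_subset)
    fix w :: complex assume w: "w \<in> ball 0 \<rho>"
    have e1: "f1 (l, pencil l m w) - f2 (l, pencil l m w) = w ^ Suc n * H w"
      and e2: "f1 (l, pencil l m w) - P1 (pencil l m w) = w ^ Suc n * H1 w"
      and e3: "f2 (l, pencil l m w) - P2 (pencil l m w) = w ^ Suc n * H2 w"
      using bspec[OF r(3) subsetD[OF sub(1) w]] bspec[OF r1(3) subsetD[OF sub(2) w]]
        bspec[OF r2(3) subsetD[OF sub(3) w]] by simp_all
    have "w ^ Suc n * (H w - H1 w + H2 w) = w ^ Suc n * H w - w ^ Suc n * H1 w + w ^ Suc n * H2 w"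
      by (simp only: right_diff_distrib distrib_left)
    then show "1 * P1 (pencil l m w) + - 1 * P2 (pencil l m w) = w ^ Suc n * (H w - H1 w + H2 w)"
      unfolding e1[symmetric] e2[symmetric] e3[symmetric] by simp
  qed
  then show ?thesis by (simp add: fun_eq_iff)
qed

lemma inj_on_jet_of:
  assumes U: "openin X_top U"
  shows "inj_on (jet_of n n U) (V_sections n U)"
proof (rule inj_onI)
  fix \<sigma> \<tau> assume \<sigma>: "\<sigma> \<in> V_sections n U" and \<tau>: "\<tau> \<in> V_sections n U" and eq: "jet_of n n U \<sigma> = jet_of n n U \<tau>"
  show "\<sigma> = \<tau>"
  proof
    fix \<zeta>
    show "\<sigma> \<zeta> = \<tau> \<zeta>"
    proof (cases "\<zeta> \<in> U")
      case True
      have \<zeta>X: "\<zeta> \<in> X" using True openin_X_subset[OF U] by blast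
      have p: "(\<zeta>, \<zeta>) \<in> U \<times> X" using True \<zeta>X by simp
      have o: "openin XX_top (U \<times> X)" by (rule openin_Times[OF U openin_X])
      have "jet_of n n U \<sigma> (\<zeta>, \<zeta>) = jet_of n n U \<tau> (\<zeta>, \<zeta>)" using eq by simp
      then have "jet_stalk n n (\<zeta>, \<zeta>)
            (\<lambda>(l, y). \<sigma> (line l) y) =
          jet_stalk n n (\<zeta>, \<zeta>)
            (\<lambda>(l, y). \<tau> (line l) y)"
        using p unfolding jet_of_def by simp
      from jets.stalk_class_eqD[OF o p V_sections_in_LL[OF U \<tau>] this]
      obtain N where N: "(\<zeta>, \<zeta>) \<in> N"
        "(\<lambda>p. (case p of (l, y) \<Rightarrow> \<sigma> (line l) y) - (case p of (l, y) \<Rightarrow> \<tau> (line l) y))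
          \<in> vanishing_sections (n + 1) (int n) N" by blast
      obtain l m where lm: "frame l m" "line l = \<zeta>" "l \<in> cone \<zeta>" using X_obtain_frame[OF \<zeta>X] by blast
      have "(line l, line l) \<in> N" using N(1) lm(2) by simp
      from slice_vanishing[OF N(2) lm(1) this]
      obtain r H where r: "0 < r" "H holomorphic_on ball 0 r"
        "\<forall>w\<in>ball 0 r. \<sigma> \<zeta> (pencil l m w) - \<tau> \<zeta> (pencil l m w) = w ^ (n + 1) * H w"
        unfolding prod.case lm(2) by blast
      have P: "\<sigma> \<zeta> \<in> Sym n" "\<tau> \<zeta> \<in> Sym n" using \<sigma> \<tau> True by (auto simp: V_sections_def)
      have "(\<lambda>y. 1 * \<sigma> \<zeta> y + (- 1) * \<tau> \<zeta> y) = (\<lambda>_. 0)"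
        by (rule Sym_vanishing[OF Sym_linear[OF P] lm(1) r(1,2)]) (use r(3) in simp)
      then show ?thesis by (simp add: fun_eq_iff)
    next
      case False then show ?thesis using \<sigma> \<tau> by (simp add: V_sections_def)
    qed
  qed
qed

text \<open>Since the osculating form at a point is unique, \<open>\<sigma>\<close> is defined
  globally by a definite description and no gluing is required. Locally it coincides with a family
  from \<open>osculating_family\<close>, which brings holomorphy and, through the common remainder,
  the congruence of \<open>f\<close> and \<open>\<sigma>\<close>.\<close>

lemma jet_of_surj:
  assumes U: "openin X_top U" and q: "q \<in> Jet n n U"
  shows "q \<in> jet_of n n U ` V_sections n U"
proof -
  let ?F = "LL_sections 0 (int n)" and ?G = "vanishing_sections (n + 1) (int n)"
  define \<sigma> where "\<sigma> = (\<lambda>\<zeta>. if \<zeta> \<in> U then THE P. osculates n q \<zeta> P else (\<lambda>y. 0))"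
  have q': "q \<in> quotient_sections XX_top ?F ?G (U \<times> X)" using q by (simp add: Jet_def)
  have UX: "U \<subseteq> X" by (rule openin_X_subset[OF U])
  have \<sigma>_eq: "\<sigma> \<zeta> = P" if "osculates n q \<zeta> P" "\<zeta> \<in> U" for \<zeta> P
    using that UX osculates_unique[of n q \<zeta> _ P] unfolding \<sigma>_def by (auto intro!: the_equality)
  have fam: "\<exists>r T h. 0 < r \<and> (\<forall>z\<in>ball z0 r. line (pencil l m z) \<in> U \<and> T z \<in> Sym n \<and> \<sigma> (line (pencil l m z)) = T z) \<and>
      (\<forall>y\<in>dual. (\<lambda>z. T z y) holomorphic_on ball z0 r) \<and> holomorphic2_on h (ball z0 r \<times> ball z0 r) \<and>
      (\<forall>z\<in>ball z0 r. \<forall>w\<in>ball z0 r.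
         f (pencil l m z, pencil l m w) - T z (pencil l m w) = (z - w) ^ Suc n * h (z, w))"
    if N: "openin XX_top N" "N \<subseteq> U \<times> X" and f: "f \<in> ?F N"
      and rep: "\<And>p. p \<in> N \<Longrightarrow> q p = stalk_class XX_top ?F ?G p f"
      and lm: "frame l m" and z0: "(line (pencil l m z0), line (pencil l m z0)) \<in> N" for N f l m z0
  proof -
    obtain r T h where r: "0 < r"
      and T: "\<forall>z\<in>ball z0 r. (line (pencil l m z), line (pencil l m z)) \<in> N \<and> T z \<in> Sym n \<and>
         (\<forall>l'\<in>cone (line (pencil l m z)). vanishes_at (Suc n) l' (\<lambda>y. f (l', y) - T z y))"
      and Th: "\<forall>y\<in>dual. (\<lambda>z. T z y) holomorphic_on ball z0 r"
      and h: "holomorphic2_on h (ball z0 r \<times> ball z0 r)"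
      and eq: "\<forall>z\<in>ball z0 r. \<forall>w\<in>ball z0 r.
         f (pencil l m z, pencil l m w) - T z (pencil l m w) = (z - w) ^ Suc n * h (z, w)"
      using osculating_family[OF f N(1) lm z0] by blast
    have "line (pencil l m z) \<in> U \<and> T z \<in> Sym n \<and> \<sigma> (line (pencil l m z)) = T z" if z: "z \<in> ball z0 r" for z
    proof -
      have zN: "(line (pencil l m z), line (pencil l m z)) \<in> N" using T z by blast
      then have zU: "line (pencil l m z) \<in> U" using N(2) by blast
      have "osculates n q (line (pencil l m z)) (T z)"
        unfolding osculates_def
        by (rule conjI, use T z in blast, rule exI[of _ N], rule exI[of _ f])
          (use N(1) zN f rep[OF zN] T z in blast)
      then show ?thesis using \<sigma>_eq zU T z by blast
    qed
    then show ?thesis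
      using r Th h eq by (intro exI[of _ r] exI[of _ T] exI[of _ h] conjI) auto
  qed
  have loc: "\<exists>r T. 0 < r \<and> (\<forall>z\<in>ball z0 r. T z \<in> Sym n \<and> \<sigma> (line (pencil l m z)) = T z) \<and>
      (\<forall>y\<in>dual. (\<lambda>z. T z y) holomorphic_on ball z0 r)"
    if lm: "frame l m" and z0: "line (pencil l m z0) \<in> U" for l m z0
  proof -
    have p: "(line (pencil l m z0), line (pencil l m z0)) \<in> U \<times> X" using z0 UX by blast
    obtain N f where N: "openin XX_top N" "(line (pencil l m z0), line (pencil l m z0)) \<in> N" "N \<subseteq> U \<times> X"
      "f \<in> ?F N" "\<And>p. p \<in> N \<Longrightarrow> q p = stalk_class XX_top ?F ?G p f"
      using jets.quotient_sectionsD[OF q' p] by blast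
    show ?thesis using fam[OF N(1,3,4,5) lm N(2)] by blast
  qed
  have \<sigma>V: "\<sigma> \<in> V_sections n U"
    unfolding V_sections_def
  proof (intro CollectI conjI ballI allI impI)
    fix \<xi> assume \<xi>: "\<xi> \<in> U"
    then obtain l m where lm: "frame l m" "line l = \<xi>" using UX X_obtain_frame[of \<xi>] by blast
    then have "line (pencil l m 0) \<in> U" using \<xi> by (simp add: pencil_0)
    from loc[OF lm(1) this] obtain r T where rT: "0 < r"
      "\<forall>z\<in>ball 0 r. T z \<in> Sym n \<and> \<sigma> (line (pencil l m z)) = T z" by blast
    then have "(0::complex) \<in> ball 0 r" by simp
    then have "\<sigma> (line (pencil l m 0)) \<in> Sym n" using rT(2) by metis
    then show "\<sigma> \<xi> \<in> Sym n" using lm(2) by (simp add: pencil_0)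
  next
    fix \<xi> assume "\<xi> \<notin> U" then show "\<sigma> \<xi> = (\<lambda>y. 0)" by (simp add: \<sigma>_def)
  next
    fix l m y assume lm: "frame l m" and y: "y \<in> dual"
    show "(\<lambda>z. \<sigma> (line (pencil l m z)) y) holomorphic_on {z. line (pencil l m z) \<in> U}"
    proof (rule holomorphic_on_locally)
      fix z0 assume "z0 \<in> {z. line (pencil l m z) \<in> U}"
      then have "line (pencil l m z0) \<in> U" by simp
      from loc[OF lm this] obtain r T where rT: "0 < r"
        "\<forall>z\<in>ball z0 r. T z \<in> Sym n \<and> \<sigma> (line (pencil l m z)) = T z"
        "\<forall>y\<in>dual. (\<lambda>z. T z y) holomorphic_on ball z0 r" by blast
      have "(\<lambda>z. T z y) holomorphic_on ball z0 r" using rT(3) y by blast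
      then have "(\<lambda>z. \<sigma> (line (pencil l m z)) y) holomorphic_on ball z0 r"
        by (rule holomorphic_transform) (use rT(2) in auto)
      then show "\<exists>r>0. (\<lambda>z. \<sigma> (line (pencil l m z)) y) holomorphic_on ball z0 r" using rT(1) by blast
    qed
  qed
  note \<sigma>L = V_sections_in_LL[OF U \<sigma>V]
  have "jet_of n n U \<sigma> = q"
  proof
    fix p
    show "jet_of n n U \<sigma> p = q p"
    proof (cases "p \<in> U \<times> X")
      case False
      then show ?thesis using jets.quotient_sections_outside[OF q' False] by (simp add: jet_of_def)
    next
      case True
      obtain N f where N: "openin XX_top N" "p \<in> N" "N \<subseteq> U \<times> X"
        "f \<in> ?F N" "\<And>p. p \<in> N \<Longrightarrow> q p = stalk_class XX_top ?F ?G p f"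
        using jets.quotient_sectionsD[OF q' True] by blast
      let ?\<sigma> = "\<lambda>(l, y). \<sigma> (line l) y"
      have \<sigma>N: "?\<sigma> \<in> ?F N" by (rule LL_restrict[OF \<sigma>L N(3)])
      \<comment> \<open>The test for the subsheaf takes place at the diagonal points of
        \<open>N\<close>, which also settles points \<open>p\<close> off the diagonal.\<close>
      have "(\<lambda>y. f y - ?\<sigma> y) \<in> ?G N"
        unfolding vanishing_sections_def
      proof (intro CollectI conjI allI impI)
        show "(\<lambda>y. f y - ?\<sigma> y) \<in> ?F N" by (rule LL_diff[OF N(4) \<sigma>N])
        fix l m z0 assume lm: "frame l m" and z0: "(line (pencil l m z0), line (pencil l m z0)) \<in> N"
        obtain r T h where r: "0 < r"
          and T: "\<forall>z\<in>ball z0 r. line (pencil l m z) \<in> U \<and> T z \<in> Sym n \<and> \<sigma> (line (pencil l m z)) = T z"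
          and h: "holomorphic2_on h (ball z0 r \<times> ball z0 r)"
          and eq: "\<forall>z\<in>ball z0 r. \<forall>w\<in>ball z0 r.
             f (pencil l m z, pencil l m w) - T z (pencil l m w) = (z - w) ^ Suc n * h (z, w)"
          using fam[OF N(1,3,4,5) lm z0] by blast
        show "\<exists>S h. open S \<and> (z0, z0) \<in> S \<and> holomorphic2_on h S \<and>
          (\<forall>(z, w)\<in>S. f (pencil l m z, pencil l m w) - ?\<sigma> (pencil l m z, pencil l m w) = (z - w) ^ (n + 1) * h (z, w))"
        proof (rule exI[of _ "ball z0 r \<times> ball z0 r"], rule exI[of _ h], intro conjI ballI)
          show "open (ball z0 r \<times> ball z0 r)" by (intro open_Times open_ball)
          show "(z0, z0) \<in> ball z0 r \<times> ball z0 r" using r by simp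
          show "holomorphic2_on h (ball z0 r \<times> ball z0 r)" by (rule h)
          fix p assume "p \<in> ball z0 r \<times> ball z0 r"
          then obtain z w where p: "p = (z, w)" and z: "z \<in> ball z0 r" and w: "w \<in> ball z0 r" by blast
          have "\<sigma> (line (pencil l m z)) = T z" using T z by blast
          then show "case p of (z, w) \<Rightarrow> f (pencil l m z, pencil l m w) -
             ?\<sigma> (pencil l m z, pencil l m w) = (z - w) ^ (n + 1) * h (z, w)"
            using eq z w p by simp
        qed
      qed
      from jets.stalk_class_eqI[OF N(1,2,4) \<sigma>N this] N(5)[OF N(2)] True
      show ?thesis by (simp add: jet_of_def)
    qed
  qed
  then show ?thesis using \<sigma>V by blast
qed

lemma jet_iso_n_V_sections:
  assumes U: "openin X_top U" and q: "q \<in> Jet n n U"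
  shows "jet_iso_n n U q \<in> V_sections n U"
  unfolding jet_iso_n_def
  by (rule the_inv_into_into[OF inj_on_jet_of[OF U] jet_of_surj[OF U q] subset_refl])

end

section \<open>Residues on the projective line\<close>

text \<open>The extra factor is the derivative of the Moebius map, so this is the invariance of the
  residue of a form under a change of parameter. A small circle and its image both wind once around
  0, and integration along them computes the two residues.\<close>

lemma residue_compose_moebius:
  fixes c \<alpha> \<beta> :: complex
  assumes F: "F holomorphic_on B - {0}" and B: "open B" "0 \<in> B" and nz: "c \<noteq> 0" "\<beta> \<noteq> 0"
  shows "residue (\<lambda>w. F (w * \<beta> / (c + w * \<alpha>)) * (c * \<beta> / (c + w * \<alpha>) ^ 2)) 0 = residue F 0"
proof -
  define \<phi> where "\<phi> = (\<lambda>w. w * \<beta> / (c + w * \<alpha>))"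
  define \<phi>' where "\<phi>' = (\<lambda>w. c * \<beta> / (c + w * \<alpha>) ^ 2)"
  obtain R where R: "0 < R" "ball 0 R \<subseteq> B" using B unfolding open_contains_ball by blast
  have "open (ball (0::complex) R)" "0 \<in> ball (0::complex) R" using R by auto
  from chart_change_ball[OF nz(1) this]
  obtain r where r: "0 < r" and b: "\<forall>w\<in>ball 0 r. c + w * \<alpha> \<noteq> 0 \<and> \<phi> w \<in> ball 0 R"
    unfolding \<phi>_def by blast
  have d: "(\<phi> has_field_derivative \<phi>' w) (at w)" if "w \<in> ball 0 r" for w
  proof -
    have n: "c + w * \<alpha> \<noteq> 0" using b that by blast
    have "(\<phi> has_field_derivative (\<beta> * (c + w * \<alpha>) - w * \<beta> * \<alpha>) / ((c + w * \<alpha>) * (c + w * \<alpha>))) (at w)"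
      unfolding \<phi>_def using n by (auto intro!: derivative_eq_intros)
    also have "(\<beta> * (c + w * \<alpha>) - w * \<beta> * \<alpha>) / ((c + w * \<alpha>) * (c + w * \<alpha>)) = \<phi>' w"
      by (simp add: \<phi>'_def power2_eq_square algebra_simps)
    finally show ?thesis .
  qed
  have \<phi>h: "\<phi> holomorphic_on ball 0 r"
    unfolding \<phi>_def using b by (intro holomorphic_intros) auto
  have \<phi>'h: "\<phi>' holomorphic_on ball 0 r"
    unfolding \<phi>'_def using b by (intro holomorphic_intros) auto
  have \<phi>0: "\<phi> w = 0 \<longleftrightarrow> w = 0" if "w \<in> ball 0 r" for w
    using b that nz(2) by (auto simp: \<phi>_def)
  define \<gamma> where "\<gamma> = circlepath 0 (r/2)"
  have \<gamma>i: "path_image \<gamma> \<subseteq> ball 0 r - {0}" using r by (auto simp: \<gamma>_def)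
  have \<phi>a: "\<phi> analytic_on ball 0 r" using \<phi>h by (simp add: analytic_on_open)
  have \<phi>i: "path_image (\<phi> \<circ> \<gamma>) \<subseteq> ball 0 R - {0}"
  proof
    fix z assume "z \<in> path_image (\<phi> \<circ> \<gamma>)"
    then obtain w where w: "w \<in> path_image \<gamma>" "z = \<phi> w" unfolding path_image_compose by blast
    then have w': "w \<in> ball 0 r" "w \<noteq> 0" using \<gamma>i by auto
    have "\<phi> w \<in> ball 0 R" using b w'(1) by blast
    then show "z \<in> ball 0 R - {0}" using \<phi>0[OF w'(1)] w'(2) w(2) by simp
  qed
  have vp: "valid_path (\<phi> \<circ> \<gamma>)"
    by (rule valid_path_compose_analytic[OF _ \<phi>a]) (use \<gamma>i in \<open>auto simp: \<gamma>_def\<close>)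
  have comp: "contour_integral (\<phi> \<circ> \<gamma>) g = contour_integral \<gamma> (\<lambda>w. \<phi>' w * g (\<phi> w))" for g
  proof -
    have "contour_integral (\<phi> \<circ> \<gamma>) g = contour_integral \<gamma> (\<lambda>w. deriv \<phi> w * g (\<phi> w))"
      by (rule contour_integral_comp_analyticW[OF \<phi>a]) (use \<gamma>i in \<open>auto simp: \<gamma>_def\<close>)
    also have "\<dots> = contour_integral \<gamma> (\<lambda>w. \<phi>' w * g (\<phi> w))"
      by (rule contour_integral_cong) (use \<gamma>i DERIV_imp_deriv[OF d] in auto)
    finally show ?thesis .
  qed
  have wn: "winding_number (\<phi> \<circ> \<gamma>) 0 = 1"
  proof -
    have "winding_number (\<phi> \<circ> \<gamma>) 0 = 1 / (2 * pi * \<i>) * contour_integral (\<phi> \<circ> \<gamma>) (\<lambda>w. 1 / (w - 0))"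
      by (rule winding_number_valid_path[OF vp]) (use \<phi>i in auto)
    also have "contour_integral (\<phi> \<circ> \<gamma>) (\<lambda>w. 1 / (w - 0)) = contour_integral \<gamma> (\<lambda>w. \<phi>' w * (1 / (\<phi> w - 0)))"
      by (rule comp)
    \<comment> \<open>The logarithmic derivative of the parameter change is
      \<open>c / (c + w * \<alpha>)\<close> divided by \<open>w\<close>. Cauchy's formula evaluates
      the numerator at 0, where it equals 1.\<close>
    also have "\<dots> = contour_integral \<gamma> (\<lambda>w. (c / (c + w * \<alpha>)) / (w - 0))"
    proof (rule contour_integral_cong)
      fix w assume "w \<in> path_image \<gamma>"
      then have w: "w \<in> ball 0 r" "w \<noteq> 0" using \<gamma>i by auto
      then have "c + w * \<alpha> \<noteq> 0" using b by blast
      then show "\<phi>' w * (1 / (\<phi> w - 0)) = c / (c + w * \<alpha>) / (w - 0)"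
        using w nz by (simp add: \<phi>_def \<phi>'_def power2_eq_square)
    qed simp
    also have "\<dots> = 2 * of_real pi * \<i> * (c / (c + 0 * \<alpha>))"
    proof (rule contour_integral_unique)
      show "((\<lambda>w. (c / (c + w * \<alpha>)) / (w - 0)) has_contour_integral 2 * of_real pi * \<i> * (c / (c + 0 * \<alpha>))) \<gamma>"
        unfolding \<gamma>_def
      proof (rule Cauchy_integral_circlepath_simple)
        show "(\<lambda>w. c / (c + w * \<alpha>)) holomorphic_on cball 0 (r/2)"
          using b r by (intro holomorphic_intros) auto
      qed (use r in simp)
    qed
    finally show ?thesis by (rule trans) (use nz in simp)
  qed
  have "contour_integral (\<phi> \<circ> \<gamma>) F = 2 * pi * \<i> * (\<Sum>p\<in>{0}. winding_number (\<phi> \<circ> \<gamma>) p * residue F p)"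
  proof (rule Residue_theorem[of "ball 0 R"])
    show "F holomorphic_on ball 0 R - {0}" using F by (rule holomorphic_on_subset) (use R in auto)
    show "pathfinish (\<phi> \<circ> \<gamma>) = pathstart (\<phi> \<circ> \<gamma>)"
      by (simp add: pathfinish_compose pathstart_compose \<gamma>_def)
    show "\<forall>z. z \<notin> ball 0 R \<longrightarrow> winding_number (\<phi> \<circ> \<gamma>) z = 0"
      using \<phi>i vp by (intro allI impI winding_number_zero_outside[of _ "ball 0 R"])
        (auto simp: valid_path_imp_path pathfinish_compose pathstart_compose \<gamma>_def)
  qed (use vp \<phi>i in auto)
  then have 1: "contour_integral \<gamma> (\<lambda>w. \<phi>' w * F (\<phi> w)) = 2 * pi * \<i> * residue F 0"
    by (simp add: comp wn)
  have "(F \<circ> \<phi>) holomorphic_on ball 0 r - {0}"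
  proof (rule holomorphic_on_compose_gen)
    show "\<phi> holomorphic_on ball 0 r - {0}" using \<phi>h by (rule holomorphic_on_subset) auto
    show "F holomorphic_on ball 0 R - {0}" using F by (rule holomorphic_on_subset) (use R in auto)
    show "\<phi> ` (ball 0 r - {0}) \<subseteq> ball 0 R - {0}"
    proof
      fix z assume "z \<in> \<phi> ` (ball 0 r - {0})"
      then obtain w where w: "w \<in> ball 0 r" "w \<noteq> 0" "z = \<phi> w" by blast
      have "\<phi> w \<in> ball 0 R" using b w(1) by blast
      then show "z \<in> ball 0 R - {0}" using \<phi>0[OF w(1)] w(2,3) by simp
    qed
  qed
  then have "(\<lambda>w. F (\<phi> w) * \<phi>' w) holomorphic_on ball 0 r - {0}"
    using holomorphic_on_subset[OF \<phi>'h, of "ball 0 r - {0}"] unfolding o_def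
    by (intro holomorphic_on_mult) auto
  then have "((\<lambda>w. F (\<phi> w) * \<phi>' w) has_contour_integral
      2 * pi * \<i> * residue (\<lambda>w. F (\<phi> w) * \<phi>' w) 0) \<gamma>"
    unfolding \<gamma>_def by (intro base_residue[of "ball 0 r"]) (use r in auto)
  then have 2: "contour_integral \<gamma> (\<lambda>w. \<phi>' w * F (\<phi> w)) = 2 * pi * \<i> * residue (\<lambda>w. F (\<phi> w) * \<phi>' w) 0"
    by (simp add: contour_integral_unique mult.commute)
  have "residue (\<lambda>w. F (\<phi> w) * \<phi>' w) 0 = residue F 0" using 1 2 by simp
  then show ?thesis by (simp add: \<phi>_def \<phi>'_def)
qed

text \<open>There is no residue at infinity: the integral over a circle of radius \<open>R\<close>
  is at most \<open>2 * pi * C / R\<close>, while it no longer depends on \<open>R\<close> once all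
  poles are enclosed.\<close>

lemma sum_residues_decaying:
  assumes Z: "finite Z" and F: "F holomorphic_on UNIV - Z"
    and R0: "\<And>z. R0 \<le> norm z \<Longrightarrow> norm (F z) \<le> C / norm z ^ 2" and C: "0 \<le> C"
  shows "(\<Sum>z\<in>Z. residue F z) = 0"
proof (rule ccontr)
  define S where "S = 2 * pi * \<i> * (\<Sum>z\<in>Z. residue F z)"
  assume "(\<Sum>z\<in>Z. residue F z) \<noteq> 0"
  then have S: "0 < norm S" by (simp add: S_def norm_mult)
  obtain b where b: "\<And>z. z \<in> Z \<Longrightarrow> norm z \<le> b"
    using finite_imp_bounded[OF Z] unfolding bounded_iff by blast
  \<comment> \<open>\<open>R\<close> encloses every pole, reaches the range of the decay bound, and
    exceeds \<open>2 * pi * C / norm S\<close>, beyond which the integral is too small to be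
    \<open>S\<close>. The summands 1 make the inequalities strict.\<close>
  define R where "R = max (max 1 R0) (max (b + 1) (2 * pi * C / norm S + 1))"
  have R: "1 \<le> R" "R0 \<le> R" "b < R" "2 * pi * C / norm S < R"
    unfolding R_def by (auto simp: less_max_iff_disj)
  have Rp: "0 < R" using R(1) by linarith
  have inR: "norm z < R" if "z \<in> Z" for z using b[OF that] R(3) by linarith
  have "contour_integral (circlepath 0 R) F =
      2 * pi * \<i> * (\<Sum>z\<in>Z. winding_number (circlepath 0 R) z * residue F z)"
    by (rule Residue_theorem[of UNIV]) (use Z F Rp in \<open>auto dest: inR\<close>)
  also have "(\<Sum>z\<in>Z. winding_number (circlepath 0 R) z * residue F z) = (\<Sum>z\<in>Z. residue F z)"
    using inR by (intro sum.cong) (auto simp: winding_number_circlepath)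
  finally have ci: "contour_integral (circlepath 0 R) F = S" by (simp add: S_def)
  have "continuous_on (path_image (circlepath 0 R)) F"
    using F by (rule continuous_on_subset[OF holomorphic_on_imp_continuous_on]) (use Rp in \<open>auto dest: inR\<close>)
  then have "F contour_integrable_on circlepath 0 R"
    by (rule contour_integrable_continuous_circlepath)
  then have "(F has_contour_integral S) (circlepath 0 R)"
    using ci has_contour_integral_integral by fastforce
  then have "norm S \<le> C / R ^ 2 * (2 * pi * R)"
  proof (rule has_contour_integral_bound_circlepath)
    show "0 \<le> C / R ^ 2" using C by simp
    show "norm (F x) \<le> C / R ^ 2" if "norm (x - 0) = R" for x
      using R0[of x] that R(2) by simp
  qed (rule Rp)
  also have "\<dots> = 2 * pi * C / R" using Rp by (simp add: power2_eq_square)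
  finally have "norm S * R \<le> 2 * pi * C" using Rp by (simp add: field_simps)
  moreover have "2 * pi * C < norm S * R" using R(4) S by (simp add: field_simps)
  ultimately show False by linarith
qed

context oriented_plane begin

text \<open>The frame chosen inside \<open>residue_at\<close> depends on \<open>\<xi>\<close> alone,
  so one frame serves all functions \<open>f\<close>, and linearity can be read off in it.\<close>

lemma residue_at_frame:
  assumes "\<xi> \<in> X"
  obtains l m where "frame l m" "line l = \<xi>" "\<And>f. residue_at \<xi> f = residue (\<lambda>w. f (pencil l m w) * \<omega> l m) 0"
proof -
  have "\<exists>p. case p of (l, m) \<Rightarrow> l \<in> cone \<xi> \<and> frame l m" using X_obtain_frame[OF assms] by blast
  from someI_ex[OF this] obtain l m where lm: "(SOME (l, m). l \<in> cone \<xi> \<and> frame l m) = (l, m)"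
    "l \<in> cone \<xi>" "frame l m" by (metis (no_types, lifting) case_prodE)
  have "line l = \<xi>" using lm(2) by (simp add: cone_def)
  with lm(3) that show ?thesis unfolding residue_at_def lm(1) by simp
qed

lemma chart_punctured:
  assumes "frame l m" "line l = \<xi>"
  shows "{z. line (pencil l m z) \<in> N - {\<xi>}} = {z. line (pencil l m z) \<in> N} - {0}"
  using line_pencil_eq_iff[OF assms(1), of _ 0] assms(2) by (auto simp: pencil_0)

lemma residue_at_cong:
  assumes \<xi>: "\<xi> \<in> N" and N: "openin X_top N"
    and eq: "\<And>\<zeta> y. \<zeta> \<in> N - {\<xi>} \<Longrightarrow> y \<in> cone \<zeta> \<Longrightarrow> f y = g y"
  shows "residue_at \<xi> f = residue_at \<xi> g"
proof -
  have \<xi>X: "\<xi> \<in> X" using \<xi> openin_X_subset[OF N] by blast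
  obtain l m where lm: "frame l m" "line l = \<xi>"
    and res: "\<And>f. residue_at \<xi> f = residue (\<lambda>w. f (pencil l m w) * \<omega> l m) 0"
    using residue_at_frame[OF \<xi>X] by blast
  have "eventually (\<lambda>w. w \<in> {z. line (pencil l m z) \<in> N} - {0}) (at 0)"
    by (rule eventually_at_in_open[OF open_chart[OF N lm(1)]]) (use \<xi> lm(2) in \<open>simp add: pencil_0\<close>)
  then have "eventually (\<lambda>w. f (pencil l m w) * \<omega> l m = g (pencil l m w) * \<omega> l m) (at 0)"
  proof (rule eventually_mono)
    fix w assume "w \<in> {z. line (pencil l m z) \<in> N} - {0}"
    then have "line (pencil l m w) \<in> N - {\<xi>}" using chart_punctured[OF lm, of N] by blast
    from eq[OF this pencil_in_cone[OF lm(1)]]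
    show "f (pencil l m w) * \<omega> l m = g (pencil l m w) * \<omega> l m" by simp
  qed
  then show ?thesis unfolding res by (rule residue_cong) simp
qed

text \<open>Homogeneity of degree -2 contributes \<open>1 / (c + w * \<alpha>)^2\<close> and the
  change of \<open>\<omega> l m\<close> contributes \<open>c * \<beta>\<close>. Their product is the
  derivative of the parameter change, so the residue is the same in every frame centred at
  \<open>\<xi>\<close>.\<close>

lemma residue_at_eq:
  assumes lm: "frame l m" "line l = \<xi>" and N: "openin X_top N" "\<xi> \<in> N"
    and f: "f \<in> L_sections (-2) (N - {\<xi>})"
  shows "residue_at \<xi> f = residue (\<lambda>w. f (pencil l m w) * \<omega> l m) 0"
proof -
  have \<xi>X: "\<xi> \<in> X" using N openin_X_subset[OF N(1)] by blast
  obtain l2 m2 where lm2: "frame l2 m2" "line l2 = \<xi>"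
    and res: "\<And>f. residue_at \<xi> f = residue (\<lambda>w. f (pencil l2 m2 w) * \<omega> l2 m2) 0"
    using residue_at_frame[OF \<xi>X] by blast
  define B where "B = {z. line (pencil l m z) \<in> N}"
  have B: "open B" "0 \<in> B" using open_chart[OF N(1) lm(1)] N(2) lm(2) by (auto simp: B_def pencil_0)
  define F where "F = (\<lambda>z. f (pencil l m z) * \<omega> l m)"
  have F: "F holomorphic_on B - {0}"
    unfolding F_def B_def using L_holomorphic[OF f lm(1)] chart_punctured[OF lm, of N]
    by (intro holomorphic_intros) simp
  have "line l = line l2" using lm(2) lm2(2) by simp
  from chart_change[OF lm(1) lm2(1) this]
  obtain c \<alpha> \<beta> where cc: "c \<noteq> 0" "\<beta> \<noteq> 0" "\<omega> l2 m2 = c * \<beta> * \<omega> l m"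
    and pen: "\<forall>w. c + w * \<alpha> \<noteq> 0 \<longrightarrow> pencil l2 m2 w = (\<lambda>v. (c + w * \<alpha>) * pencil l m (w * \<beta> / (c + w * \<alpha>)) v)"
    by blast
  obtain r where r: "0 < r" "\<forall>w\<in>ball 0 r. c + w * \<alpha> \<noteq> 0 \<and> w * \<beta> / (c + w * \<alpha>) \<in> B"
    using chart_change_ball[OF cc(1) B, of \<alpha> \<beta>] by blast
  have "eventually (\<lambda>w. w \<in> ball 0 r - {0}) (at (0::complex))"
    by (rule eventually_at_in_open) (use r in auto)
  then have "eventually (\<lambda>w. f (pencil l2 m2 w) * \<omega> l2 m2 =
      F (w * \<beta> / (c + w * \<alpha>)) * (c * \<beta> / (c + w * \<alpha>) ^ 2)) (at 0)"
  proof (rule eventually_mono)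
    fix w :: complex assume w: "w \<in> ball 0 r - {0}"
    define z where "z = w * \<beta> / (c + w * \<alpha>)"
    have n: "c + w * \<alpha> \<noteq> 0" and zB: "z \<in> B" using r(2) w by (auto simp: z_def)
    have "z \<noteq> 0" using w n cc by (simp add: z_def)
    then have z: "line (pencil l m z) \<in> N - {\<xi>}" using zB chart_punctured[OF lm, of N] by (auto simp: B_def)
    have "f (pencil l2 m2 w) = f (\<lambda>v. (c + w * \<alpha>) * pencil l m z v)" using pen n by (simp add: z_def)
    also have "\<dots> = (c + w * \<alpha>) powi (-2) * f (pencil l m z)"
      by (rule L_homogeneous[OF f z pencil_in_cone[OF lm(1)] n])
    finally have "f (pencil l2 m2 w) = f (pencil l m z) / (c + w * \<alpha>) ^ 2"
      by (simp add: power_int_minus field_simps)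
    then show "f (pencil l2 m2 w) * \<omega> l2 m2 = F (w * \<beta> / (c + w * \<alpha>)) * (c * \<beta> / (c + w * \<alpha>) ^ 2)"
      by (simp add: z_def[symmetric] F_def cc(3))
  qed
  then have "residue_at \<xi> f = residue (\<lambda>w. F (w * \<beta> / (c + w * \<alpha>)) * (c * \<beta> / (c + w * \<alpha>) ^ 2)) 0"
    unfolding res by (rule residue_cong) simp
  also have "\<dots> = residue F 0" by (rule residue_compose_moebius[OF F B cc(1,2)])
  finally show ?thesis by (simp add: F_def)
qed

lemma residue_at_linear:
  assumes N: "openin X_top N" "\<xi> \<in> N"
    and f: "f \<in> L_sections (-2) (N - {\<xi>})" and g: "g \<in> L_sections (-2) (N - {\<xi>})"
  shows "residue_at \<xi> (\<lambda>y. a * f y + b * g y) = a * residue_at \<xi> f + b * residue_at \<xi> g"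
proof -
  have \<xi>X: "\<xi> \<in> X" using N openin_X_subset[OF N(1)] by blast
  obtain l m where lm: "frame l m" "line l = \<xi>"
    and res: "\<And>f. residue_at \<xi> f = residue (\<lambda>w. f (pencil l m w) * \<omega> l m) 0"
    using residue_at_frame[OF \<xi>X] by blast
  define B where "B = {z. line (pencil l m z) \<in> N}"
  have B: "open B" "0 \<in> B" using open_chart[OF N(1) lm(1)] N(2) lm(2) by (auto simp: B_def pencil_0)
  define F where "F = (\<lambda>z. f (pencil l m z) * \<omega> l m)"
  define G where "G = (\<lambda>z. g (pencil l m z) * \<omega> l m)"
  have F: "F holomorphic_on B - {0}" and G: "G holomorphic_on B - {0}"
    unfolding F_def G_def B_def using L_holomorphic[OF f lm(1)] L_holomorphic[OF g lm(1)] chart_punctured[OF lm, of N]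
    by (auto intro!: holomorphic_intros)
  have "residue (\<lambda>z. a * F z + b * G z) 0 = residue (\<lambda>z. a * F z) 0 + residue (\<lambda>z. b * G z) 0"
    by (rule residue_add[OF B]) (intro holomorphic_intros F G)+
  also have "\<dots> = a * residue F 0 + b * residue G 0"
    using residue_lmul[OF B F, of a] residue_lmul[OF B G, of b] by simp
  finally show ?thesis unfolding res F_def G_def by (simp add: algebra_simps)
qed

lemma residue_at_holomorphic:
  assumes N: "openin X_top N" "\<xi> \<in> N" and f: "f \<in> L_sections (-2) N"
  shows "residue_at \<xi> f = 0"
proof -
  have \<xi>X: "\<xi> \<in> X" using N openin_X_subset[OF N(1)] by blast
  obtain l m where lm: "frame l m" "line l = \<xi>"
    and res: "\<And>f. residue_at \<xi> f = residue (\<lambda>w. f (pencil l m w) * \<omega> l m) 0"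
    using residue_at_frame[OF \<xi>X] by blast
  have "0 \<in> {z. line (pencil l m z) \<in> N}" using N(2) lm(2) by (simp add: pencil_0)
  then show ?thesis unfolding res
    by (rule residue_holo[OF open_chart[OF N(1) lm(1)]]) (intro holomorphic_intros L_holomorphic[OF f lm(1)])
qed

text \<open>A point outside \<open>D\<close> is taken as the point at infinity, so that all poles
  lie in one affine chart. There the degree -2 forces decay like
  \<open>1 / norm z ^ 2\<close>.\<close>

lemma sum_residue_at:
  assumes D: "finite D" "D \<subseteq> X" and s: "s \<in> L_sections (-2) (X - D)"
  shows "(\<Sum>\<xi>\<in>D. residue_at \<xi> s) = 0"
proof -
  obtain l0 m0 where lm0: "frame l0 m0" using omega_nonzero by (auto simp: frame_iff)
  have "inj (\<lambda>z. line (pencil l0 m0 z))" using line_pencil_eq_iff[OF lm0] by (simp add: inj_def)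
  then have "infinite (range (\<lambda>z. line (pencil l0 m0 z)))"
    using finite_imageD infinite_UNIV_char_0 by blast
  then have "\<not> range (\<lambda>z. line (pencil l0 m0 z)) \<subseteq> D" using D(1) finite_subset by blast
  then obtain \<eta> where \<eta>: "\<eta> \<in> X" "\<eta> \<notin> D" using line_pencil_in_X[OF lm0] by blast
  obtain m l where ml: "frame m l" "line m = \<eta>" using X_obtain_frame[OF \<eta>(1)] by blast
  have lm: "frame l m" by (rule frame_swap[OF ml(1)])
  note ld = frameD[OF lm]
  define Z where "Z = {z. line (pencil l m z) \<in> D}"
  have inj: "inj (\<lambda>z. line (pencil l m z))" using line_pencil_eq_iff[OF lm] by (simp add: inj_def)
  have Z: "finite Z" using finite_vimageI[OF D(1) inj] by (simp add: Z_def vimage_def)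
  have DZ: "D = (\<lambda>z. line (pencil l m z)) ` Z"
  proof
    show "D \<subseteq> (\<lambda>z. line (pencil l m z)) ` Z"
    proof
      fix \<xi> assume \<xi>: "\<xi> \<in> D"
      then have \<xi>X: "\<xi> \<in> X" using D(2) by blast
      obtain y where y: "y \<in> dual" "y \<noteq> (\<lambda>_. 0)" "line y = \<xi>" using X_obtain_line[OF \<xi>X] by blast
      have "line y \<noteq> line m" using y(3) ml(2) \<eta>(2) \<xi> by auto
      then have ym: "\<omega> y m \<noteq> 0" using line_eq_iff[OF y(1,2) ld(2) frame_nonzero(2)[OF lm]] by blast
      define z where "z = \<omega> l y / \<omega> y m"
      have c: "\<omega> y m / \<omega> l m \<noteq> 0" using ym ld(3) by simp
      have "y = (\<lambda>v. (\<omega> y m / \<omega> l m) * pencil l m z v)"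
        unfolding z_def by (rule pencil_expand[OF lm y(1) ym])
      then have "y \<in> cone (line (pencil l m z))"
        using cone_scale[OF pencil_in_cone[OF lm, of z] c] by simp
      then have "line (pencil l m z) = \<xi>" using y(3) by (simp add: cone_def)
      then show "\<xi> \<in> (\<lambda>z. line (pencil l m z)) ` Z" using \<xi> by (auto simp: Z_def)
    qed
  qed (auto simp: Z_def)
  define F where "F = (\<lambda>z. s (pencil l m z) * \<omega> l m)"
  have "{z. line (pencil l m z) \<in> X - D} = UNIV - Z" using line_pencil_in_X[OF lm] by (auto simp: Z_def)
  then have F: "F holomorphic_on UNIV - Z"
    unfolding F_def using L_holomorphic[OF s lm] by (intro holomorphic_intros) simp
  have res: "residue_at (line (pencil l m z)) s = residue F z" if z: "z \<in> Z" for z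
  proof -
    let ?\<xi> = "line (pencil l m z)"
    have N: "openin X_top (X - (D - {?\<xi>}))" using D(1) by (intro openin_diff_finite openin_X) auto
    have s': "s \<in> L_sections (-2) (X - (D - {?\<xi>}) - {?\<xi>})"
      by (rule L_sections_restrict[OF s]) auto
    have "residue_at ?\<xi> s = residue (\<lambda>w. s (pencil (pencil l m z) m w) * \<omega> (pencil l m z) m) 0"
      by (rule residue_at_eq[OF frame_pencil[OF lm] refl N _ s']) (simp add: line_pencil_in_X[OF lm])
    also have "\<dots> = residue (\<lambda>w. F (z + w)) 0"
      using ld by (simp add: pencil_pencil F_def omega_pencils)
    also have "\<dots> = residue F z" by (rule residue_shift_0[symmetric])
    finally show ?thesis .
  qed
  have "(\<Sum>\<xi>\<in>D. residue_at \<xi> s) = (\<Sum>z\<in>Z. residue_at (line (pencil l m z)) s)"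
    unfolding DZ using sum.reindex[OF inj_on_subset[OF inj subset_UNIV], of "\<lambda>\<xi>. residue_at \<xi> s" Z]
    by (simp add: o_def)
  also have "\<dots> = (\<Sum>z\<in>Z. residue F z)" using res by (rule sum.cong[OF refl])
  also have "\<dots> = 0"
  proof -
    have "open {u. line (pencil m l u) \<in> X - D}"
      by (rule open_chart[OF openin_diff_finite[OF openin_X D(1)] ml(1)])
    moreover have "0 \<in> {u. line (pencil m l u) \<in> X - D}" using \<eta> ml(2) by (simp add: pencil_0)
    ultimately obtain r where r: "0 < r" "cball 0 r \<subseteq> {u. line (pencil m l u) \<in> X - D}"
      unfolding open_contains_cball by blast
    have "continuous_on (cball 0 r) (\<lambda>u. s (pencil m l u))"
      using holomorphic_on_imp_continuous_on[OF L_holomorphic[OF s ml(1)]] r(2) by (rule continuous_on_subset)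
    then have "compact ((\<lambda>u. s (pencil m l u)) ` cball 0 r)" by (intro compact_continuous_image compact_cball)
    then have "bounded ((\<lambda>u. s (pencil m l u)) ` cball 0 r)" by (rule compact_imp_bounded)
    then obtain M where M: "\<And>u. u \<in> cball 0 r \<Longrightarrow> norm (s (pencil m l u)) \<le> M"
      unfolding bounded_iff by blast
    have M0: "0 \<le> M" using M[of 0] r(1) norm_ge_zero order_trans by (metis centre_in_cball less_imp_le)
    show ?thesis
    proof (rule sum_residues_decaying[OF Z F])
      show "0 \<le> M * norm (\<omega> l m)" using M0 by simp
      fix z :: complex assume z: "1 / r \<le> norm z"
      have zp: "0 < norm z" using z r(1) by (meson divide_pos_pos less_le_trans zero_less_one)
      then have z0: "z \<noteq> 0" by auto
      have u: "1 / z \<in> cball 0 r" using z r(1) zp by (simp add: norm_divide field_simps)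
      \<comment> \<open>\<open>1 / z\<close> is the parameter of the chart centred at the point at
        infinity, where \<open>s\<close> is bounded; the scaling factor \<open>z\<close> leaves
        \<open>s\<close> with the exponent -2.\<close>
      have "pencil l m z = (\<lambda>v. z * pencil m l (1 / z) v)"
        using z0 by (auto simp: pencil_def algebra_simps)
      then have "s (pencil l m z) = z powi (-2) * s (pencil m l (1 / z))"
        using L_homogeneous[OF s _ pencil_in_cone[OF ml(1)] z0, of "1 / z"] r(2) u by auto
      then have "F z = s (pencil m l (1 / z)) * \<omega> l m / z ^ 2"
        unfolding F_def by (simp add: power_int_minus divide_inverse mult_ac)
      then have "norm (F z) = norm (s (pencil m l (1 / z))) * norm (\<omega> l m) / norm z ^ 2"
        by (simp add: norm_mult norm_divide norm_power)
      also have "\<dots> \<le> M * norm (\<omega> l m) / norm z ^ 2"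
        using M[OF u] by (intro divide_right_mono mult_right_mono) auto
      finally show "norm (F z) \<le> M * norm (\<omega> l m) / norm z ^ 2" .
    qed
  qed
  finally show ?thesis .
qed

text \<open>Because the local forms agree on overlaps away from \<open>D\<close>, evaluating at
  \<open>y\<close> the one that belongs to \<open>line y\<close> gives a single form off
  \<open>D\<close>, and each local residue is a residue of it.\<close>

lemma sum_residue_at_glued:
  assumes D: "finite D" "D \<subseteq> X"
    and V: "\<And>\<eta>. \<eta> \<in> X \<Longrightarrow> openin X_top (V \<eta>) \<and> \<eta> \<in> V \<eta>"
    and \<nu>: "\<And>\<eta>. \<eta> \<in> X \<Longrightarrow> \<nu> \<eta> \<in> L_sections (-2) (V \<eta> - D)"
    and agree: "\<And>\<eta> \<eta>'. \<eta> \<in> X \<Longrightarrow> \<eta>' \<in> X \<Longrightarrow> agree_on cone (V \<eta> \<inter> V \<eta>' - D) (\<nu> \<eta>) (\<nu> \<eta>')"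
  shows "(\<Sum>\<xi>\<in>D. residue_at \<xi> (\<nu> \<xi>)) = 0"
proof -
  define s where "s = (\<lambda>y. \<nu> (line y) y)"
  have sv: "s y = \<nu> \<eta> y" if "\<eta> \<in> X" "\<zeta> \<in> V \<eta> - D" "y \<in> cone \<zeta>" for \<eta> \<zeta> y
  proof -
    have \<zeta>: "\<zeta> \<in> X" using that V openin_X_subset by blast
    have "line y = \<zeta>" using that(3) by (simp add: cone_def)
    moreover have "\<nu> \<zeta> y = \<nu> \<eta> y"
      using agree[OF \<zeta> that(1)] V[OF \<zeta>] that(2,3) unfolding agree_on_def by blast
    ultimately show ?thesis by (simp add: s_def)
  qed
  have "s \<in> L_sections (-2) (X - D)"
    unfolding L_sections_def
  proof (intro CollectI conjI ballI allI impI)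
    fix \<xi> l and c :: complex assume \<xi>: "\<xi> \<in> X - D" and l: "l \<in> cone \<xi>" and c: "c \<noteq> 0"
    have \<xi>V: "\<xi> \<in> V \<xi> - D" using \<xi> V by blast
    have "\<xi> \<in> X" using \<xi> by blast
    have "s (\<lambda>v. c * l v) = \<nu> \<xi> (\<lambda>v. c * l v)" by (rule sv[OF \<open>\<xi> \<in> X\<close> \<xi>V cone_scale[OF l c]])
    also have "\<dots> = c powi (-2) * \<nu> \<xi> l" by (rule L_homogeneous[OF \<nu>[OF \<open>\<xi> \<in> X\<close>] \<xi>V l c])
    also have "\<nu> \<xi> l = s l" by (rule sv[OF \<open>\<xi> \<in> X\<close> \<xi>V l, symmetric])
    finally show "s (\<lambda>v. c * l v) = c powi (-2) * s l" .
  next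
    fix l m assume lm: "frame l m"
    show "(\<lambda>z. s (pencil l m z)) holomorphic_on {z. line (pencil l m z) \<in> X - D}"
    proof (rule holomorphic_on_locally)
      fix z0 assume "z0 \<in> {z. line (pencil l m z) \<in> X - D}"
      then have \<zeta>: "line (pencil l m z0) \<in> X" "line (pencil l m z0) \<notin> D" by auto
      let ?V = "V (line (pencil l m z0)) - D"
      have "open {z. line (pencil l m z) \<in> ?V}"
        using V[OF \<zeta>(1)] by (intro open_chart openin_diff_finite D lm) auto
      moreover have "z0 \<in> {z. line (pencil l m z) \<in> ?V}" using V[OF \<zeta>(1)] \<zeta>(2) by auto
      ultimately obtain r where r: "0 < r" "ball z0 r \<subseteq> {z. line (pencil l m z) \<in> ?V}"
        unfolding open_contains_ball by blast
      have "(\<lambda>z. \<nu> (line (pencil l m z0)) (pencil l m z)) holomorphic_on ball z0 r"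
        using L_holomorphic[OF \<nu>[OF \<zeta>(1)] lm] r(2) by (rule holomorphic_on_subset)
      then have "(\<lambda>z. s (pencil l m z)) holomorphic_on ball z0 r"
      proof (rule holomorphic_transform)
        fix z assume "z \<in> ball z0 r"
        then have "line (pencil l m z) \<in> ?V" using r(2) by blast
        from sv[OF \<zeta>(1) this pencil_in_cone[OF lm]]
        show "\<nu> (line (pencil l m z0)) (pencil l m z) = s (pencil l m z)" ..
      qed
      then show "\<exists>r>0. (\<lambda>z. s (pencil l m z)) holomorphic_on ball z0 r" using r(1) by blast
    qed
  qed
  from sum_residue_at[OF D this] have "(\<Sum>\<xi>\<in>D. residue_at \<xi> s) = 0" .
  moreover have "residue_at \<xi> s = residue_at \<xi> (\<nu> \<xi>)" if \<xi>: "\<xi> \<in> D" for \<xi>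
  proof -
    have \<xi>X: "\<xi> \<in> X" using \<xi> D(2) by blast
    show ?thesis
    proof (rule residue_at_cong[of _ "V \<xi> - (D - {\<xi>})"])
      show "\<xi> \<in> V \<xi> - (D - {\<xi>})" using V[OF \<xi>X] by blast
      show "openin X_top (V \<xi> - (D - {\<xi>}))" using V[OF \<xi>X] D(1) by (intro openin_diff_finite) auto
      fix \<zeta> y assume "\<zeta> \<in> V \<xi> - (D - {\<xi>}) - {\<xi>}" "y \<in> cone \<zeta>"
      then show "s y = \<nu> \<xi> y" by (intro sv[OF \<xi>X, of \<zeta>]) auto
    qed
  qed
  ultimately show ?thesis by simp
qed

section \<open>Residues of quotients by powers of the equation of the diagonal\<close>

lemma quotient_in_L_sections:
  assumes f: "f \<in> LL_sections 0 b N" and N: "openin XX_top N" and l: "l \<in> dual" "l \<noteq> (\<lambda>_. 0)"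
    and P: "P \<in> Sym j" and deg: "int j + (b - int k) = d"
  shows "(\<lambda>y. P y * (f (l, y) / \<omega> l y ^ k)) \<in> L_sections d ({\<eta>. (line l, \<eta>) \<in> N} - {line l})"
proof -
  let ?N = "{\<eta>. (line l, \<eta>) \<in> N} - {line l}"
  have 1: "(\<lambda>y. f (l, y)) \<in> L_sections b ?N"
    by (rule L_sections_restrict[OF LL_slice[OF f N l]]) auto
  have 2: "(\<lambda>y. 1 / \<omega> l y ^ k) \<in> L_sections (- int k) ?N"
    by (rule L_sections_inverse_omega[OF l]) (use openin_X_subset[OF openin_slice[OF N]] in auto)
  have "(\<lambda>y. P y * (f (l, y) * (1 / \<omega> l y ^ k))) \<in> L_sections (int j + (b + - int k)) ?N"
    by (intro L_sections_mult Sym_in_L_sections[OF P] 1 2)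
  then show ?thesis using deg by simp
qed

text \<open>The zero of order \<open>k\<close> cancels the pole of
  \<open>1 / \<omega> l y ^ k\<close>, so the form is regular at \<open>line l\<close>. This is why
  the residue depends on the jet and not on the function chosen to represent it.\<close>

lemma residue_at_vanishing:
  assumes h: "h \<in> vanishing_sections k b N" and N: "openin XX_top N" "(line l, line l) \<in> N"
    and l: "l \<in> dual" "l \<noteq> (\<lambda>_. 0)" and P: "P \<in> Sym j" and deg: "int j + (b - int k) = - 2"
  shows "residue_at (line l) (\<lambda>y. P y * (h (l, y) / \<omega> l y ^ k)) = 0"
proof -
  obtain m where lm: "frame l m" using exists_frame[OF l] by blast
  note ld = frameD[OF lm]
  obtain r H where r: "0 < r" "H holomorphic_on ball 0 r" "\<forall>w\<in>ball 0 r. h (l, pencil l m w) = w ^ k * H w"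
    using slice_vanishing[OF h lm N(2)] by blast
  have "residue_at (line l) (\<lambda>y. P y * (h (l, y) / \<omega> l y ^ k)) =
      residue (\<lambda>w. P (pencil l m w) * (h (l, pencil l m w) / \<omega> l (pencil l m w) ^ k) * \<omega> l m) 0"
    by (rule residue_at_eq[OF lm refl openin_slice[OF N(1)] _ quotient_in_L_sections[OF vanishing_in_LL[OF h] N(1) l P deg]])
      (use N(2) in simp)
  also have "\<dots> = residue (\<lambda>w. P (pencil l m w) * (H w / \<omega> l m ^ k) * \<omega> l m) 0"
  proof (rule residue_cong)
    have "eventually (\<lambda>w. w \<in> ball 0 r - {0}) (at (0::complex))"
      by (rule eventually_at_in_open) (use r in auto)
    then show "eventually (\<lambda>w. P (pencil l m w) * (h (l, pencil l m w) / \<omega> l (pencil l m w) ^ k) * \<omega> l m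
        = P (pencil l m w) * (H w / \<omega> l m ^ k) * \<omega> l m) (at 0)"
    proof (rule eventually_mono)
      fix w :: complex assume w: "w \<in> ball 0 r - {0}"
      then have "h (l, pencil l m w) = w ^ k * H w" using r(3) by blast
      then show "P (pencil l m w) * (h (l, pencil l m w) / \<omega> l (pencil l m w) ^ k) * \<omega> l m
        = P (pencil l m w) * (H w / \<omega> l m ^ k) * \<omega> l m"
        using w ld by (simp add: omega_pencils power_mult_distrib)
    qed
  qed simp
  also have "\<dots> = 0"
  proof (rule residue_holo)
    have "(\<lambda>w. P (pencil l m w)) holomorphic_on {w. line (pencil l m w) \<in> X}"
      by (rule L_holomorphic[OF Sym_in_L_sections[OF P] lm])
    then have "(\<lambda>w. P (pencil l m w)) holomorphic_on ball 0 r"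
      by (rule holomorphic_on_subset) (use line_pencil_in_X[OF lm] in auto)
    then show "(\<lambda>w. P (pencil l m w) * (H w / \<omega> l m ^ k) * \<omega> l m) holomorphic_on ball 0 r"
      using r(2) ld(3) by (intro holomorphic_intros) auto
  qed (use r in auto)
  finally show ?thesis .
qed

end

section \<open>The trace of the connecting homomorphism\<close>

lemma cohomologous_refl:
  assumes "\<And>p. p \<in> N \<Longrightarrow> openin T (W p) \<and> p \<in> W p" and "\<And>N. (\<lambda>y. 0) \<in> G N"
  shows "cohomologous T C G N (W, g) (W, g)"
  unfolding cohomologous.simps
  by (rule exI[of _ W], rule exI[of _ "\<lambda>_ _. 0"]) (use assms in \<open>auto simp: agree_on_def\<close>)

context subsheaf begin

lemma exists_representatives:
  assumes "q \<in> quotient_sections T F G N"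
  shows "\<exists>W f. \<forall>p\<in>N. openin T (W p) \<and> p \<in> W p \<and> W p \<subseteq> N \<and> f p \<in> F (W p) \<and>
    (\<forall>p'\<in>W p. q p' = stalk_class T F G p' (f p))"
proof -
  have "\<forall>p\<in>N. \<exists>x. openin T (fst x) \<and> p \<in> fst x \<and> fst x \<subseteq> N \<and> snd x \<in> F (fst x) \<and>
    (\<forall>p'\<in>fst x. q p' = stalk_class T F G p' (snd x))"
  proof
    fix p assume p: "p \<in> N"
    obtain N' f where "openin T N'" "p \<in> N'" "N' \<subseteq> N" "f \<in> F N'"
      "\<And>p'. p' \<in> N' \<Longrightarrow> q p' = stalk_class T F G p' f"
      using quotient_sectionsD[OF assms p] by blast
    then show "\<exists>x. openin T (fst x) \<and> p \<in> fst x \<and> fst x \<subseteq> N \<and> snd x \<in> F (fst x) \<and>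
      (\<forall>p'\<in>fst x. q p' = stalk_class T F G p' (snd x))"
      by (intro exI[of _ "(N', f)"]) simp
  qed
  from bchoice[OF this] obtain x where x: "\<forall>p\<in>N. openin T (fst (x p)) \<and> p \<in> fst (x p) \<and>
    fst (x p) \<subseteq> N \<and> snd (x p) \<in> F (fst (x p)) \<and>
    (\<forall>p'\<in>fst (x p). q p' = stalk_class T F G p' (snd (x p)))" by blast
  show ?thesis by (rule exI[of _ "\<lambda>p. fst (x p)"], rule exI[of _ "\<lambda>p. snd (x p)"]) (rule x)
qed

text \<open>On an overlap both lifts have the same class at every point, so their difference lies
  locally in \<open>G\<close>, and then in \<open>G\<close> by \<open>G_local\<close>.\<close>

lemma representatives_cocycle:
  assumes rep: "\<And>p. p \<in> N \<Longrightarrow> openin T (W p) \<and> p \<in> W p \<and> W p \<subseteq> N \<and> f p \<in> F (W p) \<and>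
    (\<forall>p'\<in>W p. q p' = stalk_class T F G p' (f p))"
  shows "(W, \<lambda>p p' y. f p' y - f p y) \<in> cocycles T C G N"
  unfolding cocycles_def mem_Collect_eq prod.case
proof (intro conjI ballI)
  fix p p' assume p: "p \<in> N" and p': "p' \<in> N"
  show "(\<lambda>y. f p' y - f p y) \<in> G (W p \<inter> W p')"
  proof (rule G_local)
    have fp: "f p \<in> F (W p \<inter> W p')" "f p' \<in> F (W p \<inter> W p')"
      using rep[OF p] rep[OF p'] by (auto intro: F_restrict)
    then show "(\<lambda>y. f p' y - f p y) \<in> F (W p \<inter> W p')" by (intro F_diff)
    fix p'' assume p'': "p'' \<in> W p \<inter> W p'"
    have "stalk_class T F G p'' (f p') = stalk_class T F G p'' (f p)"
      using rep[OF p] rep[OF p'] p'' by (metis IntD1 IntD2)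
    from stalk_class_eqD[OF _ p'' fp(1) this] rep[OF p] rep[OF p']
    show "\<exists>N'. openin T N' \<and> p'' \<in> N' \<and> (\<lambda>y. f p' y - f p y) \<in> G N'" by blast
  qed
qed (use rep in \<open>auto simp: agree_on_def\<close>)

lemma representatives_connecting_hom:
  assumes rep: "\<And>p. p \<in> N \<Longrightarrow> openin T (W p) \<and> p \<in> W p \<and> W p \<subseteq> N \<and> f p \<in> F (W p) \<and>
    (\<forall>p'\<in>W p. q p' = stalk_class T F G p' (f p))"
  shows "(W, \<lambda>p p' y. f p' y - f p y) \<in> connecting_hom T C F G N q"
proof -
  have "cohomologous T C G N (W, \<lambda>p p' y. f p' y - f p y) (W, \<lambda>p p' y. f p' y - f p y)"
    by (rule cohomologous_refl) (use rep G_zero in auto)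
  then show ?thesis
    unfolding connecting_hom_def using representatives_cocycle[OF rep] rep by blast
qed

end

context oriented_plane begin

lemma LL_cong:
  assumes f: "f \<in> LL_sections a b N" and N: "openin XX_top N" and eq: "agree_on cone2 N f g"
  shows "g \<in> LL_sections a b N"
proof (rule LL_I, goal_cases)
  case (1 \<xi> \<eta> l m c)
  have *: "f (l, m) = g (l, m)" if "l \<in> cone \<xi>" "m \<in> cone \<eta>" for l m
  proof -
    have "(l, m) \<in> cone2 (\<xi>, \<eta>)" using that by (simp add: cone2_def)
    then show ?thesis using eq 1(1) unfolding agree_on_def by blast
  qed
  show ?case using LL_homogeneous[OF f 1] *[OF 1(2,3)] *[OF cone_scale[OF 1(2,4)] 1(3)]
      *[OF 1(2) cone_scale[OF 1(3,4)]] by simp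
next
  case (2 l m l' m')
  show ?case
  proof (rule holomorphic2_on_transform[OF LL_holomorphic2[OF f 2] open_chart2[OF N 2]])
    fix p assume "p \<in> {(z, w). (line (pencil l m z), line (pencil l' m' w)) \<in> N}"
    then obtain z w where p: "p = (z, w)" "(line (pencil l m z), line (pencil l' m' w)) \<in> N" by blast
    have "(pencil l m z, pencil l' m' w) \<in> cone2 (line (pencil l m z), line (pencil l' m' w))"
      using pencil_in_cone 2 by (simp add: cone2_def)
    then have "f (pencil l m z, pencil l' m' w) = g (pencil l m z, pencil l' m' w)"
      using eq p(2) unfolding agree_on_def by blast
    then show "(case p of (z, w) \<Rightarrow> f (pencil l m z, pencil l' m' w)) =
        (case p of (z, w) \<Rightarrow> g (pencil l m z, pencil l' m' w))" by (simp add: p(1))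
  qed
qed

lemma vanishing_off_diagonal:
  assumes f: "f \<in> LL_sections 0 b N" and off: "\<And>\<xi>. (\<xi>, \<xi>) \<notin> N"
  shows "f \<in> vanishing_sections k b N"
  unfolding vanishing_sections_def using f off by blast

lemma omega_nonzero_off_diagonal:
  assumes "(l, y) \<in> cone2 (\<xi>, \<eta>)" "\<xi> \<in> X" "\<eta> \<in> X" "\<xi> \<noteq> \<eta>"
  shows "\<omega> l y \<noteq> 0"
proof -
  have l: "l \<in> cone \<xi>" and y: "y \<in> cone \<eta>" using assms(1) by (auto simp: cone2_def)
  note l' = coneD[OF assms(2) l] and y' = coneD[OF assms(3) y]
  show ?thesis using line_eq_iff[OF l'(1,2) y'(1,2)] l'(3) y'(3) assms(4) by simp
qed

lemma LL_divide_omega: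
  assumes f: "f \<in> LL_sections a b N" and N: "N \<subseteq> X \<times> X" and off: "\<And>\<xi>. (\<xi>, \<xi>) \<notin> N"
  shows "(\<lambda>(l, y). f (l, y) / \<omega> l y ^ k) \<in> LL_sections (a - int k) (b - int k) N"
proof (rule LL_I, goal_cases)
  case (1 \<xi> \<eta> l m c)
  have d: "l \<in> dual" "m \<in> dual" using 1 by (auto simp: cone_def)
  have "c powi (d - int k) = c powi d / c ^ k" for d using 1(4) by (simp add: power_int_diff)
  then show ?case
    using LL_homogeneous[OF f 1] omega_scale_left[OF d, of c] omega_scale_right[OF d, of c]
    by (simp add: power_mult_distrib)
next
  case (2 l m l' m')
  let ?S = "{(z, w). (line (pencil l m z), line (pencil l' m' w)) \<in> N}"
  note d = frameD[OF 2(1)] and d' = frameD[OF 2(2)]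
  have "holomorphic2_on (\<lambda>p. (case p of (z, w) \<Rightarrow> f (pencil l m z, pencil l' m' w)) /
      ((\<omega> l l' + fst p * \<omega> m l') + snd p * (\<omega> l m' + fst p * \<omega> m m')) ^ k) ?S"
  proof (intro holomorphic2_intros LL_holomorphic2[OF f 2])
    fix p assume "p \<in> ?S"
    then obtain z w where p: "p = (z, w)" "(line (pencil l m z), line (pencil l' m' w)) \<in> N" by blast
    have "(pencil l m z, pencil l' m' w) \<in> cone2 (line (pencil l m z), line (pencil l' m' w))"
      using pencil_in_cone 2 by (simp add: cone2_def)
    from omega_nonzero_off_diagonal[OF this line_pencil_in_X[OF 2(1)] line_pencil_in_X[OF 2(2)]] off p(2)
    have "\<omega> (pencil l m z) (pencil l' m' w) \<noteq> 0" by metis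
    then show "((\<omega> l l' + fst p * \<omega> m l') + snd p * (\<omega> l m' + fst p * \<omega> m m')) ^ k \<noteq> 0"
      using d d' by (simp add: p(1) omega_pencil dual_pencil)
  qed
  moreover have "(\<lambda>p. (case p of (z, w) \<Rightarrow> f (pencil l m z, pencil l' m' w)) /
      ((\<omega> l l' + fst p * \<omega> m l') + snd p * (\<omega> l m' + fst p * \<omega> m m')) ^ k) =
      (\<lambda>(z, w). case (pencil l m z, pencil l' m' w) of (l, y) \<Rightarrow> f (l, y) / \<omega> l y ^ k)"
    using d d' by (auto simp: fun_eq_iff omega_pencil dual_pencil)
  ultimately show ?case by simp
qed

text \<open>Supplies the meromorphy that \<open>H1_trace\<close> demands of a Mittag-Leffler
  distribution: numerator and denominator are holomorphic at the pole.\<close>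

lemma not_essential_quotient:
  assumes f: "f \<in> LL_sections 0 b N" and N: "openin XX_top N" "(line l, line l) \<in> N"
    and l: "l \<in> dual" "l \<noteq> (\<lambda>_. 0)" and P: "P \<in> Sym j" and fr: "frame l' m'" "line l' = line l"
  shows "not_essential (\<lambda>w. P (pencil l' m' w) * (f (l, pencil l' m' w) / \<omega> l (pencil l' m' w) ^ k)) 0"
proof -
  define B where "B = {w. line (pencil l' m' w) \<in> {\<eta>. (line l, \<eta>) \<in> N}}"
  have B: "open B" "0 \<in> B"
    using open_chart[OF openin_slice[OF N(1), of "line l"] fr(1)] N(2) fr(2) by (auto simp: B_def pencil_0)
  have 1: "(\<lambda>w. f (l, pencil l' m' w)) holomorphic_on B"
    using L_holomorphic[OF LL_slice[OF f N(1) l] fr(1)] unfolding B_def by simp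
  have 2: "(\<lambda>w. P (pencil l' m' w)) holomorphic_on B"
    using L_holomorphic[OF Sym_in_L_sections[OF P] fr(1)] unfolding B_def by blast
  have 3: "(\<lambda>w. \<omega> l (pencil l' m' w) ^ k) holomorphic_on B"
  proof -
    have "(\<lambda>w. (\<omega> l l' + w * \<omega> l m') ^ k) holomorphic_on B" by (intro holomorphic_intros)
    then show ?thesis using l frameD[OF fr(1)] by (simp add: omega_pencil)
  qed
  have an: "g analytic_on {0}" if "g holomorphic_on B" for g
    using that B by (meson analytic_on_holomorphic empty_subsetI insert_subset)
  have "not_essential (\<lambda>w. P (pencil l' m' w) * f (l, pencil l' m' w) / \<omega> l (pencil l' m' w) ^ k) 0"
    by (intro not_essential_divide not_essential_analytic isolated_singularity_at_analytic an
        holomorphic_on_mult 1 2 3)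
  then show ?thesis by simp
qed

text \<open>The uniqueness half of the definite description in \<open>H1_trace\<close>. An arbitrary
  cocycle of the product class is linked to local representatives of \<open>q\<close> by four
  coboundaries. \<open>h1\<close> and \<open>h2\<close> vanish to order \<open>k + 1\<close> on the
  diagonal and are absorbed into the representatives; \<open>h3\<close> and \<open>h4\<close> are
  regular on the fibre. The corrected distribution glues to one form on \<open>X\<close>, whose
  residues add up to zero.\<close>

lemma trace_unique:
  assumes kn: "n < k" and q: "q \<in> Jet k n U" and U: "openin X_top U" and l: "l \<in> dual" "line l \<in> U"
    and N0: "openin XX_top N0" "(line l, line l) \<in> N0" and f0: "f0 \<in> LL_sections 0 (int n) N0"
    and q0: "q (line l, line l) = jet_stalk k n (line l, line l) f0"
    and P: "P \<in> Sym (k - n - 1)"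
    and c: "(W4, g4) \<in> H1_product (fibre_class (int n - int (k + 1))
        (untwist (k + 1) (int n) (jet_connecting k n U q)) l) P"
    and D: "finite D" "D \<subseteq> X"
    and \<mu>: "\<And>\<eta>. \<eta> \<in> X \<Longrightarrow> \<mu> \<eta> \<in> L_sections (-2) (W4 \<eta> - D)"
    and \<mu>g: "\<And>\<xi> \<eta>. \<xi> \<in> X \<Longrightarrow> \<eta> \<in> X \<Longrightarrow>
        agree_on cone (W4 \<xi> \<inter> W4 \<eta> - D) (g4 \<xi> \<eta>) (\<lambda>y. \<mu> \<eta> y - \<mu> \<xi> y)"
  shows "(\<Sum>\<xi>\<in>D. residue_at \<xi> (\<mu> \<xi>)) =
    residue_at (line l) (\<lambda>y. P y * (f0 (l, y) / \<omega> l y ^ (k + 1)))"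
proof -
  let ?\<xi> = "line l" and ?K = "k + 1" and ?F = "LL_sections 0 (int n)"
    and ?G = "vanishing_sections (k + 1) (int n)" and ?b = "int n - int (k + 1)"
  have \<xi>X: "?\<xi> \<in> X" using l openin_X_subset[OF U] by blast
  have l\<xi>: "l \<in> cone ?\<xi>" using l by (simp add: cone_def)
  have l0: "l \<noteq> (\<lambda>_. 0)" by (rule coneD(2)[OF \<xi>X l\<xi>])
  have deg: "int (k - n - 1) + ?b = - 2" using kn by (simp add: of_nat_diff)
  from c obtain W3 g3 where c3: "(W3, g3) \<in> fibre_class ?b (untwist ?K (int n) (jet_connecting k n U q)) l"
    and co4: "cohomologous X_top cone (L_sections (-2)) X (W3, \<lambda>\<xi> \<eta> y. g3 \<xi> \<eta> y * P y) (W4, g4)"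
    unfolding H1_product_def by blast
  from c3 obtain U2 c2 where c2: "(U2, c2) \<in> untwist ?K (int n) (jet_connecting k n U q) ?\<xi>"
    and co3': "cohomologous X_top cone (L_sections ?b) X (fibre_cochain l c2) (W3, g3)"
    unfolding fibre_class_def by blast
  obtain W2 g2 where c2eq: "c2 = (W2, g2)" by (cases c2)
  note co3 = co3'[unfolded c2eq fibre_cochain.simps]
  have "(U2, (W2, \<lambda>p p' (l, y). \<omega> l y ^ ?K * g2 p p' (l, y))) \<in> jet_connecting k n U q ?\<xi>"
    using c2 unfolding untwist_def c2eq by blast
  then obtain c1 where c1: "c1 \<in> connecting_hom XX_top cone2 ?F ?G (U \<times> X) q"
    and germ: "(U2, (W2, \<lambda>p p' (l, y). \<omega> l y ^ ?K * g2 p p' (l, y))) \<in> direct_image_germ ?G U c1 ?\<xi>"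
    unfolding jet_connecting_def using l(2) by auto
  obtain W1 g1 where c1eq: "c1 = (W1, g1)" by (cases c1)
  from germ obtain U'' where U'': "openin X_top U''" "?\<xi> \<in> U''" "U'' \<subseteq> U \<inter> U2"
    and co2: "cohomologous XX_top cone2 ?G (U'' \<times> X)
       (restrict_cochain (U'' \<times> X) (W1, g1))
       (restrict_cochain (U'' \<times> X) (W2, \<lambda>p p' (l, y). \<omega> l y ^ ?K * g2 p p' (l, y)))"
    unfolding direct_image_germ_def c1eq by blast
  note co2' = co2[unfolded restrict_cochain.simps]
  from c1 obtain W0 fr where rep: "\<forall>p\<in>U \<times> X. openin XX_top (W0 p) \<and> p \<in> W0 p \<and> W0 p \<subseteq> U \<times> X \<and>
      fr p \<in> ?F (W0 p) \<and> (\<forall>p'\<in>W0 p. q p' = stalk_class XX_top ?F ?G p' (fr p))"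
    and co1: "cohomologous XX_top cone2 ?G (U \<times> X) (W0, \<lambda>p p' y. fr p' y - fr p y) (W1, g1)"
    unfolding connecting_hom_def c1eq by blast
  from co1 obtain V1 h1 where V1: "\<forall>p\<in>U \<times> X. openin XX_top (V1 p) \<and> p \<in> V1 p \<and> V1 p \<subseteq> W0 p \<inter> W1 p \<and> h1 p \<in> ?G (V1 p)"
    and a1: "\<forall>p\<in>U \<times> X. \<forall>p'\<in>U \<times> X. agree_on cone2 (V1 p \<inter> V1 p')
       (\<lambda>y. g1 p p' y - (fr p' y - fr p y)) (\<lambda>y. h1 p' y - h1 p y)"
    unfolding cohomologous.simps by blast
  from co2' obtain V2 h2 where V2: "\<forall>p\<in>U'' \<times> X. openin XX_top (V2 p) \<and> p \<in> V2 p \<and>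
      V2 p \<subseteq> (W1 p \<inter> U'' \<times> X) \<inter> (W2 p \<inter> U'' \<times> X) \<and> h2 p \<in> ?G (V2 p)"
    and a2: "\<forall>p\<in>U'' \<times> X. \<forall>p'\<in>U'' \<times> X. agree_on cone2 (V2 p \<inter> V2 p')
       (\<lambda>y. (case y of (l, y) \<Rightarrow> \<omega> l y ^ ?K * g2 p p' (l, y)) - g1 p p' y) (\<lambda>y. h2 p' y - h2 p y)"
    unfolding cohomologous.simps by blast
  from co3 obtain V3 h3 where V3: "\<forall>p\<in>X. openin X_top (V3 p) \<and> p \<in> V3 p \<and>
      V3 p \<subseteq> {\<eta>'. (?\<xi>, \<eta>') \<in> W2 (?\<xi>, p)} \<inter> W3 p \<and> h3 p \<in> L_sections ?b (V3 p)"
    and a3: "\<forall>p\<in>X. \<forall>p'\<in>X. agree_on cone (V3 p \<inter> V3 p')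
       (\<lambda>y. g3 p p' y - g2 (?\<xi>, p) (?\<xi>, p') (l, y)) (\<lambda>y. h3 p' y - h3 p y)"
    unfolding cohomologous.simps by blast
  from co4 obtain V4 h4 where V4: "\<forall>p\<in>X. openin X_top (V4 p) \<and> p \<in> V4 p \<and> V4 p \<subseteq> W3 p \<inter> W4 p \<and> h4 p \<in> L_sections (-2) (V4 p)"
    and a4: "\<forall>p\<in>X. \<forall>p'\<in>X. agree_on cone (V4 p \<inter> V4 p')
       (\<lambda>y. g4 p p' y - g3 p p' y * P y) (\<lambda>y. h4 p' y - h4 p y)"
    unfolding cohomologous.simps by blast
  have pU: "(?\<xi>, \<eta>) \<in> U \<times> X" "(?\<xi>, \<eta>) \<in> U'' \<times> X" if "\<eta> \<in> X" for \<eta> using that l(2) U''(2) by auto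
  define M where "M = (\<lambda>\<eta>. V1 (?\<xi>, \<eta>) \<inter> V2 (?\<xi>, \<eta>))"
  \<comment> \<open>Adding \<open>h1\<close> and \<open>h2\<close> keeps the class modulo the
    subsheaf, and it makes \<open>\<omega> l y ^ (k + 1)\<close> times \<open>g2\<close> exactly the
    coboundary of \<open>e\<close> on the fibre.\<close>
  define e where "e = (\<lambda>\<eta> y. fr (?\<xi>, \<eta>) y + (h1 (?\<xi>, \<eta>) y + h2 (?\<xi>, \<eta>) y))"
  have M: "openin XX_top (M \<eta>)" "(?\<xi>, \<eta>) \<in> M \<eta>" if "\<eta> \<in> X" for \<eta>
    using V1 V2 pU[OF that] unfolding M_def by (auto intro: openin_Int)
  have hs: "h1 (?\<xi>, \<eta>) \<in> ?G (M \<eta>)" "h2 (?\<xi>, \<eta>) \<in> ?G (M \<eta>)" "fr (?\<xi>, \<eta>) \<in> ?F (M \<eta>)" if "\<eta> \<in> X" for \<eta>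
  proof -
    have "h1 (?\<xi>, \<eta>) \<in> ?G (V1 (?\<xi>, \<eta>))" "V1 (?\<xi>, \<eta>) \<subseteq> W0 (?\<xi>, \<eta>)" using V1 pU(1)[OF that] by auto
    moreover have "h2 (?\<xi>, \<eta>) \<in> ?G (V2 (?\<xi>, \<eta>))" using V2 pU(2)[OF that] by auto
    moreover have "fr (?\<xi>, \<eta>) \<in> ?F (W0 (?\<xi>, \<eta>))" using rep pU(1)[OF that] by blast
    ultimately show "h1 (?\<xi>, \<eta>) \<in> ?G (M \<eta>)" "h2 (?\<xi>, \<eta>) \<in> ?G (M \<eta>)" "fr (?\<xi>, \<eta>) \<in> ?F (M \<eta>)"
      unfolding M_def by (auto intro: vanishing_restrict LL_restrict)
  qed
  have Gadd: "(\<lambda>y. f y + g y) \<in> ?G N" if fg: "f \<in> ?G N" "g \<in> ?G N" for f g N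
    using vanishing_diff[OF fg(1) vanishing_diff[OF vanishing_zero fg(2)]] by simp
  have Fadd: "(\<lambda>y. f y + g y) \<in> ?F N" if fg: "f \<in> ?F N" "g \<in> ?F N" for f g N
    using LL_diff[OF fg(1) LL_diff[OF LL_zero fg(2)]] by simp
  have eF: "e \<eta> \<in> ?F (M \<eta>)" if "\<eta> \<in> X" for \<eta>
    unfolding e_def using hs[OF that] by (intro Fadd) (auto dest: vanishing_in_LL)
  define V where "V = (\<lambda>\<eta>. V4 \<eta> \<inter> V3 \<eta> \<inter> {\<eta>'. (?\<xi>, \<eta>') \<in> M \<eta>})"
  have V: "openin X_top (V \<eta>) \<and> \<eta> \<in> V \<eta>" if "\<eta> \<in> X" for \<eta>
  proof -
    have "openin X_top (V4 \<eta>) \<and> \<eta> \<in> V4 \<eta>" "openin X_top (V3 \<eta>) \<and> \<eta> \<in> V3 \<eta>"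
      using bspec[OF V4 that] bspec[OF V3 that] by blast+
    then show ?thesis unfolding V_def
      using M(2)[OF that] openin_slice[OF M(1)[OF that], of ?\<xi>] by (auto intro!: openin_Int)
  qed
  have VW4: "V \<eta> \<subseteq> W4 \<eta>" if "\<eta> \<in> X" for \<eta> using V4 that unfolding V_def by blast
  define E where "E = (\<lambda>\<eta> y. P y * (e \<eta> (l, y) / \<omega> l y ^ ?K))"
  \<comment> \<open>The regular corrections: \<open>h3\<close>, brought to degree -2 by
    \<open>P\<close>, and \<open>h4\<close>. They have no poles and hence no residues.\<close>
  define A where "A = (\<lambda>\<eta> y. h3 \<eta> y * P y + h4 \<eta> y)"
  have EL: "E \<eta> \<in> L_sections (-2) (V \<eta> - {?\<xi>})" if "\<eta> \<in> X" for \<eta>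
    unfolding E_def
    by (rule L_sections_restrict[OF quotient_in_L_sections[OF eF[OF that] M(1)[OF that] l(1) l0 P deg]])
      (auto simp: V_def)
  have AL: "A \<eta> \<in> L_sections (-2) (V \<eta>)" if "\<eta> \<in> X" for \<eta>
  proof -
    have "h3 \<eta> \<in> L_sections ?b (V \<eta>)" "h4 \<eta> \<in> L_sections (-2) (V \<eta>)"
      using V3 V4 that unfolding V_def by (auto intro: L_sections_restrict)
    moreover have "?b + int (k - n - 1) = - 2" using deg by simp
    ultimately show ?thesis unfolding A_def
      using L_sections_mult[OF _ Sym_in_L_sections[OF P], of "h3 \<eta>" ?b "V \<eta>"]
      by (intro L_sections_add) auto
  qed
  \<comment> \<open>\<open>E\<close> may have a pole at \<open>line l\<close>, a point that
    \<open>D\<close> may fail to contain.\<close>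
  define D' where "D' = insert ?\<xi> D"
  have D': "finite D'" "D' \<subseteq> X" "D \<subseteq> D'" "?\<xi> \<in> D'" using D \<xi>X by (auto simp: D'_def)
  define \<nu> where "\<nu> = (\<lambda>\<eta> y. (\<mu> \<eta> y - E \<eta> y) - A \<eta> y)"
  have "(\<Sum>\<zeta>\<in>D'. residue_at \<zeta> (\<nu> \<zeta>)) = 0"
  proof (rule sum_residue_at_glued[OF D'(1,2) V])
    show "\<nu> \<eta> \<in> L_sections (-2) (V \<eta> - D')" if \<eta>: "\<eta> \<in> X" for \<eta>
      unfolding \<nu>_def
    proof (intro L_sections_diff)
      show "\<mu> \<eta> \<in> L_sections (-2) (V \<eta> - D')"
        by (rule L_sections_restrict[OF \<mu>[OF \<eta>]]) (use VW4[OF \<eta>] D'(3) in blast)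
      show "E \<eta> \<in> L_sections (-2) (V \<eta> - D')"
        by (rule L_sections_restrict[OF EL[OF \<eta>]]) (use D'(4) in blast)
      show "A \<eta> \<in> L_sections (-2) (V \<eta> - D')"
        by (rule L_sections_restrict[OF AL[OF \<eta>]]) blast
    qed
    show "agree_on cone (V \<eta> \<inter> V \<eta>' - D') (\<nu> \<eta>) (\<nu> \<eta>')" if \<eta>: "\<eta> \<in> X" and \<eta>': "\<eta>' \<in> X" for \<eta> \<eta>'
      unfolding agree_on_def
    proof (intro ballI)
      fix \<zeta> y assume \<zeta>: "\<zeta> \<in> V \<eta> \<inter> V \<eta>' - D'" and y: "y \<in> cone \<zeta>"
      have \<zeta>X: "\<zeta> \<in> X" using \<zeta> V[OF \<eta>] openin_X_subset by blast
      have ly: "(l, y) \<in> cone2 (?\<xi>, \<zeta>)" using y l\<xi> by (simp add: cone2_def)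
      have "?\<xi> \<noteq> \<zeta>" using \<zeta> D'(4) by blast
      then have om: "\<omega> l y ^ ?K \<noteq> 0" using omega_nonzero_off_diagonal[OF ly \<xi>X \<zeta>X] by simp
      have in4: "\<zeta> \<in> W4 \<eta> \<inter> W4 \<eta>' - D" using \<zeta> VW4[OF \<eta>] VW4[OF \<eta>'] D'(3) by blast
      have in3: "\<zeta> \<in> V4 \<eta> \<inter> V4 \<eta>'" "\<zeta> \<in> V3 \<eta> \<inter> V3 \<eta>'" using \<zeta> unfolding V_def by auto
      have in1: "(?\<xi>, \<zeta>) \<in> V1 (?\<xi>, \<eta>) \<inter> V1 (?\<xi>, \<eta>')" "(?\<xi>, \<zeta>) \<in> V2 (?\<xi>, \<eta>) \<inter> V2 (?\<xi>, \<eta>')"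
        using \<zeta> unfolding V_def M_def by auto
      have eq5: "g4 \<eta> \<eta>' y = \<mu> \<eta>' y - \<mu> \<eta> y"
        using \<mu>g[OF \<eta> \<eta>'] in4 y unfolding agree_on_def by blast
      have eq4: "g4 \<eta> \<eta>' y - g3 \<eta> \<eta>' y * P y = h4 \<eta>' y - h4 \<eta> y"
        using a4 \<eta> \<eta>' in3(1) y unfolding agree_on_def by blast
      have eq3: "g3 \<eta> \<eta>' y - g2 (?\<xi>, \<eta>) (?\<xi>, \<eta>') (l, y) = h3 \<eta>' y - h3 \<eta> y"
        using a3 \<eta> \<eta>' in3(2) y unfolding agree_on_def by blast
      have "(case (l, y) of (l, y) \<Rightarrow> \<omega> l y ^ ?K * g2 (?\<xi>, \<eta>) (?\<xi>, \<eta>') (l, y)) - g1 (?\<xi>, \<eta>) (?\<xi>, \<eta>') (l, y)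
          = h2 (?\<xi>, \<eta>') (l, y) - h2 (?\<xi>, \<eta>) (l, y)"
        using bspec[OF bspec[OF a2 pU(2)[OF \<eta>]] pU(2)[OF \<eta>']] in1(2) ly unfolding agree_on_def by blast
      then have eq2: "\<omega> l y ^ ?K * g2 (?\<xi>, \<eta>) (?\<xi>, \<eta>') (l, y) - g1 (?\<xi>, \<eta>) (?\<xi>, \<eta>') (l, y)
          = h2 (?\<xi>, \<eta>') (l, y) - h2 (?\<xi>, \<eta>) (l, y)" unfolding prod.case .
      have eq1: "g1 (?\<xi>, \<eta>) (?\<xi>, \<eta>') (l, y) - (fr (?\<xi>, \<eta>') (l, y) - fr (?\<xi>, \<eta>) (l, y))
          = h1 (?\<xi>, \<eta>') (l, y) - h1 (?\<xi>, \<eta>) (l, y)"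
        using bspec[OF bspec[OF a1 pU(1)[OF \<eta>]] pU(1)[OF \<eta>']] in1(1) ly unfolding agree_on_def by blast
      have "\<omega> l y ^ ?K * g2 (?\<xi>, \<eta>) (?\<xi>, \<eta>') (l, y) = e \<eta>' (l, y) - e \<eta> (l, y)"
        using eq1 eq2 unfolding e_def by (simp add: algebra_simps)
      then have "g2 (?\<xi>, \<eta>) (?\<xi>, \<eta>') (l, y) = e \<eta>' (l, y) / \<omega> l y ^ ?K - e \<eta> (l, y) / \<omega> l y ^ ?K"
        using om by (metis diff_divide_distrib nonzero_mult_div_cancel_left)
      then have Pg2: "P y * g2 (?\<xi>, \<eta>) (?\<xi>, \<eta>') (l, y) = E \<eta>' y - E \<eta> y"
        unfolding E_def by (simp only: right_diff_distrib)
      have "g3 \<eta> \<eta>' y = g2 (?\<xi>, \<eta>) (?\<xi>, \<eta>') (l, y) + (h3 \<eta>' y - h3 \<eta> y)"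
        using eq3 by (simp add: algebra_simps)
      then have "g3 \<eta> \<eta>' y * P y = P y * g2 (?\<xi>, \<eta>) (?\<xi>, \<eta>') (l, y) + (h3 \<eta>' y * P y - h3 \<eta> y * P y)"
        by (simp only: distrib_left right_diff_distrib mult.commute)
      then have "g3 \<eta> \<eta>' y * P y = (E \<eta>' y - E \<eta> y) + (h3 \<eta>' y * P y - h3 \<eta> y * P y)"
        unfolding Pg2 .
      from eq4[unfolded eq5 this, symmetric] show "\<nu> \<eta> y = \<nu> \<eta>' y"
        unfolding \<nu>_def A_def by (simp add: algebra_simps)
    qed
  qed
  moreover have "residue_at \<zeta> (\<nu> \<zeta>) = residue_at \<zeta> (\<mu> \<zeta>) - residue_at \<zeta> (E \<zeta>)" if \<zeta>: "\<zeta> \<in> D'" for \<zeta>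
  proof -
    have \<zeta>X: "\<zeta> \<in> X" using \<zeta> D'(2) by blast
    let ?N = "V \<zeta> - (D' - {\<zeta>})"
    have N: "openin X_top ?N" "\<zeta> \<in> ?N" using V[OF \<zeta>X] D'(1) by (auto intro: openin_diff_finite)
    have m: "\<mu> \<zeta> \<in> L_sections (-2) (?N - {\<zeta>})"
      by (rule L_sections_restrict[OF \<mu>[OF \<zeta>X]]) (use VW4[OF \<zeta>X] D'(3) in blast)
    have ee: "E \<zeta> \<in> L_sections (-2) (?N - {\<zeta>})"
      by (rule L_sections_restrict[OF EL[OF \<zeta>X]]) (use D'(4) in blast)
    have a: "A \<zeta> \<in> L_sections (-2) ?N"
      by (rule L_sections_restrict[OF AL[OF \<zeta>X]]) blast
    then have a': "A \<zeta> \<in> L_sections (-2) (?N - {\<zeta>})" by (rule L_sections_restrict) blast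
    have "residue_at \<zeta> (\<lambda>y. 1 * (1 * \<mu> \<zeta> y + (-1) * E \<zeta> y) + (-1) * A \<zeta> y)
        = 1 * residue_at \<zeta> (\<lambda>y. 1 * \<mu> \<zeta> y + (-1) * E \<zeta> y) + (-1) * residue_at \<zeta> (A \<zeta>)"
      by (rule residue_at_linear[OF N]) (intro L_sections_add L_sections_cmult m ee a')+
    moreover have "residue_at \<zeta> (\<lambda>y. 1 * \<mu> \<zeta> y + (-1) * E \<zeta> y) =
        1 * residue_at \<zeta> (\<mu> \<zeta>) + (-1) * residue_at \<zeta> (E \<zeta>)"
      by (rule residue_at_linear[OF N m ee])
    moreover have "residue_at \<zeta> (A \<zeta>) = 0" by (rule residue_at_holomorphic[OF N a])
    ultimately show ?thesis unfolding \<nu>_def by simp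
  qed
  ultimately have "(\<Sum>\<zeta>\<in>D'. residue_at \<zeta> (\<mu> \<zeta>)) = (\<Sum>\<zeta>\<in>D'. residue_at \<zeta> (E \<zeta>))"
    by (simp add: sum_subtractf)
  moreover have "(\<Sum>\<zeta>\<in>D'. residue_at \<zeta> (\<mu> \<zeta>)) = (\<Sum>\<zeta>\<in>D. residue_at \<zeta> (\<mu> \<zeta>))"
  proof (rule sum.mono_neutral_right[OF D'(1,3)], intro ballI)
    fix \<zeta> assume \<zeta>: "\<zeta> \<in> D' - D"
    then have \<zeta>X: "\<zeta> \<in> X" using D'(2) by blast
    have "\<zeta> \<in> V \<zeta> - D" using V[OF \<zeta>X] \<zeta> by blast
    moreover have "openin X_top (V \<zeta> - D)" using V[OF \<zeta>X] D(1) by (intro openin_diff_finite) auto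
    moreover have "\<mu> \<zeta> \<in> L_sections (-2) (V \<zeta> - D)"
      by (rule L_sections_restrict[OF \<mu>[OF \<zeta>X]]) (use VW4[OF \<zeta>X] in blast)
    ultimately show "residue_at \<zeta> (\<mu> \<zeta>) = 0" using residue_at_holomorphic by blast
  qed
  \<comment> \<open>At any other point \<open>E \<zeta>\<close> is regular, because
    \<open>\<omega> l\<close> has its only zero at \<open>line l\<close>; a single residue
    remains.\<close>
  moreover have "(\<Sum>\<zeta>\<in>D'. residue_at \<zeta> (E \<zeta>)) = (\<Sum>\<zeta>\<in>{?\<xi>}. residue_at \<zeta> (E \<zeta>))"
  proof (rule sum.mono_neutral_right[OF D'(1)], use D'(4) in blast, intro ballI)
    fix \<zeta> assume \<zeta>: "\<zeta> \<in> D' - {?\<xi>}"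
    then have \<zeta>X: "\<zeta> \<in> X" using D'(2) by blast
    have "\<zeta> \<in> V \<zeta> - {?\<xi>}" using V[OF \<zeta>X] \<zeta> by blast
    moreover have "openin X_top (V \<zeta> - {?\<xi>})" using V[OF \<zeta>X] by (intro openin_diff_finite) auto
    ultimately show "residue_at \<zeta> (E \<zeta>) = 0" using residue_at_holomorphic EL[OF \<zeta>X] by blast
  qed
  moreover have "residue_at ?\<xi> (E ?\<xi>) = residue_at ?\<xi> (\<lambda>y. P y * (f0 (l, y) / \<omega> l y ^ ?K))"
  proof -
    let ?p = "(?\<xi>, ?\<xi>)"
    have p: "?p \<in> U \<times> X" using pU(1)[OF \<xi>X] .
    have "stalk_class XX_top ?F ?G ?p (fr ?p) = stalk_class XX_top ?F ?G ?p f0"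
      using rep p q0 by (metis (no_types, lifting))
    from jets.stalk_class_eqD[OF N0 f0 this]
    obtain N' where N': "openin XX_top N'" "?p \<in> N'" "(\<lambda>y. fr ?p y - f0 y) \<in> ?G N'" by blast
    define R where "R = N' \<inter> M ?\<xi> \<inter> N0"
    have R: "openin XX_top R" "?p \<in> R"
      using N' M[OF \<xi>X] N0 unfolding R_def by (auto intro: openin_Int)
    \<comment> \<open>\<open>d\<close> is all that separates \<open>e\<close> from \<open>f0\<close>
      at the diagonal point; it lies in the subsheaf, so \<open>residue_at_vanishing\<close> removes
      its contribution.\<close>
    define d where "d = (\<lambda>y. (fr ?p y - f0 y) + (h1 ?p y + h2 ?p y))"
    have dG: "d \<in> ?G R"
      unfolding d_def
      by (intro Gadd; rule vanishing_restrict, rule N'(3) hs(1)[OF \<xi>X] hs(2)[OF \<xi>X]) (auto simp: R_def)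
    have f0R: "f0 \<in> ?F R" by (rule LL_restrict[OF f0]) (auto simp: R_def)
    let ?N = "{\<eta>. (?\<xi>, \<eta>) \<in> R}"
    have N: "openin X_top ?N" "?\<xi> \<in> ?N" using openin_slice[OF R(1)] R(2) by auto
    have "E ?\<xi> = (\<lambda>y. 1 * (P y * (f0 (l, y) / \<omega> l y ^ ?K)) + 1 * (P y * (d (l, y) / \<omega> l y ^ ?K)))"
      unfolding E_def e_def d_def by (auto simp: add_divide_distrib diff_divide_distrib algebra_simps)
    then have "residue_at ?\<xi> (E ?\<xi>) =
        1 * residue_at ?\<xi> (\<lambda>y. P y * (f0 (l, y) / \<omega> l y ^ ?K)) + 1 * residue_at ?\<xi> (\<lambda>y. P y * (d (l, y) / \<omega> l y ^ ?K))"
      using residue_at_linear[OF N quotient_in_L_sections[OF f0R R(1) l(1) l0 P deg]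
          quotient_in_L_sections[OF vanishing_in_LL[OF dG] R(1) l(1) l0 P deg], of 1 1] by simp
    then show ?thesis using residue_at_vanishing[OF dG R l(1) l0 P deg] by simp
  qed
  ultimately show ?thesis by simp
qed

end

context oriented_plane begin

text \<open>
  Near \<open>line l\<close>, the connecting homomorphism is computed by the cover of \<open>A \<times> X\<close> by \<open>A \<times> A\<close> and by
  the complement of the diagonal: off the diagonal, every section represents the given jet.
\<close>

lemma connecting_germ:
  assumes q: "q \<in> Jet k n U" and U: "openin X_top U" and l: "l \<in> dual" "line l \<in> U"
    and A: "openin X_top A" "line l \<in> A" "A \<times> A \<subseteq> N0"
    and N0: "N0 \<subseteq> U \<times> X" and f0: "f0 \<in> LL_sections 0 (int n) N0"
    and rep: "\<And>p. p \<in> N0 \<Longrightarrow> q p = jet_stalk k n p f0"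
  defines "W \<equiv> \<lambda>p. if fst p = snd p then A \<times> A else {(\<xi>, \<eta>). \<xi> \<in> A \<and> \<eta> \<in> X \<and> \<xi> \<noteq> \<eta>}"
    and "f \<equiv> \<lambda>p. if fst p = snd p then f0 else (\<lambda>_. 0)"
  shows "(A, (W, \<lambda>p p' y. (f p' y - f p y) / \<omega> (fst y) (snd y) ^ (k + 1)))
      \<in> untwist (k + 1) (int n) (jet_connecting k n U q) (line l)"
    and "\<And>p. p \<in> A \<times> X \<Longrightarrow> openin XX_top (W p) \<and> p \<in> W p \<and> W p \<subseteq> A \<times> X \<and> f p \<in> LL_sections 0 (int n) (W p)"
proof -
  let ?F = "LL_sections 0 (int n)" and ?G = "vanishing_sections (k + 1) (int n)" and ?K = "k + 1"
  let ?off = "{(\<xi>, \<eta>). \<xi> \<in> A \<and> \<eta> \<in> X \<and> \<xi> \<noteq> \<eta>}"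
  have AX: "A \<subseteq> X" by (rule openin_X_subset[OF A(1)])
  have AU: "A \<subseteq> U" using A(3) N0 by blast
  have q': "q \<in> quotient_sections XX_top ?F ?G (U \<times> X)" using q by (simp add: Jet_def)
  have oAX: "openin XX_top (A \<times> X)" by (rule openin_Times[OF A(1) openin_X])
  have "?off = A \<times> X \<inter> {(\<xi>, \<eta>). \<xi> \<in> X \<and> \<eta> \<in> X \<and> \<xi> \<noteq> \<eta>}" using AX by auto
  then have ooff: "openin XX_top ?off" using openin_Int[OF oAX openin_off_diagonal] by simp
  have f0A: "f0 \<in> ?F (A \<times> A)" by (rule LL_restrict[OF f0 A(3)])
  have off_stalk: "q p' = stalk_class XX_top ?F ?G p' (\<lambda>_. 0)" if p': "p' \<in> ?off" for p'
  proof -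
    have "p' \<in> U \<times> X" using p' AU by blast
    from jets.quotient_sectionsD[OF q' this] obtain N f where N: "openin XX_top N" "p' \<in> N" "f \<in> ?F N"
      "q p' = stalk_class XX_top ?F ?G p' f" by metis
    let ?N = "N \<inter> ?off"
    have "f \<in> ?F ?N" by (rule LL_restrict[OF N(3)]) blast
    moreover have "f \<in> ?G ?N" by (rule vanishing_off_diagonal[OF \<open>f \<in> ?F ?N\<close>]) auto
    ultimately have "stalk_class XX_top ?F ?G p' f = stalk_class XX_top ?F ?G p' (\<lambda>_. 0)"
      using N(2) p' openin_Int[OF N(1) ooff] LL_zero
      by (intro jets.stalk_class_eqI[of ?N]) auto
    then show ?thesis using N(4) by simp
  qed
  have repW: "openin XX_top (W p) \<and> p \<in> W p \<and> W p \<subseteq> A \<times> X \<and> f p \<in> ?F (W p) \<and>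
      (\<forall>p'\<in>W p. q p' = stalk_class XX_top ?F ?G p' (f p))" if p: "p \<in> A \<times> X" for p
  proof (cases "fst p = snd p")
    case True
    then have "p \<in> A \<times> A" using p by (cases p) auto
    then show ?thesis using True openin_Times[OF A(1,1)] AX f0A rep A(3)
      unfolding W_def f_def by auto
  next
    case False
    then have "p \<in> ?off" using p by (cases p) auto
    then show ?thesis using False ooff off_stalk LL_zero unfolding W_def f_def by auto
  qed
  then show "\<And>p. p \<in> A \<times> X \<Longrightarrow> openin XX_top (W p) \<and> p \<in> W p \<and> W p \<subseteq> A \<times> X \<and> f p \<in> ?F (W p)"
    by blast
  obtain W0 fr where rep0: "\<forall>p\<in>U \<times> X. openin XX_top (W0 p) \<and> p \<in> W0 p \<and> W0 p \<subseteq> U \<times> X \<and> fr p \<in> ?F (W0 p) \<and>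
      (\<forall>p'\<in>W0 p. q p' = stalk_class XX_top ?F ?G p' (fr p))"
    using jets.exists_representatives[OF q'] by blast
  have c0: "(W0, \<lambda>p p' y. fr p' y - fr p y) \<in> connecting_hom XX_top cone2 ?F ?G (U \<times> X) q"
    by (rule jets.representatives_connecting_hom) (use rep0 in blast)
  define g where "g = (\<lambda>p p' y. (f p' y - f p y) / \<omega> (fst y) (snd y) ^ ?K)"
  define g' where "g' = (\<lambda>p p' (l, y). \<omega> l y ^ ?K * g p p' (l, y))"
  \<comment> \<open>An index off the diagonal makes the whole overlap avoid the diagonal, so
    \<open>\<omega>\<close> has no zero there; for two indices on the diagonal the difference of
    representatives is zero. Hence division by \<open>\<omega>\<close> to the power
    \<open>k + 1\<close> is harmless in all cases.\<close>
  have W_off: "fst p \<noteq> snd p \<or> fst p' \<noteq> snd p' \<Longrightarrow> (\<xi>, \<xi>) \<notin> W p \<inter> W p'" for p p' \<xi>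
    unfolding W_def by auto
  have g_diag: "g p p' = (\<lambda>_. 0)" if "fst p = snd p" "fst p' = snd p'" for p p'
    using that by (auto simp: g_def f_def)
  have WX: "W p \<inter> W p' \<subseteq> X \<times> X" for p p' using AX unfolding W_def by auto
  have f_diff: "(\<lambda>y. f p' y - f p y) \<in> ?F (W p \<inter> W p')" if "p \<in> A \<times> X" "p' \<in> A \<times> X" for p p'
    using repW[OF that(1)] repW[OF that(2)] by (intro LL_diff) (auto intro: LL_restrict)
  have g_LL: "g p p' \<in> LL_sections (- int ?K) (int n - int ?K) (W p \<inter> W p')"
    if pp: "p \<in> A \<times> X" "p' \<in> A \<times> X" for p p'
  proof (cases "fst p = snd p \<and> fst p' = snd p'")
    case True then show ?thesis using g_diag LL_zero by simp
  next
    case False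
    from LL_divide_omega[OF f_diff[OF pp] WX W_off, of ?K]
    have "(\<lambda>(l, y). (f p' (l, y) - f p (l, y)) / \<omega> l y ^ ?K)
        \<in> LL_sections (0 - int ?K) (int n - int ?K) (W p \<inter> W p')" using False by simp
    then show ?thesis unfolding g_def case_prod_beta' prod.collapse by simp
  qed
  have g'_eq: "agree_on cone2 (W p \<inter> W p') (\<lambda>y. f p' y - f p y) (g' p p')" for p p'
    unfolding agree_on_def
  proof (intro ballI)
    fix \<zeta> y assume \<zeta>: "\<zeta> \<in> W p \<inter> W p'" and y: "y \<in> cone2 \<zeta>"
    obtain l m where lm: "y = (l, m)" by (cases y)
    obtain \<xi> \<eta> where xe: "\<zeta> = (\<xi>, \<eta>)" by (cases \<zeta>)
    show "f p' y - f p y = g' p p' y"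
    proof (cases "fst p = snd p \<and> fst p' = snd p'")
      case True then show ?thesis using g_diag by (simp add: g'_def lm f_def)
    next
      case False
      then have "\<xi> \<noteq> \<eta>" using W_off[of p p' \<xi>] \<zeta> xe by auto
      moreover have "(\<xi>, \<eta>) \<in> X \<times> X" using subsetD[OF WX \<zeta>] by (simp add: xe)
      moreover have "(l, m) \<in> cone2 (\<xi>, \<eta>)" using y by (simp add: lm xe)
      ultimately have "\<omega> l m \<noteq> 0" using omega_nonzero_off_diagonal by blast
      then show ?thesis by (simp add: g'_def g_def lm)
    qed
  qed
  have co: "(W, g) \<in> cocycles XX_top cone2 (LL_sections (- int ?K) (int n - int ?K)) (A \<times> X)"
    unfolding cocycles_def mem_Collect_eq prod.case
  proof (intro conjI ballI)
    fix p p' p'' assume p: "p \<in> A \<times> X" and p': "p' \<in> A \<times> X" and "p'' \<in> A \<times> X"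
    show "agree_on cone2 (W p \<inter> W p' \<inter> W p'') (\<lambda>y. g p p' y + g p' p'' y) (g p p'')"
      by (auto simp: agree_on_def g_def diff_divide_distrib)
  qed (use repW g_LL in blast)+

  have co': "(W, g') \<in> cocycles XX_top cone2 ?G (A \<times> X)"
    unfolding cocycles_def mem_Collect_eq prod.case
  proof (intro conjI ballI)
    fix p p' assume p: "p \<in> A \<times> X" and p': "p' \<in> A \<times> X"
    have o: "openin XX_top (W p \<inter> W p')" using repW[OF p] repW[OF p'] by blast
    have L: "g' p p' \<in> ?F (W p \<inter> W p')" by (rule LL_cong[OF f_diff[OF p p'] o g'_eq])
    show "g' p p' \<in> ?G (W p \<inter> W p')"
    proof (cases "fst p = snd p \<and> fst p' = snd p'")
      case True
      then have "g' p p' = (\<lambda>_. 0)" using g_diag by (auto simp: g'_def)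
      then show ?thesis using vanishing_zero by simp
    next
      case False
      then show ?thesis by (intro vanishing_off_diagonal[OF L] W_off) blast
    qed
    fix p'' assume "p'' \<in> A \<times> X"
    show "agree_on cone2 (W p \<inter> W p' \<inter> W p'') (\<lambda>y. g' p p' y + g' p' p'' y) (g' p p'')"
    proof -
      have "f p' y - f p y = g' p p' y" "f p'' y - f p' y = g' p' p'' y" "f p'' y - f p y = g' p p'' y"
        if "\<zeta> \<in> W p \<inter> W p' \<inter> W p''" "y \<in> cone2 \<zeta>" for \<zeta> y
        using g'_eq[of p p'] g'_eq[of p' p''] g'_eq[of p p''] that unfolding agree_on_def by blast+
      note this[symmetric]
      then show ?thesis unfolding agree_on_def by simp
    qed
  qed (use repW in blast)+
  have "cohomologous XX_top cone2 ?G (A \<times> X)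
      ((\<lambda>p. W0 p \<inter> A \<times> X), \<lambda>p p' y. fr p' y - fr p y)
      ((\<lambda>p. W p \<inter> A \<times> X), \<lambda>p p' y. f p' y - f p y)"
  proof (rule jets.representatives_cohomologous)
    fix p assume p: "p \<in> A \<times> X"
    then have pU: "p \<in> U \<times> X" using AU by blast
    have "openin XX_top (W0 p)" "p \<in> W0 p" "fr p \<in> ?F (W0 p)" "q p = stalk_class XX_top ?F ?G p (fr p)"
      using bspec[OF rep0 pU] by blast+
    then show "openin XX_top (W0 p \<inter> A \<times> X) \<and> p \<in> W0 p \<inter> A \<times> X \<and> fr p \<in> ?F (W0 p \<inter> A \<times> X) \<and>
        q p = stalk_class XX_top ?F ?G p (fr p)"
      using p oAX by (auto intro: LL_restrict)
    have "openin XX_top (W p)" "p \<in> W p" "f p \<in> ?F (W p)" "q p = stalk_class XX_top ?F ?G p (f p)"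
      using repW[OF p] by blast+
    then show "openin XX_top (W p \<inter> A \<times> X) \<and> p \<in> W p \<inter> A \<times> X \<and> f p \<in> ?F (W p \<inter> A \<times> X) \<and>
        q p = stalk_class XX_top ?F ?G p (f p)"
      using p oAX by (auto intro: LL_restrict)
  qed
  then obtain V h where V: "\<forall>p\<in>A \<times> X. openin XX_top (V p) \<and> p \<in> V p \<and>
      V p \<subseteq> (W0 p \<inter> A \<times> X) \<inter> (W p \<inter> A \<times> X) \<and> h p \<in> ?G (V p)"
    and h: "\<forall>p\<in>A \<times> X. \<forall>p'\<in>A \<times> X. agree_on cone2 (V p \<inter> V p')
       (\<lambda>y. (f p' y - f p y) - (fr p' y - fr p y)) (\<lambda>y. h p' y - h p y)"
    unfolding cohomologous.simps by blast
  \<comment> \<open>\<open>g'\<close> agrees with the coboundary of \<open>f\<close> on the fibres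
    over overlaps, not necessarily as a total function: where \<open>\<omega>\<close> is zero,
    dividing and multiplying back loses the value. So the cochain \<open>h\<close> is transferred
    pointwise.\<close>
  have "cohomologous XX_top cone2 ?G (A \<times> X)
      ((\<lambda>p. W0 p \<inter> A \<times> X), \<lambda>p p' y. fr p' y - fr p y) ((\<lambda>p. W p \<inter> A \<times> X), g')"
    unfolding cohomologous.simps
  proof (rule exI[of _ V], rule exI[of _ h], rule conjI[OF V], intro ballI)
    fix p p' assume p: "p \<in> A \<times> X" and p': "p' \<in> A \<times> X"
    show "agree_on cone2 (V p \<inter> V p') (\<lambda>y. g' p p' y - (fr p' y - fr p y)) (\<lambda>y. h p' y - h p y)"
      unfolding agree_on_def
    proof (intro ballI)
      fix \<zeta> y assume \<zeta>: "\<zeta> \<in> V p \<inter> V p'" and y: "y \<in> cone2 \<zeta>"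
      have "\<zeta> \<in> W p \<inter> W p'" using \<zeta> bspec[OF V p] bspec[OF V p'] by blast
      then have "f p' y - f p y = g' p p' y" using g'_eq[of p p'] y unfolding agree_on_def by blast
      moreover have "(f p' y - f p y) - (fr p' y - fr p y) = h p' y - h p y"
        using bspec[OF bspec[OF h p] p'] \<zeta> y unfolding agree_on_def by blast
      ultimately show "g' p p' y - (fr p' y - fr p y) = h p' y - h p y" by simp
    qed
  qed
  then have "\<exists>U''. openin X_top U'' \<and> line l \<in> U'' \<and> U'' \<subseteq> U \<inter> A \<and>
      cohomologous XX_top cone2 ?G (U'' \<times> X)
        (restrict_cochain (U'' \<times> X) (W0, \<lambda>p p' y. fr p' y - fr p y)) (restrict_cochain (U'' \<times> X) (W, g'))"
    using A AU by (intro exI[of _ A]) (simp add: restrict_cochain.simps)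
  then have "(A, (W, g')) \<in> direct_image_germ ?G U (W0, \<lambda>p p' y. fr p' y - fr p y) (line l)"
    unfolding direct_image_germ_def using A co' by simp
  then have "(A, (W, g')) \<in> jet_connecting k n U q (line l)"
    unfolding jet_connecting_def using c0 l(2) by auto
  then have "(A, (W, g)) \<in> untwist ?K (int n) (jet_connecting k n U q) (line l)"
    unfolding untwist_def using A co by (simp add: g'_def)
  then show "(A, (W, \<lambda>p p' y. (f p' y - f p y) / \<omega> (fst y) (snd y) ^ ?K))
      \<in> untwist ?K (int n) (jet_connecting k n U q) (line l)"
    unfolding g_def .
qed

text \<open>The existence half of the definite description in \<open>H1_trace\<close>: the explicit
  germ of \<open>connecting_germ\<close> is carried through restriction to the fibre and
  multiplication by \<open>P\<close>, with a reflexive cohomology at each stage.\<close>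

lemma trace_exists:
  assumes kn: "n < k" and q: "q \<in> Jet k n U" and U: "openin X_top U" and l: "l \<in> dual" "line l \<in> U"
    and N0: "openin XX_top N0" "(line l, line l) \<in> N0" "N0 \<subseteq> U \<times> X" and f0: "f0 \<in> LL_sections 0 (int n) N0"
    and rep: "\<And>p. p \<in> N0 \<Longrightarrow> q p = jet_stalk k n p f0"
    and P: "P \<in> Sym (k - n - 1)"
  shows "\<exists>(W, g)\<in>H1_product (fibre_class (int n - int (k + 1))
        (untwist (k + 1) (int n) (jet_connecting k n U q)) l) P. \<exists>D \<mu>. finite D \<and> D \<subseteq> X \<and>
        (\<forall>\<xi>\<in>X. \<mu> \<xi> \<in> L_sections (-2) (W \<xi> - D)) \<and>
        (\<forall>\<xi>\<in>X. \<forall>\<eta>\<in>W \<xi> \<inter> D. \<forall>l m. l \<in> cone \<eta> \<longrightarrow> frame l m \<longrightarrow>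
           not_essential (\<lambda>w. \<mu> \<xi> (pencil l m w)) 0) \<and>
        (\<forall>\<xi>\<in>X. \<forall>\<eta>\<in>X. agree_on cone (W \<xi> \<inter> W \<eta> - D) (g \<xi> \<eta>) (\<lambda>y. \<mu> \<eta> y - \<mu> \<xi> y)) \<and>
        residue_at (line l) (\<lambda>y. P y * (f0 (l, y) / \<omega> l y ^ (k + 1))) = (\<Sum>\<xi>\<in>D. residue_at \<xi> (\<mu> \<xi>))"
proof -
  let ?\<xi> = "line l" and ?K = "k + 1" and ?b = "int n - int (k + 1)"
  have \<xi>X: "?\<xi> \<in> X" using l openin_X_subset[OF U] by blast
  have l\<xi>: "l \<in> cone ?\<xi>" using l by (simp add: cone_def)
  have l0: "l \<noteq> (\<lambda>_. 0)" by (rule coneD(2)[OF \<xi>X l\<xi>])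
  have deg: "int (k - n - 1) + ?b = - 2" using kn by (simp add: of_nat_diff)
  obtain A1 A2 where A12: "openin X_top A1" "openin X_top A2" "?\<xi> \<in> A1" "?\<xi> \<in> A2" "A1 \<times> A2 \<subseteq> N0"
    using openin_XX_box[OF N0(1,2)] by blast
  \<comment> \<open>The box is cut down to a square, so that one set of the cover contains the whole
    diagonal over \<open>A\<close>.\<close>
  define A where "A = A1 \<inter> A2"
  have A: "openin X_top A" "?\<xi> \<in> A" "A \<times> A \<subseteq> N0" using A12 by (auto simp: A_def)
  define W where "W = (\<lambda>p::'v set \<times> 'v set. if fst p = snd p then A \<times> A else {(\<xi>, \<eta>). \<xi> \<in> A \<and> \<eta> \<in> X \<and> \<xi> \<noteq> \<eta>})"
  define f where "f = (\<lambda>p::'v set \<times> 'v set. if fst p = snd p then f0 else (\<lambda>_. 0))"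
  define g where "g = (\<lambda>p p' y. (f p' y - f p y) / \<omega> (fst y) (snd y) ^ ?K)"
  have unt: "(A, (W, g)) \<in> untwist ?K (int n) (jet_connecting k n U q) ?\<xi>"
    unfolding W_def f_def g_def by (rule connecting_germ(1)[OF q U l A N0(3) f0 rep])
  have Wf: "openin XX_top (W p) \<and> p \<in> W p \<and> W p \<subseteq> A \<times> X \<and> f p \<in> LL_sections 0 (int n) (W p)"
    if "p \<in> A \<times> X" for p
    unfolding W_def f_def by (rule connecting_germ(2)[OF q U l A N0(3) f0 rep that])
  have pA: "(?\<xi>, \<eta>) \<in> A \<times> X" if "\<eta> \<in> X" for \<eta> using that A(2) by simp
  have co: "(W, g) \<in> cocycles XX_top cone2 (LL_sections (- int ?K) ?b) (A \<times> X)"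
    using unt unfolding untwist_def by blast
  define W3 where "W3 = (\<lambda>\<eta>. {\<eta>'. (?\<xi>, \<eta>') \<in> W (?\<xi>, \<eta>)})"
  define g3 where "g3 = (\<lambda>\<eta> \<eta>' y. g (?\<xi>, \<eta>) (?\<xi>, \<eta>') (l, y))"
  have fc: "fibre_cochain l (W, g) = (W3, g3)" by (simp add: W3_def g3_def)
  have W3: "openin X_top (W3 \<eta>) \<and> \<eta> \<in> W3 \<eta> \<and> W3 \<eta> \<subseteq> X" if "\<eta> \<in> X" for \<eta>
    using Wf[OF pA[OF that]] openin_slice[of "W (?\<xi>, \<eta>)" ?\<xi>] unfolding W3_def by blast
  have g3L: "g3 \<eta> \<eta>' \<in> L_sections ?b (W3 \<eta> \<inter> W3 \<eta>')" if "\<eta> \<in> X" "\<eta>' \<in> X" for \<eta> \<eta>'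
  proof -
    have "g (?\<xi>, \<eta>) (?\<xi>, \<eta>') \<in> LL_sections (- int ?K) ?b (W (?\<xi>, \<eta>) \<inter> W (?\<xi>, \<eta>'))"
      using co pA[OF that(1)] pA[OF that(2)] unfolding cocycles_def by blast
    moreover have "openin XX_top (W (?\<xi>, \<eta>) \<inter> W (?\<xi>, \<eta>'))"
      using Wf[OF pA[OF that(1)]] Wf[OF pA[OF that(2)]] by blast
    ultimately have "(\<lambda>y. g (?\<xi>, \<eta>) (?\<xi>, \<eta>') (l, y)) \<in>
        L_sections ?b {\<zeta>. (?\<xi>, \<zeta>) \<in> W (?\<xi>, \<eta>) \<inter> W (?\<xi>, \<eta>')}"
      by (rule LL_slice[OF _ _ l(1) l0])
    moreover have "{\<zeta>. (?\<xi>, \<zeta>) \<in> W (?\<xi>, \<eta>) \<inter> W (?\<xi>, \<eta>')} = W3 \<eta> \<inter> W3 \<eta>'" by (auto simp: W3_def)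
    ultimately show ?thesis by (simp add: g3_def)
  qed
  have g3_add: "g3 \<eta> \<eta>' y + g3 \<eta>' \<eta>'' y = g3 \<eta> \<eta>'' y" for \<eta> \<eta>' \<eta>'' y
    by (simp add: g3_def g_def diff_divide_distrib)
  have co3: "(W3, g3) \<in> cocycles X_top cone (L_sections ?b) X"
    unfolding cocycles_def using W3 g3L g3_add by (simp add: agree_on_def)
  have fcl: "(W3, g3) \<in> fibre_class ?b (untwist ?K (int n) (jet_connecting k n U q)) l"
    unfolding fibre_class_def
  proof (intro CollectI conjI co3)
    have "cohomologous X_top cone (L_sections ?b) X (fibre_cochain l (W, g)) (W3, g3)"
      unfolding fc by (rule cohomologous_refl) (use W3 L_sections_zero in auto)
    then show "\<exists>(U', c')\<in>untwist ?K (int n) (jet_connecting k n U q) (line l).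
        cohomologous X_top cone (L_sections ?b) X (fibre_cochain l c') (W3, g3)"
      using unt by (intro bexI[of _ "(A, (W, g))"]) simp_all
  qed
  define g4 where "g4 = (\<lambda>\<eta> \<eta>' y. g3 \<eta> \<eta>' y * P y)"
  have co4: "(W3, g4) \<in> cocycles X_top cone (L_sections (-2)) X"
    unfolding cocycles_def mem_Collect_eq prod.case
  proof (intro conjI ballI)
    fix \<eta> \<eta>' assume e: "\<eta> \<in> X" "\<eta>' \<in> X"
    have "?b + int (k - n - 1) = - 2" using deg by simp
    then show "g4 \<eta> \<eta>' \<in> L_sections (-2) (W3 \<eta> \<inter> W3 \<eta>')"
      using L_sections_mult[OF g3L[OF e] Sym_in_L_sections[OF P]] by (simp add: g4_def)
    fix \<eta>'' assume "\<eta>'' \<in> X"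
    show "agree_on cone (W3 \<eta> \<inter> W3 \<eta>' \<inter> W3 \<eta>'') (\<lambda>y. g4 \<eta> \<eta>' y + g4 \<eta>' \<eta>'' y) (g4 \<eta> \<eta>'')"
      unfolding agree_on_def g4_def by (simp add: g3_add distrib_right[symmetric])
  qed (use W3 in blast)+
  have prod: "(W3, g4) \<in> H1_product (fibre_class ?b (untwist ?K (int n) (jet_connecting k n U q)) l) P"
    unfolding H1_product_def
  proof (intro CollectI conjI co4)
    have "cohomologous X_top cone (L_sections (-2)) X (W3, \<lambda>\<xi> \<eta> y. g3 \<xi> \<eta> y * P y) (W3, g4)"
      unfolding g4_def by (rule cohomologous_refl) (use W3 L_sections_zero in auto)
    then show "\<exists>(W, g)\<in>fibre_class ?b (untwist ?K (int n) (jet_connecting k n U q)) l.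
        cohomologous X_top cone (L_sections (-2)) X (W, \<lambda>\<xi> \<eta> y. g \<xi> \<eta> y * P y) (W3, g4)"
      using fcl by (intro bexI[of _ "(W3, g3)"]) simp_all
  qed
  \<comment> \<open>\<open>f (line l, \<eta>)\<close> is \<open>f0\<close> for
    \<open>\<eta> = line l\<close> and 0 for every other \<open>\<eta>\<close>, so at most one
    member of the distribution is nonzero.\<close>
  define \<mu> where "\<mu> = (\<lambda>\<eta> y. P y * (f (?\<xi>, \<eta>) (l, y) / \<omega> l y ^ ?K))"
  have 1: "\<mu> \<eta> \<in> L_sections (-2) (W3 \<eta> - {?\<xi>})" if "\<eta> \<in> X" for \<eta>
    using Wf[OF pA[OF that]] quotient_in_L_sections[OF _ _ l(1) l0 P deg, of "f (?\<xi>, \<eta>)" "W (?\<xi>, \<eta>)"]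
    unfolding \<mu>_def W3_def by blast
  have 2: "not_essential (\<lambda>w. \<mu> \<eta> (pencil l' m' w)) 0"
    if "\<eta> \<in> X" "?\<xi> \<in> W3 \<eta>" "l' \<in> cone ?\<xi>" "frame l' m'" for \<eta> l' m'
    unfolding \<mu>_def
    by (rule not_essential_quotient[of _ "int n" "W (?\<xi>, \<eta>)"])
      (use Wf[OF pA[OF that(1)]] that l l0 P in \<open>auto simp: W3_def cone_def\<close>)
  have 3: "agree_on cone (W3 \<xi> \<inter> W3 \<eta> - {?\<xi>}) (g4 \<xi> \<eta>) (\<lambda>y. \<mu> \<eta> y - \<mu> \<xi> y)" for \<xi> \<eta>
    by (auto simp: agree_on_def g4_def g3_def g_def \<mu>_def diff_divide_distrib algebra_simps)
  have 4: "residue_at ?\<xi> (\<lambda>y. P y * (f0 (l, y) / \<omega> l y ^ ?K)) = (\<Sum>\<xi>\<in>{?\<xi>}. residue_at \<xi> (\<mu> \<xi>))"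
    by (simp add: \<mu>_def f_def)
  show ?thesis
  proof (rule bexI[OF _ prod], unfold prod.case, rule exI[of _ "{?\<xi>}"], rule exI[of _ \<mu>],
      intro conjI ballI allI impI)
    fix \<eta> \<zeta> l' m' assume "\<eta> \<in> X" "\<zeta> \<in> W3 \<eta> \<inter> {?\<xi>}" "l' \<in> cone \<zeta>" "frame l' m'"
    then show "not_essential (\<lambda>w. \<mu> \<eta> (pencil l' m' w)) 0" using 2 by blast
  qed (use 1 3 4 \<xi>X in simp_all)
qed

lemma Serre_dual_residue:
  assumes kn: "n < k" and q: "q \<in> Jet k n U" and U: "openin X_top U" and l: "l \<in> dual" "line l \<in> U"
    and N0: "openin XX_top N0" "(line l, line l) \<in> N0" "N0 \<subseteq> U \<times> X" and f0: "f0 \<in> LL_sections 0 (int n) N0"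
    and rep: "\<And>p. p \<in> N0 \<Longrightarrow> q p = jet_stalk k n p f0"
    and P: "P \<in> Sym (k - n - 1)"
  shows "Serre_dual (k - n - 1) (fibre_class (int n - int (k + 1))
        (untwist (k + 1) (int n) (jet_connecting k n U q)) l) P =
      residue_at (line l) (\<lambda>y. P y * (f0 (l, y) / \<omega> l y ^ (k + 1)))"
proof -
  let ?\<kappa> = "H1_product (fibre_class (int n - int (k + 1))
        (untwist (k + 1) (int n) (jet_connecting k n U q)) l) P"
  have "H1_trace ?\<kappa> = residue_at (line l) (\<lambda>y. P y * (f0 (l, y) / \<omega> l y ^ (k + 1)))"
    unfolding H1_trace_def
  proof (rule the_equality)
    show "\<exists>(W, g)\<in>?\<kappa>. \<exists>D \<mu>. finite D \<and> D \<subseteq> X \<and>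
        (\<forall>\<xi>\<in>X. \<mu> \<xi> \<in> L_sections (-2) (W \<xi> - D)) \<and>
        (\<forall>\<xi>\<in>X. \<forall>\<eta>\<in>W \<xi> \<inter> D. \<forall>l m. l \<in> cone \<eta> \<longrightarrow> frame l m \<longrightarrow>
           not_essential (\<lambda>w. \<mu> \<xi> (pencil l m w)) 0) \<and>
        (\<forall>\<xi>\<in>X. \<forall>\<eta>\<in>X. agree_on cone (W \<xi> \<inter> W \<eta> - D) (g \<xi> \<eta>) (\<lambda>y. \<mu> \<eta> y - \<mu> \<xi> y)) \<and>
        residue_at (line l) (\<lambda>y. P y * (f0 (l, y) / \<omega> l y ^ (k + 1))) = (\<Sum>\<xi>\<in>D. residue_at \<xi> (\<mu> \<xi>))"
      by (rule trace_exists[OF kn q U l N0 f0 rep P])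
    fix t assume "\<exists>(W, g)\<in>?\<kappa>. \<exists>D \<mu>. finite D \<and> D \<subseteq> X \<and>
        (\<forall>\<xi>\<in>X. \<mu> \<xi> \<in> L_sections (-2) (W \<xi> - D)) \<and>
        (\<forall>\<xi>\<in>X. \<forall>\<eta>\<in>W \<xi> \<inter> D. \<forall>l m. l \<in> cone \<eta> \<longrightarrow> frame l m \<longrightarrow>
           not_essential (\<lambda>w. \<mu> \<xi> (pencil l m w)) 0) \<and>
        (\<forall>\<xi>\<in>X. \<forall>\<eta>\<in>X. agree_on cone (W \<xi> \<inter> W \<eta> - D) (g \<xi> \<eta>) (\<lambda>y. \<mu> \<eta> y - \<mu> \<xi> y)) \<and>
        t = (\<Sum>\<xi>\<in>D. residue_at \<xi> (\<mu> \<xi>))"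
    then obtain W g D \<mu> where c: "(W, g) \<in> ?\<kappa>" and D: "finite D" "D \<subseteq> X"
      and \<mu>: "\<forall>\<xi>\<in>X. \<mu> \<xi> \<in> L_sections (-2) (W \<xi> - D)"
      and ag: "\<forall>\<xi>\<in>X. \<forall>\<eta>\<in>X. agree_on cone (W \<xi> \<inter> W \<eta> - D) (g \<xi> \<eta>) (\<lambda>y. \<mu> \<eta> y - \<mu> \<xi> y)"
      and t: "t = (\<Sum>\<xi>\<in>D. residue_at \<xi> (\<mu> \<xi>))" by blast
    show "t = residue_at (line l) (\<lambda>y. P y * (f0 (l, y) / \<omega> l y ^ (k + 1)))"
      unfolding t
      by (rule trace_unique[OF kn q U l N0(1,2) f0 rep[OF N0(2)] P c D \<mu>[rule_format] ag[rule_format]])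
  qed
  then show ?thesis using P by (simp add: Serre_dual_def)
qed

text \<open>Linearity is inherited from the residue, since one representative \<open>f0\<close>
  serves all forms. Membership in \<open>Sym_dual\<close> is what allows \<open>contraction\<close>
  to undo \<open>Sym_iso\<close>.\<close>

lemma Serre_dual_in_Sym_dual:
  assumes kn: "n < k" and q: "q \<in> Jet k n U" and U: "openin X_top U" and l: "l \<in> dual" "line l \<in> U"
    and N0: "openin XX_top N0" "(line l, line l) \<in> N0" "N0 \<subseteq> U \<times> X" and f0: "f0 \<in> LL_sections 0 (int n) N0"
    and rep: "\<And>p. p \<in> N0 \<Longrightarrow> q p = jet_stalk k n p f0"
  shows "Serre_dual (k - n - 1) (fibre_class (int n - int (k + 1))
        (untwist (k + 1) (int n) (jet_connecting k n U q)) l) \<in> Sym_dual (k - n - 1)"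
    (is "?\<phi> \<in> _")
proof -
  have \<xi>X: "line l \<in> X" using l openin_X_subset[OF U] by blast
  have l0: "l \<noteq> (\<lambda>_. 0)" using coneD(2)[OF \<xi>X] l by (simp add: cone_def)
  have deg: "int (k - n - 1) + (int n - int (k + 1)) = - 2" using kn by (simp add: of_nat_diff)
  have N: "openin X_top {\<eta>. (line l, \<eta>) \<in> N0}" "line l \<in> {\<eta>. (line l, \<eta>) \<in> N0}"
    using openin_slice[OF N0(1)] N0(2) by auto
  have "?\<phi> (\<lambda>y. a * P y + b * Q y) = a * ?\<phi> P + b * ?\<phi> Q"
    if P: "P \<in> Sym (k - n - 1)" and Q: "Q \<in> Sym (k - n - 1)" for P Q a b
  proof -
    have S: "?\<phi> R = residue_at (line l) (\<lambda>y. R y * (f0 (l, y) / \<omega> l y ^ (k + 1)))"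
      if "R \<in> Sym (k - n - 1)" for R
      by (rule Serre_dual_residue[OF kn q U l N0 f0 _ that]) (rule rep)
    have "residue_at (line l) (\<lambda>y. (a * P y + b * Q y) * (f0 (l, y) / \<omega> l y ^ (k + 1))) =
      residue_at (line l) (\<lambda>y. a * (P y * (f0 (l, y) / \<omega> l y ^ (k + 1))) + b * (Q y * (f0 (l, y) / \<omega> l y ^ (k + 1))))"
      by (simp only: distrib_right mult.assoc)
    also have "\<dots> = a * residue_at (line l) (\<lambda>y. P y * (f0 (l, y) / \<omega> l y ^ (k + 1))) +
        b * residue_at (line l) (\<lambda>y. Q y * (f0 (l, y) / \<omega> l y ^ (k + 1)))"
      by (rule residue_at_linear[OF N quotient_in_L_sections[OF f0 N0(1) l(1) l0 P deg]
            quotient_in_L_sections[OF f0 N0(1) l(1) l0 Q deg]])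
    finally show ?thesis unfolding S[OF P] S[OF Q] S[OF Sym_linear[OF P Q]] .
  qed
  moreover have "?\<phi> P = 0" if "P \<notin> Sym (k - n - 1)" for P using that by (simp add: Serre_dual_def)
  ultimately show ?thesis unfolding Sym_dual_def by blast
qed

section \<open>Residue functionals of a jet and of its projection\<close>

lemma residue_at_cong_dual:
  assumes "\<xi> \<in> X" "\<And>y. y \<in> dual \<Longrightarrow> f y = g y"
  shows "residue_at \<xi> f = residue_at \<xi> g"
  by (rule residue_at_cong[OF assms(1) openin_X]) (use assms(2) in \<open>auto simp: cone_def\<close>)

text \<open>With one function representing both jets, the two residue functionals differ only in the
  exponent of \<open>\<omega>\<close> and in the degree of the test forms. Injectivity of
  \<open>Sym_iso\<close> then carries the identity of functionals over to
  \<open>contraction\<close>.\<close>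

lemma direct_image_iso_projection:
  assumes kn: "n < k - 1" and U: "openin X_top U"
    and q: "q \<in> Jet k n U" and q': "q' \<in> Jet (k - 1) n U"
    and common: "\<And>\<xi>. \<xi> \<in> U \<Longrightarrow> \<exists>N f. openin XX_top N \<and> (\<xi>, \<xi>) \<in> N \<and> N \<subseteq> U \<times> X \<and>
      f \<in> LL_sections 0 (int n) N \<and> (\<forall>p\<in>N.
        q p = jet_stalk k n p f \<and>
        q' p = jet_stalk (k - 1) n p f)"
  shows "direct_image_iso (k - 1) n U (jet_connecting (k - 1) n U q') =
    contraction (k - n - 1) U (direct_image_iso k n U (jet_connecting k n U q))"
proof
  fix l
  show "direct_image_iso (k - 1) n U (jet_connecting (k - 1) n U q') l =
    contraction (k - n - 1) U (direct_image_iso k n U (jet_connecting k n U q)) l"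
  proof (cases "l \<in> dual \<and> line l \<in> U")
    case False
    then show ?thesis by (auto simp: direct_image_iso_def contraction_def)
  next
    case True
    then have l: "l \<in> dual" "line l \<in> U" by auto
    have \<xi>X: "line l \<in> X" using l openin_X_subset[OF U] by blast
    obtain N f where N: "openin XX_top N" "(line l, line l) \<in> N" "N \<subseteq> U \<times> X" and f: "f \<in> LL_sections 0 (int n) N"
      and rep: "\<forall>p\<in>N.
        q p = jet_stalk k n p f \<and>
        q' p = jet_stalk (k - 1) n p f"
      using common[OF l(2)] by blast
    have kn0: "n < k" using kn by simp
    define \<phi> where "\<phi> = Serre_dual (k - n - 1) (fibre_class (int n - int (k + 1))
        (untwist (k + 1) (int n) (jet_connecting k n U q)) l)"
    define \<psi> where "\<psi> = Serre_dual (k - 1 - n - 1) (fibre_class (int n - int (k - 1 + 1))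
        (untwist (k - 1 + 1) (int n) (jet_connecting (k - 1) n U q')) l)"
    have \<phi>: "\<phi> P = residue_at (line l) (\<lambda>y. P y * (f (l, y) / \<omega> l y ^ (k + 1)))"
      if "P \<in> Sym (k - n - 1)" for P
      unfolding \<phi>_def by (rule Serre_dual_residue[OF kn0 q U l N f _ that]) (use rep in blast)
    have \<psi>: "\<psi> P = residue_at (line l) (\<lambda>y. P y * (f (l, y) / \<omega> l y ^ (k - 1 + 1)))"
      if "P \<in> Sym (k - 1 - n - 1)" for P
      unfolding \<psi>_def by (rule Serre_dual_residue[OF kn q' U l N f _ that]) (use rep in blast)
    have \<phi>D: "\<phi> \<in> Sym_dual (k - n - 1)"
      unfolding \<phi>_def by (rule Serre_dual_in_Sym_dual[OF kn0 q U l N f]) (use rep in blast)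
    have j: "k - 1 - n - 1 = k - n - 1 - 1" "Suc (k - n - 1 - 1) = k - n - 1" using kn by auto
    have "\<psi> = contract (k - n - 1) (sharp l) \<phi>"
    proof
      fix Q
      show "\<psi> Q = contract (k - n - 1) (sharp l) \<phi> Q"
      proof (cases "Q \<in> Sym (k - n - 1 - 1)")
        case False
        then show ?thesis by (simp add: contract_def \<psi>_def Serre_dual_def j(1))
      next
        case Q: True
        have yQ: "(\<lambda>y. y (sharp l) * Q y) \<in> Sym (k - n - 1)" using Sym_mult_vector[OF Q] j(2) by simp
        have "\<phi> (\<lambda>y. y (sharp l) * Q y) =
            residue_at (line l) (\<lambda>y. Q y * (f (l, y) / \<omega> l y ^ (k - 1 + 1)))"
          unfolding \<phi>[OF yQ]
        proof (rule residue_at_cong_dual[OF \<xi>X])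
          fix y assume y: "y \<in> dual"
          \<comment> \<open>\<open>k - 1 + 1\<close> equals \<open>k\<close>, as \<open>k\<close> is
            positive. Where \<open>\<omega> l y = 0\<close>, both sides of the identity below are 0
            by the convention for division by zero, so it holds for all covectors.\<close>
          have "\<omega> l y ^ (k + 1) = \<omega> l y * \<omega> l y ^ (k - 1 + 1)" using kn by (simp add: power_Suc[symmetric] del: power_Suc)
          moreover have "\<omega> l y ^ (k - 1 + 1) = 0" if "\<omega> l y = 0" using that by simp
          ultimately show "y (sharp l) * Q y * (f (l, y) / \<omega> l y ^ (k + 1)) =
              Q y * (f (l, y) / \<omega> l y ^ (k - 1 + 1))"
            unfolding sharp_eq[OF l(1) y] by (cases "\<omega> l y = 0") auto
        qed
        also have "\<dots> = \<psi> Q" using \<psi>[of Q] Q j(1) by simp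
        finally show ?thesis using Q by (simp add: contract_def)
      qed
    qed
    moreover have "direct_image_iso (k - 1) n U (jet_connecting (k - 1) n U q') l = Sym_iso (k - n - 1 - 1) \<psi>"
      using l by (simp add: direct_image_iso_def \<psi>_def j(1))
    moreover have "direct_image_iso k n U (jet_connecting k n U q) l = Sym_iso (k - n - 1) \<phi>"
      using l by (simp add: direct_image_iso_def \<phi>_def)
    ultimately show ?thesis
      using l the_inv_into_f_f[OF inj_on_Sym_iso \<phi>D] by (simp add: contraction_def)
  qed
qed

section \<open>Projections between jet sheaves and the splitting\<close>

lemma jet_proj_stalk:
  assumes "j \<le> k" "openin XX_top N" "p \<in> N" "f \<in> LL_sections 0 (int n) N"
    and "q p = jet_stalk k n p f"
  shows "jet_proj j n q p = jet_stalk j n p f"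
  unfolding jet_proj_def
proof (rule quotient_map_to_stalk)
  show "subsheaf XX_top (LL_sections 0 (int n)) (vanishing_sections (k + 1) (int n))"
    "subsheaf XX_top (LL_sections 0 (int n)) (vanishing_sections (j + 1) (int n))"
    by (rule subsheaf_vanishing)+
  show "vanishing_sections (k + 1) (int n) M \<subseteq> vanishing_sections (j + 1) (int n) M" for M
    using vanishing_antimono[of "j + 1" "k + 1"] assms(1) by auto
qed (rule assms)+

lemma jet_proj_outside: "q p = {} \<Longrightarrow> jet_proj j n q p = {}"
  by (simp add: jet_proj_def quotient_map_to_def)

lemma jet_proj_in_Jet:
  assumes "j \<le> k" and q: "q \<in> Jet k n U"
  shows "jet_proj j n q \<in> Jet j n U"
  unfolding Jet_def
proof (rule jets.quotient_sectionsI)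
  have q': "q \<in> quotient_sections XX_top (LL_sections 0 (int n)) (vanishing_sections (k + 1) (int n)) (U \<times> X)"
    using q by (simp add: Jet_def)
  fix p
  {
    assume "p \<in> U \<times> X"
    from jets.quotient_sectionsD[OF q' this]
    obtain N f where N: "openin XX_top N" "p \<in> N" "N \<subseteq> U \<times> X" "f \<in> LL_sections 0 (int n) N"
      "\<And>p'. p' \<in> N \<Longrightarrow> q p' = jet_stalk k n p' f"
      by blast
    have "\<forall>p'\<in>N. jet_proj j n q p' =
        jet_stalk j n p' f"
    proof
      fix p' assume p': "p' \<in> N"
      show "jet_proj j n q p' =
          jet_stalk j n p' f"
        by (rule jet_proj_stalk[where q = q, OF assms(1) N(1) p' N(4) N(5)[OF p']])
    qed
    then show "\<exists>N' f. openin XX_top N' \<and> p \<in> N' \<and> N' \<subseteq> U \<times> X \<and> f \<in> LL_sections 0 (int n) N' \<and>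
        (\<forall>p'\<in>N'. jet_proj j n q p' =
          jet_stalk j n p' f)"
      using N(1-4) by (intro exI[of _ N] exI[of _ f] conjI)
  next
    assume "p \<notin> U \<times> X"
    then show "jet_proj j n q p = {}"
      using jets.quotient_sections_outside[OF q'] by (intro jet_proj_outside)
  }
qed

lemma jet_proj_jet_proj:
  assumes "j \<le> i" "i \<le> k" and q: "q \<in> Jet k n U"
  shows "jet_proj j n (jet_proj i n q) = jet_proj j n q"
proof
  fix p
  have q': "q \<in> quotient_sections XX_top (LL_sections 0 (int n)) (vanishing_sections (k + 1) (int n)) (U \<times> X)"
    using q by (simp add: Jet_def)
  show "jet_proj j n (jet_proj i n q) p = jet_proj j n q p"
  proof (cases "p \<in> U \<times> X")
    case True
    from jets.quotient_sectionsD[OF q' this]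
    obtain N f where N: "openin XX_top N" "p \<in> N" "N \<subseteq> U \<times> X" "f \<in> LL_sections 0 (int n) N"
      "\<And>p'. p' \<in> N \<Longrightarrow> q p' = jet_stalk k n p' f"
      by blast
    have jk: "j \<le> k" using assms by simp
    show ?thesis
      unfolding jet_proj_stalk[where q = q, OF jk N(1,2,4) N(5)[OF N(2)]]
      by (rule jet_proj_stalk[where q = "jet_proj i n q", OF assms(1) N(1,2,4)
            jet_proj_stalk[where q = q, OF assms(2) N(1,2,4) N(5)[OF N(2)]]])
  next
    case False
    then have "q p = {}" using jets.quotient_sections_outside[OF q'] by blast
    then show ?thesis by (simp add: jet_proj_outside)
  qed
qed

text \<open>Projections compose, so \<open>q\<close> and its projection have the same component
  \<open>\<sigma>\<close> in V_n. Subtracting the jets of \<open>\<sigma>\<close> leaves two jets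
  with common local representatives \<open>f - \<sigma>\<close>, to which the comparison of direct
  images applies.\<close>

lemma jet_iso_projection:
  assumes kn: "n < k - 1" and U: "openin X_top U" and q: "q \<in> Jet k n U"
  shows "jet_iso (k - 1) n U (jet_proj (k - 1) n q) =
    map_prod (\<lambda>\<sigma>. \<sigma>) (contraction (k - n - 1) U) (jet_iso k n U q)"
proof -
  let ?F = "LL_sections 0 (int n)" and ?G = "\<lambda>i. vanishing_sections (i + 1) (int n)"
  define \<sigma> where "\<sigma> = \<beta> n U q"
  have \<sigma>': "\<beta> n U (jet_proj (k - 1) n q) = \<sigma>"
    unfolding \<sigma>_def \<beta>_def using jet_proj_jet_proj[of n "k - 1" k q n U] kn q by simp
  have "jet_proj n n q \<in> Jet n n U" by (rule jet_proj_in_Jet[OF _ q]) (use kn in simp)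
  then have \<sigma>V: "\<sigma> \<in> V_sections n U" unfolding \<sigma>_def \<beta>_def by (rule jet_iso_n_V_sections[OF U])
  let ?\<sigma> = "\<lambda>(l, y). \<sigma> (line l) y"
  have \<sigma>L: "?\<sigma> \<in> ?F (U \<times> X)" by (rule V_sections_in_LL[OF U \<sigma>V])
  have oU: "openin XX_top (U \<times> X)" by (rule openin_Times[OF U openin_X])
  have jet_of: "jet_of i n U \<sigma> \<in> Jet i n U" for i
    unfolding Jet_def
  proof (rule jets.quotient_sectionsI)
    fix p assume "p \<in> U \<times> X"
    then show "\<exists>N' f. openin XX_top N' \<and> p \<in> N' \<and> N' \<subseteq> U \<times> X \<and> f \<in> ?F N' \<and>
        (\<forall>p'\<in>N'. jet_of i n U \<sigma> p' = stalk_class XX_top ?F (?G i) p' f)"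
      using oU \<sigma>L by (intro exI[of _ "U \<times> X"] exI[of _ ?\<sigma>]) (simp add: jet_of_def)
  qed (simp add: jet_of_def)
  define d where "d = (\<lambda>i r. quotient_diff XX_top ?F (?G i) r (jet_of i n U \<sigma>))"
  have d_in: "d i r \<in> Jet i n U" if "r \<in> Jet i n U" for i r
    using jets.quotient_diff_sections that jet_of unfolding d_def Jet_def by blast
  have d_stalk: "d i r p = stalk_class XX_top ?F (?G i) p (\<lambda>y. f y - ?\<sigma> y)"
    if "openin XX_top N" "N \<subseteq> U \<times> X" "p \<in> N" "f \<in> ?F N" "r p = stalk_class XX_top ?F (?G i) p f" for i r p N f
  proof -
    have "jet_of i n U \<sigma> p = stalk_class XX_top ?F (?G i) p ?\<sigma>" using that(2,3) by (auto simp: jet_of_def)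
    then show ?thesis
      unfolding d_def
      by (rule jets.quotient_diff_stalk[OF that(1,3,4) LL_restrict[OF \<sigma>L that(2)], where ?q1.0 = r, OF that(5)])
  qed
  have q': "q \<in> quotient_sections XX_top ?F (?G k) (U \<times> X)" using q by (simp add: Jet_def)
  have "direct_image_iso (k - 1) n U (jet_connecting (k - 1) n U (d (k - 1) (jet_proj (k - 1) n q))) =
      contraction (k - n - 1) U (direct_image_iso k n U (jet_connecting k n U (d k q)))"
  proof (rule direct_image_iso_projection[OF kn U d_in[OF q] d_in[OF jet_proj_in_Jet[OF _ q]]])
    fix \<xi> assume \<xi>: "\<xi> \<in> U"
    then have "(\<xi>, \<xi>) \<in> U \<times> X" using openin_X_subset[OF U] by blast
    from jets.quotient_sectionsD[OF q' this]
    obtain N f where N: "openin XX_top N" "(\<xi>, \<xi>) \<in> N" "N \<subseteq> U \<times> X" "f \<in> ?F N"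
      "\<And>p'. p' \<in> N \<Longrightarrow> q p' = stalk_class XX_top ?F (?G k) p' f"
      by blast
    have "(\<lambda>y. f y - ?\<sigma> y) \<in> ?F N" by (rule LL_diff[OF N(4) LL_restrict[OF \<sigma>L N(3)]])
    moreover have "d k q p = stalk_class XX_top ?F (?G k) p (\<lambda>y. f y - ?\<sigma> y)"
      "d (k - 1) (jet_proj (k - 1) n q) p = stalk_class XX_top ?F (?G (k - 1)) p (\<lambda>y. f y - ?\<sigma> y)"
      if p: "p \<in> N" for p
    proof -
      show "d k q p = stalk_class XX_top ?F (?G k) p (\<lambda>y. f y - ?\<sigma> y)"
        by (rule d_stalk[OF N(1,3) p N(4)]) (rule N(5)[OF p])
      have "jet_proj (k - 1) n q p = stalk_class XX_top ?F (?G (k - 1)) p f"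
        by (rule jet_proj_stalk[where q = q, OF _ N(1) p N(4) N(5)[OF p]]) simp
      then show "d (k - 1) (jet_proj (k - 1) n q) p = stalk_class XX_top ?F (?G (k - 1)) p (\<lambda>y. f y - ?\<sigma> y)"
        by (intro d_stalk[OF N(1,3) p N(4)])
    qed
    ultimately show "\<exists>N f. openin XX_top N \<and> (\<xi>, \<xi>) \<in> N \<and> N \<subseteq> U \<times> X \<and> f \<in> ?F N \<and>
        (\<forall>p\<in>N. d k q p = stalk_class XX_top ?F (?G k) p f \<and>
          d (k - 1) (jet_proj (k - 1) n q) p = stalk_class XX_top ?F (?G (k - 1)) p f)"
      using N(1-3) by (intro exI[of _ N] exI[of _ "\<lambda>y. f y - ?\<sigma> y"]) blast
  qed simp
  then show ?thesis
    unfolding jet_iso_def Let_def \<sigma>' \<sigma>_def[symmetric] d_def by simp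
qed

end

theorem proposition3p4:
  fixes scale :: "complex \<Rightarrow> 'v::ab_group_add \<Rightarrow> 'v"
    and \<omega> :: "('v \<Rightarrow> complex) \<Rightarrow> ('v \<Rightarrow> complex) \<Rightarrow> complex"
    and k n :: nat
  assumes "oriented_plane scale \<omega>" and "k > n"
  shows "(k - 1 > n \<longrightarrow>
           (\<forall>U. openin (complex_plane.X_top scale) U \<longrightarrow>
             (\<forall>q \<in> complex_plane.Jet scale k n U.
                oriented_plane.jet_iso scale \<omega> (k - 1) n U (complex_plane.jet_proj scale (k - 1) n q) =
                map_prod (\<lambda>\<sigma>. \<sigma>) (oriented_plane.contraction scale \<omega> (k - n - 1) U)
                  (oriented_plane.jet_iso scale \<omega> k n U q)))) \<and>
         (k - 1 = n \<longrightarrow>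
           (\<forall>U. openin (complex_plane.X_top scale) U \<longrightarrow>
             (\<forall>q \<in> complex_plane.Jet scale k n U.
                complex_plane.jet_iso_n scale n U (complex_plane.jet_proj scale (k - 1) n q) =
                (case oriented_plane.jet_iso scale \<omega> k n U q of
                   (\<sigma>, t) \<Rightarrow> (\<lambda>\<xi> y. \<sigma> \<xi> y + 0)))))"
proof -
  interpret oriented_plane scale \<omega> by fact
  show ?thesis
  proof (intro conjI impI allI ballI)
    fix U q assume "k - 1 > n" "openin X_top U" "q \<in> Jet k n U"
    then show "jet_iso (k - 1) n U (jet_proj (k - 1) n q) =
        map_prod (\<lambda>\<sigma>. \<sigma>) (contraction (k - n - 1) U) (jet_iso k n U q)"
      by (rule jet_iso_projection)
  next
    \<comment> \<open>Here the projection is the very one that defines \<open>\<beta>\<close>, the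
      first component of \<open>jet_iso\<close>; the added 0 is the zero homomorphism on the second
      component.\<close>
    fix U q assume "k - 1 = n"
    then show "jet_iso_n n U (jet_proj (k - 1) n q) =
        (case jet_iso k n U q of (\<sigma>, t) \<Rightarrow> (\<lambda>\<xi> y. \<sigma> \<xi> y + 0))"
      by (simp add: jet_iso_def \<beta>_def Let_def)
  qed
qed

end
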